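(* Let $x,y$ be nonnegative integers and let $F_1$, $F_2$ be two ferns consisting of triangles of side-lengths $a_1,\dots,a_m$ and $c_1,\dots,c_k$ from left to right, respectively. Assume in addition that $m$ is odd and $k$ is even (the other cases can be obtained from this case by appending a triangle of side-length $0$ to the end of the corresponding fern). Put $a=a_1+a_2+\cdots$, $c=c_1+c_2+\cdots$, and, when $x+y$ is odd, $$\sigma=s\Big(a_1,\dots,a_m,\tfrac{x+y-1}{2},c_1,\dots,c_{k-1},\,c_k+1,\,c_k,c_{k-1},\dots,c_2,\;c_1+\tfrac{x+y-1}{2}+a_m,\;a_{m-1},\dots,a_1\Big).$$ (a) If $x$ is odd and $y$ is even, then $$M_c\Big(E'_{x,y}\big(F_1,F_2\,|\,\tfrac{x+y-1}{2}\big)\Big)=\frac{\sigma}{PP\left(a,\frac{x+y-1}{2},c\right)}\,M_c(B'_{y+2a+c,\,x+c,\,y+c,\,c})$$ $$=\frac{\sigma}{PP\left(a,\frac{x+y-1}{2},c\right)}\,PP\Big(\tfrac{x+2c+1}{2},\tfrac y2,c\Big)\prod_{i=1}^{\frac{x-1}{2}}\frac{(\frac{y+2a}{2}+i)_c}{(i)_c}\prod_{i=1}^{\frac y2}\frac{(\frac{y+2a+2c}{2}+i)_{\frac{x-1}{2}}}{(c+i)_{\frac{x-1}{2}}}\cdot\frac{(\frac{y+2a+2c}{2}+i)_{\frac{x+2c+1}{2}}}{(c+i)_{\frac{x+2c+1}{2}}}.$$ (b) If $x$ is even and $y$ is odd, then $$M_c\Big(E'_{x,y}\big(F_1,F_2\,|\,\tfrac{x+y-1}{2}\big)\Big)=\frac{\sigma}{PP\left(a,\frac{x+y-1}{2},c\right)}\,M_c(B'_{y+2a+c,\,x+c,\,y+c,\,c})$$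 $$=\frac{\sigma}{PP\left(a,\frac{x+y-1}{2},c\right)}\,PP\Big(\tfrac{x+2c}{2},\tfrac{y-1}{2},c+1\Big)\prod_{i=0}^{\frac{y-1}{2}}\frac{(\frac{y+2a+1}{2}+i)_c}{(c+i+1)_c}\prod_{i=1}^{\frac x2}\frac{(\frac{y+2a-1}{2}+i)_{\frac{y+2c+1}{2}}}{(i)_{\frac{y+2c+1}{2}}}\cdot\frac{(\frac{y+2a+2c+1}{2}+c+i)_{\frac{y-1}{2}}}{(2c+i+1)_{\frac{y+2c+1}{2}}}.$$
   Context: Work on the triangular lattice with unit equilateral triangles, one family of lattice lines being horizontal. A lozenge is the union of two unit triangles sharing an edge; $M_c(R)$ is the number of lozenge tilings of a region $R$ that are centrally symmetric (invariant under the $180^\circ$ rotation about the symmetry center of $R$). Side-lengths of a hexagon (all angles $120^\circ$) or trapezoid are listed clockwise from the north side. A fern is a finite chain of lattice triangles of alternating orientations placed consecutively along a horizontal lattice line: each up-pointing triangle stands above the line with its base on it, each down-pointing triangle hangs below the line with its horizontal side on it, and the horizontal sides of consecutive triangles are adjacent segments of the line. Triangles of side-length $0$ are allowed. $E'_{x,y}(F_1,F_2\,|\,\frac{x+y-1}{2})$ (for $x+y$ odd): with $a,c$ the total side-lengths of $F_1,F_2$, take the hexagon of side-lengths $x+a+c,\ y+a+c,\ y+a+c,\ x+a+c,\ y+a+c,\ y+a+c$. Its axis is the horizontal segment joining its west and east vertices, of length $x+y+2a+2c$; its midpoint is the symmetry center, which is the midpoint of a unit lattice segment. Along the axis remove $F_1$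 starting at the west vertex, $F_2$ ending at the lattice point $1/2$ unit to the left of the symmetry center (so the gap between $F_1$ and $F_2$ has length $\frac{x+y-1}{2}$), and the images of $F_1$ and $F_2$ under the $180^\circ$ rotation about the symmetry center. $B'_{p,q,r,k}$ (up to congruence): the hexagon of side-lengths $q,p,r,q,p,r$, where $p$ and $r$ have the same parity and $q$ the opposite parity, with two triangles of side-length $k$ removed along the horizontal line through its center: an up-pointing triangle whose bottom-right vertex is the lattice point $1/2$ unit to the left of the center, and a down-pointing triangle whose top-left vertex is the lattice point $1/2$ unit to the right of the center. $s(b_1,\dots,b_l)$ is the number of lozenge tilings of the region $S(b_1,\dots,b_l)$ obtained as follows: with $o=b_1+b_3+b_5+\cdots$ and $e=b_2+b_4+\cdots$, take the trapezoid of side-lengths $e,\ o,\ o+e,\ o$ (long base at the bottom), divide the base from left to right into consecutive segments of lengths $b_1,b_2,\dots,b_l$, and remove the up-pointing triangles of side-lengths $b_1,b_3,b_5,\dots$ standing on the odd-indexed segments. $PP(a,b,c):=\prod_{i=1}^{a}\prod_{j=1}^{b}\prod_{k=1}^{c}\frac{i+j+k-1}{i+j+k-2}$, and $(z)_j:=z(z+1)\cdots(z+j-1)$, $(z)_0:=1$; empty products equal $1$.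
   Formalization: In (b) the printed product is false (x=2, y=1, a=c=0 gives 1/2, not 1). Corrected: first product runs over i=1..(y-1)/2 with numerator ((y+2a+2c+1)/2+i)_c, and the last denominator is (2c+i+1)_{(y-1)/2}. Ferns start with an up-pointing triangle (side 0 allowed). *)

theory Defs
  imports Complex_Main "HOL-Library.Disjoint_Sets"
begin

(* The pair (i, j) stands for the lattice point i * u + j * w, where u is the unit vector
   pointing east and w the unit vector at 60 degrees. Up (i, j) stands on the segment from
   (i, j) to (i + 1, j), and Down (i, j) hangs from that same segment. *)

type_synonym point = "int \<times> int"

datatype unit_triangle = Up point | Down point

fun verts :: "unit_triangle \<Rightarrow> point set" where
  "verts (Up (i, j)) = {(i, j), (i + 1, j), (i, j + 1)}"
| "verts (Down (i, j)) = {(i, j), (i + 1, j), (i + 1, j - 1)}"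

type_synonym region = "unit_triangle set"

(* Used for sets P of lattice points cut out by inequalities on i, j and i + j, that is, by
   half-planes bounded by lattice lines. *)
definition region_of :: "point set \<Rightarrow> region" where
  "region_of P = {t. verts t \<subseteq> P}"


subsection \<open>Lozenge tilings\<close>

definition lozenge :: "unit_triangle set \<Rightarrow> bool" where
  "lozenge L \<longleftrightarrow> (\<exists>t t'. t \<noteq> t' \<and> card (verts t \<inter> verts t') = 2 \<and> L = {t, t'})"

definition lozenge_tiling :: "region \<Rightarrow> unit_triangle set set \<Rightarrow> bool" where
  "lozenge_tiling R T \<longleftrightarrow> partition_on R T \<and> (\<forall>L\<in>T. lozenge L)"

definition num_tilings :: "region \<Rightarrow> nat" where
  "num_tilings R = card {T. lozenge_tiling R T}"

(* The rotation by 180 degrees about the point z / 2, i.e. v \<mapsto> z - v on lattice points. *)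
fun rot :: "point \<Rightarrow> unit_triangle \<Rightarrow> unit_triangle" where
  "rot (z1, z2) (Up (i, j)) = Down (z1 - i - 1, z2 - j)"
| "rot (z1, z2) (Down (i, j)) = Up (z1 - i - 1, z2 - j)"

lemma verts_rot: "verts (rot (z1, z2) t) = (\<lambda>(i, j). (z1 - i, z2 - j)) ` verts t"
  by (cases t) auto

(* The symmetry centre of R is z / 2. *)
definition Mc :: "point \<Rightarrow> region \<Rightarrow> nat" where
  "Mc z R = card {T. lozenge_tiling R T \<and> (`) (rot z) ` T = T}"


subsection \<open>Hexagons, triangles and ferns\<close>

(* Side-lengths a, b, c, a, b, c clockwise from the north side, west vertex at the origin;
   clockwise from there the vertices are
   (0, 0), (0, c), (a, c), (a + b, c - b), (a + b, -b), (b, -b). *)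
definition hexagon :: "nat \<Rightarrow> nat \<Rightarrow> nat \<Rightarrow> region" where
  "hexagon a b c = region_of {(i, j). 0 \<le> i \<and> i \<le> int a + int b \<and>
     - int b \<le> j \<and> j \<le> int c \<and> 0 \<le> i + j \<and> i + j \<le> int a + int c}"

(* Bottom-left vertex p, side-length n. *)
definition up_triangle :: "point \<Rightarrow> nat \<Rightarrow> region" where
  "up_triangle p n = region_of {(i, j). fst p \<le> i \<and> snd p \<le> j \<and> i + j \<le> fst p + snd p + int n}"

(* Top-left vertex p, side-length n. *)
definition down_triangle :: "point \<Rightarrow> nat \<Rightarrow> region" where
  "down_triangle p n = region_of {(i, j). i \<le> fst p + int n \<and> j \<le> snd p \<and> fst p + snd p \<le> i + j}"

(* The fern that starts at p, with side-lengths ns from left to right. Its first triangle points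
   up; a fern that starts with a down-pointing triangle has 0 as its first side-length. *)
definition fern :: "point \<Rightarrow> nat list \<Rightarrow> region" where
  "fern p ns = (\<Union>l<length ns.
     (if even l then up_triangle else down_triangle) (fst p + int (sum_list (take l ns)), snd p) (ns ! l))"


subsection \<open>The regions\<close>

definition E_center :: "nat \<Rightarrow> nat \<Rightarrow> nat list \<Rightarrow> nat list \<Rightarrow> point" where
  "E_center x y as cs = (int (x + y + 2 * sum_list as + 2 * sum_list cs), 0)"

(* For x + y odd. E_center is twice the symmetry centre, as required by rot and Mc. *)
definition E_region :: "nat \<Rightarrow> nat \<Rightarrow> nat list \<Rightarrow> nat list \<Rightarrow> region" where
  "E_region x y as cs =
    (let a = sum_list as; c = sum_list cs;
         F = fern (0, 0) as \<union> fern (int (a + (x + y - 1) div 2), 0) cs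
     in hexagon (x + a + c) (y + a + c) (y + a + c) - F - rot (E_center x y as cs) ` F)"

definition B_center :: "nat \<Rightarrow> nat \<Rightarrow> nat \<Rightarrow> point" where
  "B_center p q r = (int p + int q, int r - int p)"

(* For p, r of the same parity and q of the opposite parity. The symmetry centre
   ((p + q) / 2, (r - p) / 2) is then the midpoint of a unit segment of a horizontal lattice line. *)
definition B_region :: "nat \<Rightarrow> nat \<Rightarrow> nat \<Rightarrow> nat \<Rightarrow> region" where
  "B_region p q r k =
    (let h = (int r - int p) div 2
     in hexagon q p r
        - up_triangle ((int p + int q - 1) div 2 - int k, h) k
        - down_triangle ((int p + int q + 1) div 2, h) k)"

(* Side-lengths e, o, o + e, o clockwise from the north side, bottom-left vertex at the origin. *)
definition trapezoid :: "nat \<Rightarrow> nat \<Rightarrow> region" where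
  "trapezoid e od = region_of {(i, j). 0 \<le> i \<and> 0 \<le> j \<and> j \<le> int od \<and> i + j \<le> int od + int e}"

(* List positions start at 0, so b_1, b_3, b_5, ... sit at the even positions. *)
definition S_region :: "nat list \<Rightarrow> region" where
  "S_region bs =
    (let od = (\<Sum>l | l < length bs \<and> even l. bs ! l);
         e = (\<Sum>l | l < length bs \<and> odd l. bs ! l)
     in trapezoid e od
        - (\<Union>l\<in>{l. l < length bs \<and> even l}. up_triangle (int (sum_list (take l bs)), 0) (bs ! l)))"

definition s :: "nat list \<Rightarrow> nat" where
  "s bs = num_tilings (S_region bs)"

definition PP :: "nat \<Rightarrow> nat \<Rightarrow> nat \<Rightarrow> real" where
  "PP a b c = (\<Prod>i=1..a. \<Prod>j=1..b. \<Prod>k=1..c.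
     (real i + real j + real k - 1) / (real i + real j + real k - 2))"

end

theory Submission
  imports Defs "Jordan_Normal_Form.Determinant"
begin

text \<open>
Why the theorem is true. Cut a centrally symmetric region along its horizontal axis. A centrally
symmetric tiling is determined by its upper half, and the only freedom at the cut is the set \<open>S\<close> of
unit segments crossed by lozenges, which has to be invariant under the reflection in the centre
(\<open>Mc_cut\<close>). In the upper half, the lozenges inside the up-pointing holes are forced
(\<open>num_tilings_holes_forced\<close>), so what is left is a trapezoid whose base has a set \<open>D\<close> of unit dents.
By the theorem of Cohn, Larsen and Propp the number of its tilings is the Vandermonde product of
\<open>D\<close> divided by a superfactorial (\<open>num_tilings_trap\<close>). Here it is obtained row by row: the dents of
consecutive rows interlace, and summing a Vandermonde determinant over interlacing sequences gives a
Vandermonde determinant of one size more.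

Let \<open>U\<close> be the set of dents coming from the ferns. Then the Vandermonde product of \<open>U \<union> S\<close> is that of
\<open>U\<close>, times that of \<open>S\<close>, times the product of \<open>\<bar>u - t\<bar>\<close> over \<open>u \<in> U\<close> and \<open>t \<in> S\<close>. As \<open>S\<close> is symmetric,
the last product does not change when an element of \<open>U\<close> is replaced by its mirror image. For every
position covered by one of the two ferns, \<open>U\<close> contains exactly one of this position and its mirror
image, according to the orientation of the covering triangle. Hence the sum over \<open>S\<close>
(\<open>gap_sum\<close>) only depends on the total lengths \<open>a\<close>, \<open>c\<close> of the ferns and on the gap, and the shape of the
ferns enters through the Vandermonde product of \<open>U\<close> alone. This product is, up to a
superfactorial, the sequence count \<open>\<sigma>\<close>. The region with two removed triangles has the same gap sum,
with the two blocks of lengths \<open>a\<close> and \<open>c\<close> in place of \<open>U\<close>, and the Vandermonde product of two blocks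
at distance \<open>g\<close> is \<open>PP a g c\<close> up to the same superfactorial. This is the first equality.

For the second equality, write the positions of \<open>S\<close> as \<open>M \<plusminus> t\<close> with \<open>M\<close> the centre. The gap sum becomes
a discrete Selberg sum: a sum over \<open>n\<close>-subsets of \<open>{c+1..c+g}\<close> of a weight times the squared
Vandermonde product in the squares \<open>t\<^sup>2\<close>. By the identity of Andreief (\<open>andreief_subsets\<close>) it is a
determinant of moments with respect to any two families of monic polynomials. Taking for one family
the products of \<open>t\<^sup>2 - (c+1)\<^sup>2, t\<^sup>2 - (c+2)\<^sup>2, \<dots>\<close> and for the other, up to signs, those of
\<open>(c+g)\<^sup>2 - t\<^sup>2, (c+g-1)\<^sup>2 - t\<^sup>2, \<dots>\<close>, multiplication by a member of a family
merely shifts the parameters of the weight, so all moments are given by one closed formula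
(\<open>gap_moment_Suc\<close>). Up to row and column factors they are the binomial coefficients
\<open>N choose (B + i + j)\<close>, whose determinant is classical (\<open>det_hankel_binomial\<close>). What remains is to
compare two products of factorials, which is done by expressing both as quotients of superfactorials.
\<close>

section \<open>Vandermonde determinants\<close>

definition seq_vandermonde :: "(nat \<Rightarrow> real) \<Rightarrow> nat \<Rightarrow> real" where
  "seq_vandermonde x n = (\<Prod>j<n. \<Prod>i<j. (x j - x i))"

lemma det_leibniz:
  fixes f :: "nat \<Rightarrow> nat \<Rightarrow> real"
  shows "det (mat n n (\<lambda>(i,j). f i j))
     = (\<Sum>p | p permutes {..<n}. of_int (sign p) * (\<Prod>i<n. f i (p i)))"
proof -
  have "p i < n" if "p permutes {..<n}" "i < n" for p i
    using permutes_in_image[OF that(1)] that(2) by auto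
  then show ?thesis
    by (subst det_def'[of _ n]) (auto simp: atLeast0LessThan intro!: sum.cong prod.cong)
qed

lemma det_lower_unit_triangular:
  assumes "\<And>i j. i < j \<Longrightarrow> j < n \<Longrightarrow> f i j = (0::real)" "\<And>i. i < n \<Longrightarrow> f i i = 1"
  shows "det (mat n n (\<lambda>(i,j). f i j)) = 1"
proof -
  have "det (mat n n (\<lambda>(i,j). f i j)) = prod_list (diag_mat (mat n n (\<lambda>(i,j). f i j)))"
    by (rule det_lower_triangular[of n]) (use assms in auto)
  also have "\<dots> = 1"
    unfolding prod_list_diag_prod using assms by simp
  finally show ?thesis .
qed

text \<open>Passing from powers to another monic family multiplies by a unitriangular matrix.\<close>

lemma det_monic_vandermonde_aux:
  fixes p :: "nat \<Rightarrow> real poly"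
  assumes "\<And>j. degree (p j) = j" and "\<And>j. coeff (p j) j = 1"
  shows "det (mat n n (\<lambda>(i,j). poly (p j) (x i))) = det (mat n n (\<lambda>(i,j). x i ^ j))"
proof -
  let ?X = "mat n n (\<lambda>(i,j). x i ^ j)"
  let ?C = "mat n n (\<lambda>(k,j). coeff (p j) k)"
  have eq: "mat n n (\<lambda>(i,j). poly (p j) (x i)) = ?X * ?C"
  proof (rule eq_matI)
    fix i j assume ij: "i < dim_row (?X * ?C)" "j < dim_col (?X * ?C)"
    then have ij': "i < n" "j < n" by auto
    have "poly (p j) (x i) = (\<Sum>k\<le>j. coeff (p j) k * x i ^ k)"
      using assms by (simp add: poly_altdef)
    also have "\<dots> = (\<Sum>k<n. x i ^ k * coeff (p j) k)"
      by (rule sum.mono_neutral_cong_left)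
        (use assms ij' in \<open>auto simp: coeff_eq_0\<close>)
    also have "\<dots> = (?X * ?C) $$ (i,j)"
      using ij' by (simp add: scalar_prod_def atLeast0LessThan)
    finally show "mat n n (\<lambda>(i,j). poly (p j) (x i)) $$ (i,j) = (?X * ?C) $$ (i,j)"
      using ij' by simp
  qed auto
  have "det ?C = prod_list (diag_mat ?C)"
    by (rule det_upper_triangular[of _ n]) (use assms in \<open>auto simp: coeff_eq_0\<close>)
  also have "\<dots> = 1"
    unfolding prod_list_diag_prod using assms by simp
  finally show ?thesis unfolding eq by (subst det_mult[of _ n]) auto
qed

lemma monic_prod_linear:
  fixes t :: "nat \<Rightarrow> real"
  shows "degree (\<Prod>l<j. [:- t l, 1:]) = j" and "coeff (\<Prod>l<j. [:- t l, 1:]) j = 1"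
proof -
  show d: "degree (\<Prod>l<j. [:- t l, 1:]) = j" by (simp add: degree_prod_eq_sum_degree)
  have "lead_coeff (\<Prod>l<j. [:- t l, 1:]) = 1" by (subst lead_coeff_prod) simp
  then show "coeff (\<Prod>l<j. [:- t l, 1:]) j = 1" unfolding d .
qed

text \<open>For the Newton basis at the nodes \<open>x 0, x 1, \<dots>\<close> the matrix is triangular, so its determinant
can be read off.\<close>

lemma det_monic_vandermonde:
  fixes p :: "nat \<Rightarrow> real poly"
  assumes "\<And>j. degree (p j) = j" and "\<And>j. coeff (p j) j = 1"
  shows "det (mat n n (\<lambda>(i,j). poly (p j) (x i))) = seq_vandermonde x n"
proof -
  \<comment> \<open>the Newton basis\<close>
  define N where "N j = (\<Prod>l<j. [:- x l, 1:])" for j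
  have N: "degree (N j) = j" "coeff (N j) j = 1" for j
    unfolding N_def by (rule monic_prod_linear)+
  have "det (mat n n (\<lambda>(i,j). poly (p j) (x i))) = det (mat n n (\<lambda>(i,j). poly (N j) (x i)))"
    using det_monic_vandermonde_aux[OF assms] det_monic_vandermonde_aux[OF N] by simp
  also have "\<dots> = prod_list (diag_mat (mat n n (\<lambda>(i,j). poly (N j) (x i))))"
    by (rule det_lower_triangular[of n]) (auto simp: N_def poly_prod)
  also have "\<dots> = seq_vandermonde x n"
    unfolding prod_list_diag_prod seq_vandermonde_def by (simp add: N_def poly_prod atLeast0LessThan)
  finally show ?thesis .
qed

lemma det_scale_rows_cols:
  fixes f :: "nat \<Rightarrow> nat \<Rightarrow> real"
  shows "det (mat n n (\<lambda>(i,j). r i * c j * f i j))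
     = (\<Prod>i<n. r i) * (\<Prod>j<n. c j) * det (mat n n (\<lambda>(i,j). f i j))"
proof -
  have "(\<Prod>i<n. r i * c (p i) * f i (p i)) = (\<Prod>i<n. r i) * (\<Prod>j<n. c j) * (\<Prod>i<n. f i (p i))"
    if p: "p permutes {..<n}" for p
    using prod.permute[OF p, of c] by (simp add: comp_def prod.distrib)
  then show ?thesis
    unfolding det_leibniz sum_distrib_left by (intro sum.cong) (auto simp: mult_ac)
qed

text \<open>Multilinearity in the rows, with a separate range of summation for each row.\<close>

lemma det_sum_rows:
  fixes f :: "'a \<Rightarrow> nat \<Rightarrow> nat \<Rightarrow> real"
  assumes "\<And>i. i < n \<Longrightarrow> finite (A i)"
  shows "det (mat n n (\<lambda>(i,j). \<Sum>e\<in>A i. f e i j))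
     = (\<Sum>e\<in>PiE {..<n} A. det (mat n n (\<lambda>(i,j). f (e i) i j)))"
proof -
  have "det (mat n n (\<lambda>(i,j). \<Sum>e\<in>A i. f e i j))
     = (\<Sum>p | p permutes {..<n}. of_int (sign p) * (\<Sum>e\<in>PiE {..<n} A. \<Prod>i<n. f (e i) i (p i)))"
    unfolding det_leibniz by (subst prod_sum_PiE) (use assms in auto)
  also have "\<dots> = (\<Sum>e\<in>PiE {..<n} A. \<Sum>p | p permutes {..<n}. of_int (sign p) * (\<Prod>i<n. f (e i) i (p i)))"
    by (simp add: sum_distrib_left) (rule sum.swap)
  finally show ?thesis by (simp add: det_leibniz)
qed

text \<open>The basis on which summation over integer intervals acts as simply as integration acts on
powers.\<close>

definition falling_poly :: "nat \<Rightarrow> real poly" where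
  "falling_poly j = (\<Prod>l<j. [:- real l, 1:])"

lemma falling_poly_monic: "degree (falling_poly j) = j" "coeff (falling_poly j) j = 1"
  unfolding falling_poly_def by (rule monic_prod_linear)+

lemma poly_falling_poly: "poly (falling_poly j) x = (\<Prod>l<j. x - real l)"
  unfolding falling_poly_def by (simp add: poly_prod)

lemma falling_poly_step: "poly (falling_poly (Suc j)) (x + 1) - poly (falling_poly (Suc j)) x = real (Suc j)
    * poly (falling_poly j) x"
proof -
  have "poly (falling_poly (Suc j)) (x + 1) = (x + 1) * poly (falling_poly j) x"
    unfolding poly_falling_poly by (subst prod.lessThan_Suc_shift) (simp add: algebra_simps)
  moreover have "poly (falling_poly (Suc j)) x = poly (falling_poly j) x * (x - real j)"
    unfolding poly_falling_poly by simp
  ultimately show ?thesis by (simp add: algebra_simps)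
qed

lemma sum_falling_poly:
  fixes u v :: int
  assumes "u \<le> v"
  shows "(\<Sum>e\<in>{u..<v}. poly (falling_poly j) (of_int e))
     = (poly (falling_poly (Suc j)) (of_int v) - poly (falling_poly (Suc j)) (of_int u)) / real (Suc j)"
  using assms
proof (induction v rule: int_ge_induct)
  case (step v)
  have "{u..<v+1} = insert v {u..<v}" using step by auto
  then show ?case using step falling_poly_step[of j "of_int v"] by (simp add: field_simps)
qed simp

text \<open>Write the Vandermonde product as a determinant in falling factorials and sum row \<open>k\<close> over its
interval. Each entry becomes a difference of two falling factorials of one degree more. The
resulting matrix of differences is what row operations leave of the Vandermonde matrix of \<open>d\<close> after
its first column, which consists of ones, has been cleared. The factor \<open>fact n\<close> collects the
denominators of the summation.\<close>

lemma sum_seq_vandermonde_interlacing: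
  fixes d :: "nat \<Rightarrow> int"
  assumes "\<And>k. k < n \<Longrightarrow> d k \<le> d (Suc k)"
  shows "(\<Sum>e\<in>PiE {..<n} (\<lambda>k. {d k..<d (Suc k)}). seq_vandermonde (\<lambda>i. of_int (e i)) n)
     = seq_vandermonde (\<lambda>i. of_int (d i)) (Suc n) / fact n"
proof -
  let ?F = "\<lambda>i j. poly (falling_poly j) (of_int (d i))"
  have "(\<Sum>e\<in>PiE {..<n} (\<lambda>k. {d k..<d (Suc k)}). seq_vandermonde (\<lambda>i. of_int (e i)) n)
     = (\<Sum>e\<in>PiE {..<n} (\<lambda>k. {d k..<d (Suc k)}). det (mat n n (\<lambda>(i,j). poly (falling_poly j) (of_int (e i)))))"
    by (subst det_monic_vandermonde[of falling_poly]) (simp_all add: falling_poly_monic)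
  also have "\<dots> = det (mat n n (\<lambda>(i,j). \<Sum>e\<in>{d i..<d (Suc i)}. poly (falling_poly j) (of_int e)))"
    by (subst det_sum_rows) auto
  also have "\<dots> = det (mat n n (\<lambda>(i,j). 1 * (1 / real (Suc j)) * (?F (Suc i) (Suc j) - ?F i (Suc j))))"
    by (intro arg_cong[of _ _ det] cong_mat) (auto simp: sum_falling_poly assms)
  also have "\<dots> = det (mat n n (\<lambda>(i,j). ?F (Suc i) (Suc j) - ?F i (Suc j))) / fact n"
    by (subst det_scale_rows_cols) (simp add: prod_dividef fact_prod_Suc atLeast0LessThan)
  also have "det (mat n n (\<lambda>(i,j). ?F (Suc i) (Suc j) - ?F i (Suc j)))
      = seq_vandermonde (\<lambda>i. of_int (d i)) (Suc n)"
  proof -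
    \<comment> \<open>Multiplying by \<open>?L\<close> subtracts from every row of \<open>?W\<close> the previous row.\<close>
    let ?W = "mat (Suc n) (Suc n) (\<lambda>(i,j). ?F i j)"
    let ?L = "mat (Suc n) (Suc n) (\<lambda>(i,k). (if k = i then 1 else if Suc k = i then - 1 else 0 :: real))"
    let ?V = "mat (Suc n) (Suc n) (\<lambda>(i,j). if i = 0 then ?F i j else ?F i j - ?F (i - 1) j)"
    have LW: "?L * ?W = ?V"
    proof (rule eq_matI)
      fix i j assume "i < dim_row ?V" "j < dim_col ?V"
      then have ij: "i < Suc n" "j < Suc n" by auto
      have "(?L * ?W) $$ (i,j) = (\<Sum>k<Suc n. (if k = i then ?F k j else 0) - (if Suc k = i then ?F k j else 0))"
        using ij by (auto simp: scalar_prod_def atLeast0LessThan intro!: sum.cong simp del: sum.lessThan_Suc)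
      also have "\<dots> = ?V $$ (i,j)"
        using ij by (cases i) (auto simp: sum_subtractf simp del: sum.lessThan_Suc)
      finally show "(?L * ?W) $$ (i,j) = ?V $$ (i,j)" .
    qed auto
    have detL: "det ?L = 1" by (rule det_lower_unit_triangular) auto
    have "seq_vandermonde (\<lambda>i. of_int (d i)) (Suc n) = det ?W"
      by (subst det_monic_vandermonde[of falling_poly]) (simp_all add: falling_poly_monic)
    also have "\<dots> = det ?V"
      unfolding LW[symmetric] by (subst det_mult[of _ "Suc n"]) (auto simp: detL)
    also have "\<dots> = (\<Sum>i<Suc n. ?V $$ (i,0) * cofactor ?V i 0)"
      by (rule laplace_expansion_column) auto
    also have "\<dots> = ?V $$ (0,0) * cofactor ?V 0 0"
      by (subst sum.lessThan_Suc_shift) (auto simp: poly_falling_poly intro!: sum.neutral)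
    also have "\<dots> = det (mat n n (\<lambda>(i,j). ?F (Suc i) (Suc j) - ?F i (Suc j)))"
      by (auto simp: cofactor_def mat_delete_def poly_falling_poly[of 0] intro!: arg_cong[of _ _ det])
    finally show ?thesis by simp
  qed
  finally show ?thesis .
qed

section \<open>Products over pairs and the identity of Andreief\<close>

text \<open>Ordering the pairs avoids counting them twice. The order is immaterial for the symmetric \<open>f\<close>
considered below.\<close>

definition pair_prod :: "('a::linorder \<Rightarrow> 'a \<Rightarrow> real) \<Rightarrow> 'a set \<Rightarrow> real" where
  "pair_prod f D = (\<Prod>p\<in>D. \<Prod>q\<in>{q\<in>D. p < q}. f p q)"

lemma pair_prod_empty [simp]: "pair_prod f {} = 1"
  by (simp add: pair_prod_def)

lemma pair_prod_insert:
  assumes fin: "finite D" and z: "z \<notin> D" and sym: "\<And>p q. f p q = f q p"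
  shows "pair_prod f (insert z D) = pair_prod f D * (\<Prod>q\<in>D. f z q)"
proof -
  have a: "(\<Prod>q\<in>{q\<in>insert z D. p < q}. f p q)
      = (\<Prod>q\<in>{q\<in>D. p < q}. f p q) * (if p < z then f p z else 1)" if "p \<in> D" for p
  proof (cases "p < z")
    case True
    then have "{q\<in>insert z D. p < q} = insert z {q\<in>D. p < q}" by auto
    then show ?thesis using True z fin by simp
  next
    case False
    then have "{q\<in>insert z D. p < q} = {q\<in>D. p < q}" by auto
    then show ?thesis using False by simp
  qed
  have b: "{q\<in>insert z D. z < q} = {q\<in>D. z < q}" by auto
  have "pair_prod f (insert z D) = (\<Prod>q\<in>{q\<in>D. z < q}. f z q) *
     (\<Prod>p\<in>D. (\<Prod>q\<in>{q\<in>D. p < q}. f p q) * (if p < z then f p z else 1))"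
    unfolding pair_prod_def using fin z by (subst prod.insert) (auto simp only: b a cong: prod.cong)
  also have "\<dots> = pair_prod f D * ((\<Prod>q\<in>{q\<in>D. z < q}. f z q) * (\<Prod>p\<in>{p\<in>D. p < z}. f p z))"
    by (simp add: pair_prod_def prod.distrib prod.inter_filter fin)
  also have "(\<Prod>q\<in>{q\<in>D. z < q}. f z q) * (\<Prod>p\<in>{p\<in>D. p < z}. f p z)
     = (\<Prod>q\<in>{q\<in>D. z < q} \<union> {p\<in>D. p < z}. f z q)"
    by (subst prod.union_disjoint) (use fin sym in auto)
  also have "{q\<in>D. z < q} \<union> {p\<in>D. p < z} = D"
    using z by (auto intro: ccontr dest: linorder_neqE)
  finally show ?thesis .
qed

lemma pair_prod_union:
  assumes "finite A" "finite B" "A \<inter> B = {}" and sym: "\<And>p q. f p q = f q p"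
  shows "pair_prod f (A \<union> B) = pair_prod f A * pair_prod f B * (\<Prod>a\<in>A. \<Prod>b\<in>B. f a b)"
  using assms(1,3)
proof (induction A)
  case (insert x A)
  have "pair_prod f (insert x A \<union> B) = pair_prod f (A \<union> B) * (\<Prod>q\<in>A \<union> B. f x q)"
    using insert assms(2) by (simp add: pair_prod_insert[OF _ _ sym])
  also have "(\<Prod>q\<in>A \<union> B. f x q) = (\<Prod>q\<in>A. f x q) * (\<Prod>q\<in>B. f x q)"
    using insert assms(2) by (intro prod.union_disjoint) auto
  finally show ?case
    using insert assms(2) by (simp add: pair_prod_insert[OF _ _ sym])
qed simp

lemma pair_prod_enum:
  assumes "inj_on h {..<n::nat}" and sym: "\<And>p q. f p q = f q p"
  shows "pair_prod f (h ` {..<n}) = (\<Prod>j<n. \<Prod>i<j. f (h i) (h j))"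
  using assms(1)
proof (induction n)
  case (Suc n)
  have inj: "inj_on h {..<n}" and nin: "h n \<notin> h ` {..<n}"
    using Suc.prems by (auto simp: lessThan_Suc)
  have "pair_prod f (h ` {..<Suc n}) = pair_prod f (h ` {..<n}) * (\<Prod>q\<in>h ` {..<n}. f (h n) q)"
    using nin by (simp add: lessThan_Suc pair_prod_insert[OF _ _ sym])
  also have "(\<Prod>q\<in>h ` {..<n}. f (h n) q) = (\<Prod>i<n. f (h i) (h n))"
    using inj sym by (simp add: prod.reindex)
  finally show ?case using Suc.IH inj by simp
qed simp

lemma seq_vandermonde_permute:
  assumes "p permutes {..<n}"
  shows "seq_vandermonde (x \<circ> p) n = of_int (sign p) * seq_vandermonde x n"
proof -
  let ?A = "mat n n (\<lambda>(i,j). poly (falling_poly j) (x i))"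
  have "seq_vandermonde (x \<circ> p) n = det (mat n n (\<lambda>(i,j). poly (falling_poly j) ((x \<circ> p) i)))"
    by (subst det_monic_vandermonde[of falling_poly]) (simp_all add: falling_poly_monic)
  also have "mat n n (\<lambda>(i,j). poly (falling_poly j) ((x \<circ> p) i)) = mat n n (\<lambda>(i,j). ?A $$ (p i, j))"
    using permutes_in_image[OF assms] by (intro cong_mat) auto
  also have "det \<dots> = of_int (sign p) * det ?A"
    by (rule det_permute_rows) (use assms in \<open>auto simp: atLeast0LessThan\<close>)
  also have "det ?A = seq_vandermonde x n"
    by (subst det_monic_vandermonde[of falling_poly]) (simp_all add: falling_poly_monic)
  finally show ?thesis .
qed

lemma seq_vandermonde_eq_0:
  assumes "i < n" "j < n" "i \<noteq> j" "x i = x j"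
  shows "seq_vandermonde x n = 0"
proof -
  have *: "seq_vandermonde x n = 0" if "i < j" "j < n" "x i = x j" for i j
  proof -
    have "(\<Prod>i<j. (x j - x i)) = 0"
      by (subst prod_zero_iff) (use that in \<open>auto intro!: bexI[of _ i]\<close>)
    then show ?thesis unfolding seq_vandermonde_def by (subst prod_zero_iff) (use that in auto)
  qed
  from assms show ?thesis using *[of i j] *[of j i] by (cases "i < j") auto
qed

lemma det_monic_vandermonde_transpose:
  fixes p :: "nat \<Rightarrow> real poly"
  assumes "\<And>j. degree (p j) = j" and "\<And>j. coeff (p j) j = 1"
  shows "det (mat n n (\<lambda>(i,j). poly (p i) (x j))) = seq_vandermonde x n"
proof -
  have "mat n n (\<lambda>(i,j). poly (p i) (x j)) = transpose_mat (mat n n (\<lambda>(i,j). poly (p j) (x i)))"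
    by (auto simp: transpose_mat_def)
  then show ?thesis by (simp add: det_transpose[of _ n] det_monic_vandermonde assms)
qed

text \<open>For a fixed enumeration \<open>h\<close> of \<open>S\<close> the injective functions onto \<open>S\<close> are \<open>h \<circ> p\<close> with \<open>p\<close> a
permutation. The permutation changes one Vandermonde product by its sign, and the signed sum over
all \<open>p\<close> is the other Vandermonde determinant.\<close>

lemma sum_functions_onto:
  fixes w :: "'a::linorder \<Rightarrow> real" and \<phi> :: "'a \<Rightarrow> real" and P :: "nat \<Rightarrow> real poly"
  assumes S: "finite S" "card S = n"
    and P: "\<And>j. degree (P j) = j" "\<And>j. coeff (P j) j = 1"
  shows "(\<Sum>f\<in>{f \<in> {..<n} \<rightarrow>\<^sub>E S. inj_on f {..<n}}. (\<Prod>i<n. w (f i) * poly (P i) (\<phi> (f i)))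
      * seq_vandermonde (\<phi> \<circ> f) n)
     = (\<Prod>s\<in>S. w s) * (pair_prod (\<lambda>p q. \<bar>\<phi> q - \<phi> p\<bar>) S)\<^sup>2"
proof -
  obtain h where h: "bij_betw h {..<n} S"
    using ex_bij_betw_nat_finite[OF S(1)] S(2) by (auto simp: atLeast0LessThan)
  then have hinj: "inj_on h {..<n}" and him: "h ` {..<n} = S" by (auto simp: bij_betw_def)
  have bij: "bij_betw (\<lambda>p. restrict (h \<circ> p) {..<n}) {p. p permutes {..<n}} {f \<in> {..<n} \<rightarrow>\<^sub>E S. inj_on f {..<n}}"
  proof (rule bij_betw_imageI)
    show "inj_on (\<lambda>p. restrict (h \<circ> p) {..<n}) {p. p permutes {..<n}}"
    proof (rule inj_onI)
      fix p q assume pq: "p \<in> {p. p permutes {..<n}}" "q \<in> {p. p permutes {..<n}}"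
        "restrict (h \<circ> p) {..<n} = restrict (h \<circ> q) {..<n}"
      show "p = q"
      proof
        fix i
        show "p i = q i"
        proof (cases "i < n")
          case True
          then have "h (p i) = h (q i)" using fun_cong[OF pq(3), of i] by simp
          moreover have "p i < n" "q i < n"
            using True permutes_in_image[of p "{..<n}" i] permutes_in_image[of q "{..<n}" i] pq by auto
          ultimately show ?thesis using hinj by (auto simp: inj_on_def)
        qed (use pq in \<open>auto simp: permutes_def\<close>)
      qed
    qed
    show "(\<lambda>p. restrict (h \<circ> p) {..<n}) ` {p. p permutes {..<n}} = {f \<in> {..<n} \<rightarrow>\<^sub>E S. inj_on f {..<n}}"
    proof (intro subset_antisym subsetI)
      fix f assume "f \<in> (\<lambda>p. restrict (h \<circ> p) {..<n}) ` {p. p permutes {..<n}}"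
      then obtain p where p: "p permutes {..<n}" "f = restrict (h \<circ> p) {..<n}" by auto
      have "inj_on (h \<circ> p) {..<n}"
        using p(1) hinj by (intro comp_inj_on) (auto simp: permutes_image intro: permutes_inj_on)
      then show "f \<in> {f \<in> {..<n} \<rightarrow>\<^sub>E S. inj_on f {..<n}}"
        using p him permutes_in_image[OF p(1)] by (auto simp: inj_on_def)
    next
      fix f assume "f \<in> {f \<in> {..<n} \<rightarrow>\<^sub>E S. inj_on f {..<n}}"
      then have f: "f \<in> {..<n} \<rightarrow>\<^sub>E S" "inj_on f {..<n}" by auto
      define p where "p i = (if i < n then the_inv_into {..<n} h (f i) else i)" for i
      have hp: "p i < n \<and> h (p i) = f i" if "i < n" for i
      proof -
        have "f i \<in> h ` {..<n}" using f(1) that him by auto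
        then show ?thesis using that the_inv_into_into[OF hinj, of "f i" "{..<n}"] f_the_inv_into_f[OF hinj, of "f i"]
          by (auto simp: p_def)
      qed
      have "inj_on p {..<n}"
        using hp f(2) unfolding inj_on_def by (metis lessThan_iff)
      then have "bij_betw p {..<n} {..<n}"
        using hp by (intro bij_betw_imageI endo_inj_surj) auto
      then have "p permutes {..<n}"
        by (rule bij_imp_permutes) (auto simp: p_def)
      moreover have "f = restrict (h \<circ> p) {..<n}"
        using f(1) hp by (auto simp: restrict_def PiE_def extensional_def)
      ultimately show "f \<in> (\<lambda>p. restrict (h \<circ> p) {..<n}) ` {p. p permutes {..<n}}" by blast
    qed
  qed
  let ?G = "\<lambda>f. (\<Prod>i<n. w (f i) * poly (P i) (\<phi> (f i))) * seq_vandermonde (\<phi> \<circ> f) n"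
  have G: "?G (restrict (h \<circ> p) {..<n})
      = (\<Prod>s\<in>S. w s) * seq_vandermonde (\<phi> \<circ> h) n * (of_int (sign p) * (\<Prod>i<n. poly (P i) ((\<phi> \<circ> h) (p i))))"
    if p: "p permutes {..<n}" for p
  proof -
    have "seq_vandermonde (\<phi> \<circ> restrict (h \<circ> p) {..<n}) n = seq_vandermonde ((\<phi> \<circ> h) \<circ> p) n"
      unfolding seq_vandermonde_def by (intro prod.cong) auto
    moreover have "(\<Prod>i<n. w (h (p i))) = (\<Prod>s\<in>S. w s)"
      using prod.permute[OF p, of "w \<circ> h"] prod.reindex_bij_betw[OF h, of w] by (simp add: comp_def)
    ultimately show ?thesis by (simp add: seq_vandermonde_permute[OF p] prod.distrib)
  qed
  have "(\<Sum>f\<in>{f \<in> {..<n} \<rightarrow>\<^sub>E S. inj_on f {..<n}}. ?G f)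
      = (\<Sum>p | p permutes {..<n}. ?G (restrict (h \<circ> p) {..<n}))"
    by (rule sum.reindex_bij_betw[OF bij, symmetric])
  also have "\<dots> = (\<Prod>s\<in>S. w s) * seq_vandermonde (\<phi> \<circ> h) n
       * (\<Sum>p | p permutes {..<n}. of_int (sign p) * (\<Prod>i<n. poly (P i) ((\<phi> \<circ> h) (p i))))"
    unfolding sum_distrib_left by (rule sum.cong[OF refl], rule G) auto
  also have "(\<Sum>p | p permutes {..<n}. of_int (sign p) * (\<Prod>i<n. poly (P i) ((\<phi> \<circ> h) (p i))))
      = seq_vandermonde (\<phi> \<circ> h) n"
    using det_leibniz[of n "\<lambda>i j. poly (P i) ((\<phi> \<circ> h) j)"] by
        (simp add: det_monic_vandermonde_transpose P comp_def)
  also have "(\<Prod>s\<in>S. w s) * seq_vandermonde (\<phi> \<circ> h) n * seq_vandermonde (\<phi> \<circ> h) n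
      = (\<Prod>s\<in>S. w s) * (pair_prod (\<lambda>p q. \<bar>\<phi> q - \<phi> p\<bar>) S)\<^sup>2"
    unfolding him[symmetric]
    by (subst pair_prod_enum[OF hinj]) (simp_all add: seq_vandermonde_def abs_prod[symmetric] power2_eq_square)
  finally show ?thesis .
qed

text \<open>Expanding the determinant along its rows gives a sum over all functions from the row indices
to \<open>X\<close>. Functions that are not injective contribute a determinant with two equal rows, and the
others are grouped by their image.\<close>

lemma andreief_subsets:
  fixes w :: "'a::linorder \<Rightarrow> real" and \<phi> :: "'a \<Rightarrow> real" and P Q :: "nat \<Rightarrow> real poly"
  assumes X: "finite X"
    and P: "\<And>j. degree (P j) = j" "\<And>j. coeff (P j) j = 1"
    and Q: "\<And>j. degree (Q j) = j" "\<And>j. coeff (Q j) j = 1"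
  shows "(\<Sum>S | S \<subseteq> X \<and> card S = n. (\<Prod>s\<in>S. w s) * (pair_prod (\<lambda>p q. \<bar>\<phi> q - \<phi> p\<bar>) S)\<^sup>2)
     = det (mat n n (\<lambda>(i,j). \<Sum>x\<in>X. w x * poly (P i) (\<phi> x) * poly (Q j) (\<phi> x)))"
proof -
  let ?G = "\<lambda>f. (\<Prod>i<n. w (f i) * poly (P i) (\<phi> (f i))) * seq_vandermonde (\<phi> \<circ> f) n"
  let ?I = "{f \<in> {..<n} \<rightarrow>\<^sub>E X. inj_on f {..<n}}"
  have finI: "finite ?I" by (rule finite_subset[of _ "{..<n} \<rightarrow>\<^sub>E X"]) (use X in \<open>auto intro: finite_PiE\<close>)
  have "det (mat n n (\<lambda>(i,j). \<Sum>x\<in>X. w x * poly (P i) (\<phi> x) * poly (Q j) (\<phi> x)))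
     = (\<Sum>f\<in>{..<n} \<rightarrow>\<^sub>E X. det (mat n n (\<lambda>(i,j). (w (f i) * poly (P i) (\<phi> (f i))) * 1 * poly (Q j) ((\<phi> \<circ> f) i))))"
    by (subst det_sum_rows) (use X in auto)
  also have "\<dots> = (\<Sum>f\<in>{..<n} \<rightarrow>\<^sub>E X. ?G f)"
    by (subst det_scale_rows_cols) (simp add: det_monic_vandermonde Q comp_def)
  also have "\<dots> = (\<Sum>f\<in>?I. ?G f)"
  proof (rule sum.mono_neutral_right)
    show "\<forall>f\<in>({..<n} \<rightarrow>\<^sub>E X) - ?I. ?G f = 0"
    proof
      fix f assume "f \<in> ({..<n} \<rightarrow>\<^sub>E X) - ?I"
      then obtain i j where "i < n" "j < n" "i \<noteq> j" "f i = f j" by (auto simp: inj_on_def)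
      then have "seq_vandermonde (\<phi> \<circ> f) n = 0" by (intro seq_vandermonde_eq_0[of i n j]) auto
      then show "?G f = 0" by simp
    qed
  qed (use X in \<open>auto intro: finite_PiE\<close>)
  also have "\<dots> = (\<Sum>S | S \<subseteq> X \<and> card S = n. \<Sum>f\<in>{f\<in>?I. f ` {..<n} = S}. ?G f)"
    by (rule sum.group[symmetric]) (use X finI in \<open>auto simp: card_image PiE_def Pi_def\<close>)
  also have "\<dots> = (\<Sum>S | S \<subseteq> X \<and> card S = n. (\<Prod>s\<in>S. w s) * (pair_prod (\<lambda>p q. \<bar>\<phi> q - \<phi> p\<bar>) S)\<^sup>2)"
  proof (rule sum.cong[OF refl])
    fix S assume "S \<in> {S. S \<subseteq> X \<and> card S = n}"
    then have S: "S \<subseteq> X" "card S = n" "finite S" using X finite_subset by auto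
    have "{f\<in>?I. f ` {..<n} = S} = {f \<in> {..<n} \<rightarrow>\<^sub>E S. inj_on f {..<n}}"
    proof (intro subset_antisym subsetI)
      fix f assume f: "f \<in> {f \<in> {..<n} \<rightarrow>\<^sub>E S. inj_on f {..<n}}"
      then have "f ` {..<n} \<subseteq> S" "card (f ` {..<n}) = n" by (auto simp: card_image)
      then have "f ` {..<n} = S" using S by (intro card_subset_eq) auto
      then show "f \<in> {f\<in>?I. f ` {..<n} = S}" using f S by (auto simp: PiE_def)
    qed (auto simp: PiE_def)
    then show "(\<Sum>f\<in>{f\<in>?I. f ` {..<n} = S}. ?G f) = (\<Prod>s\<in>S. w s) * (pair_prod (\<lambda>p q. \<bar>\<phi> q - \<phi> p\<bar>) S)\<^sup>2"
      using sum_functions_onto[OF S(3,2) P, of w \<phi>] by simp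
  qed
  finally show ?thesis by simp
qed

section \<open>A Hankel determinant of binomial coefficients\<close>

text \<open>Vandermonde convolution in the form that describes iterated column additions in a binomial
matrix.\<close>

lemma sum_choose_mult_choose:
  "(\<Sum>l\<le>m. (m choose l) * (N choose (K + l))) = (N + m) choose (K + m)"
proof (induction m arbitrary: K)
  case (Suc m)
  have "(\<Sum>l\<le>Suc m. (Suc m choose l) * (N choose (K + l)))
     = (\<Sum>l\<le>m. (m choose l) * (N choose (K + l))) + (\<Sum>l\<le>m. (m choose l) * (N choose (K + Suc l)))"
  proof -
    have "(\<Sum>l\<le>Suc m. (Suc m choose l) * (N choose (K + l)))
       = (N choose K) + (\<Sum>l\<le>m. (m choose Suc l) * (N choose (K + Suc l)) + (m choose l) * (N choose (K
           + Suc l)))"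
      by (subst sum.atMost_Suc_shift) (simp add: algebra_simps)
    also have "\<dots> = (N choose K) + (\<Sum>l\<le>m. (m choose Suc l) * (N choose (K + Suc l))) + (\<Sum>l\<le>m. (m choose l)
        * (N choose (K + Suc l)))"
      by (simp add: sum.distrib)
    also have "(N choose K) + (\<Sum>l\<le>m. (m choose Suc l) * (N choose (K + Suc l))) = (\<Sum>l\<le>Suc m. (m choose l)
        * (N choose (K + l)))"
      by (subst sum.atMost_Suc_shift) simp
    finally show ?thesis by simp
  qed
  also have "\<dots> = (N + Suc m) choose (K + Suc m)"
    using Suc.IH[of K] Suc.IH[of "Suc K"] by simp
  finally show ?case .
qed simp

text \<open>If upper and lower index both grow by \<open>r\<close> and \<open>r + j\<close> is fixed, then the dependence of the
binomial coefficient on \<open>j\<close> is, apart from the factor \<open>fact (N + r)\<close>, polynomial of degree \<open>j\<close> in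
\<open>N - B - i\<close>. The truncated subtraction is harmless: the falling factorial vanishes when
\<open>j > N - B - i\<close>.\<close>

lemma choose_eq_falling:
  assumes "i \<le> N - B" "B \<le> N"
  shows "real ((N + r) choose (B + r + i + j))
    = fact (N + r) / (fact (B + r + i + j) * fact (N - B - i)) * poly (falling_poly j) (real (N - B - i))"
proof -
  define m where "m = N - B - i"
  have N: "N = B + i + m" using assms by (simp add: m_def)
  have ff: "poly (falling_poly j) (real m) = (if j \<le> m then fact m / fact (m - j) else 0)"
  proof (induction j)
    case (Suc j)
    have "poly (falling_poly (Suc j)) (real m) = poly (falling_poly j) (real m) * (real m - real j)"
      by (simp add: poly_falling_poly)
    also have "\<dots> = (if Suc j \<le> m then fact m / fact (m - Suc j) else 0)"
    proof (cases "Suc j \<le> m")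
      case True
      have "(fact (m - j) :: real) = real (m - j) * fact (m - Suc j)"
        using True by (simp add: fact_reduce)
      then show ?thesis using Suc.IH True by (simp add: of_nat_diff divide_simps)
    next
      case False
      then show ?thesis using Suc.IH by auto
    qed
    finally show ?case .
  qed (simp add: poly_falling_poly)
  show ?thesis
  proof (cases "j \<le> m")
    case True
    then have "B + r + i + j \<le> N + r" "N + r - (B + r + i + j) = m - j" by (auto simp: N)
    then show ?thesis using True ff unfolding m_def[symmetric] by (simp add: binomial_fact)
  next
    case False
    then show ?thesis using ff unfolding m_def[symmetric] by (simp add: binomial_eq_0 N)
  qed
qed

text \<open>Adding neighbouring columns repeatedly replaces column \<open>j\<close> by
\<open>N + (n - 1 - j) choose (B + n - 1 + i)\<close>. Now \<open>i\<close> and \<open>j\<close> occur together in one factorial only, and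
the matrix is a Vandermonde matrix in falling factorials up to row and column factors.\<close>

lemma det_hankel_binomial:
  assumes "B \<le> N" "n \<le> Suc (N - B)"
  shows "det (mat n n (\<lambda>(i,j). real (N choose (B + i + j))))
     = (\<Prod>j<n. (- 1) ^ j * fact j * fact (N + j) / (fact (B + n - 1 + j) * fact (N - B - j)))"
proof -
  let ?A = "mat n n (\<lambda>(i,j). real (N choose (B + i + j)))"
  let ?U = "mat n n (\<lambda>(l,j). if j \<le> l then real ((n - 1 - j) choose (l - j)) else 0)"
  let ?x = "\<lambda>i. real (N - B - i)"
  let ?r = "\<lambda>i. 1 / (fact (B + n - 1 + i) * fact (N - B - i)) :: real"
  let ?c = "\<lambda>j. fact (N + (n - 1 - j)) :: real"
  have detU: "det ?U = 1" by (rule det_lower_unit_triangular) auto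
  have AU: "?A * ?U = mat n n (\<lambda>(i,j). ?r i * ?c j * poly (falling_poly j) (?x i))"
  proof (rule eq_matI)
    fix i j assume "i < dim_row (mat n n (\<lambda>(i,j). ?r i * ?c j * poly (falling_poly j) (?x i)))"
      "j < dim_col (mat n n (\<lambda>(i,j). ?r i * ?c j * poly (falling_poly j) (?x i)))"
    then have ij: "i < n" "j < n" by auto
    have "(?A * ?U) $$ (i,j)
       = (\<Sum>l<n. real (N choose (B + i + l)) * (if j \<le> l then real ((n - 1 - j) choose (l - j)) else 0))"
      using ij by (simp add: scalar_prod_def atLeast0LessThan)
    also have "\<dots> = (\<Sum>l\<in>{j..<n}. real (N choose (B + i + l)) * real ((n - 1 - j) choose (l - j)))"
      by (rule sum.mono_neutral_cong_right) auto
    also have "\<dots> = (\<Sum>t\<le>n - 1 - j. real (N choose (B + i + (j + t))) * real ((n - 1 - j) choose t))"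
      by (rule sum.reindex_bij_witness[of _ "\<lambda>t. j + t" "\<lambda>l. l - j"]) (use ij in auto)
    also have "\<dots> = real (\<Sum>t\<le>n - 1 - j. ((n - 1 - j) choose t) * (N choose ((B + i + j) + t)))"
      by (simp add: mult_ac add_ac)
    also have "\<dots> = real ((N + (n - 1 - j)) choose (B + (n - 1 - j) + i + j))"
      unfolding sum_choose_mult_choose by (simp add: add_ac)
    also have "\<dots> = ?r i * ?c j * poly (falling_poly j) (?x i)"
      using ij assms by (subst choose_eq_falling) (auto simp: add_ac)
    finally show "(?A * ?U) $$ (i,j) = mat n n (\<lambda>(i,j). ?r i * ?c j * poly (falling_poly j) (?x i)) $$ (i,j)"
      using ij by simp
  qed auto
  have "det ?A = det (?A * ?U)" by (subst det_mult[of _ n]) (auto simp: detU)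
  also have "\<dots> = (\<Prod>i<n. ?r i) * (\<Prod>j<n. ?c j) * seq_vandermonde ?x n"
    unfolding AU by (subst det_scale_rows_cols) (simp add: det_monic_vandermonde falling_poly_monic)
  also have "(\<Prod>j<n. ?c j) = (\<Prod>j<n. fact (N + j))"
    by (rule prod.reindex_bij_witness[of _ "\<lambda>j. n - 1 - j" "\<lambda>j. n - 1 - j"]) auto
  also have "seq_vandermonde ?x n = (\<Prod>j<n. (- 1) ^ j * fact j)"
    unfolding seq_vandermonde_def
  proof (rule prod.cong[OF refl])
    fix j assume j: "j \<in> {..<n}"
    have "(\<Prod>i<j. (?x j - ?x i)) = (\<Prod>i<j. - 1 * real (Suc i))"
      by (rule prod.reindex_bij_witness[of _ "\<lambda>i. j - 1 - i" "\<lambda>i. j - 1 - i"])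
        (use j assms in \<open>auto simp: of_nat_diff\<close>)
    also have "\<dots> = (- 1) ^ j * fact j"
      by (subst prod.distrib) (simp add: fact_prod_Suc atLeast0LessThan)
    finally show "(\<Prod>i<j. (?x j - ?x i)) = (- 1) ^ j * fact j" .
  qed
  finally show ?thesis by (simp add: prod.distrib prod_dividef)
qed

section \<open>A discrete Selberg sum\<close>

text \<open>A position at distance \<open>t\<close> from the centre and its mirror image have, together, this product
of distances to the positions on one side of the centre at distances \<open>1, \<dots>, c\<close> and
\<open>c + g + 1, \<dots>, c + g + a\<close> from it, provided that \<open>t\<close> lies in the gap \<open>c < t \<le> c + g\<close>.\<close>

definition gap_weight :: "nat \<Rightarrow> nat \<Rightarrow> nat \<Rightarrow> nat \<Rightarrow> real" where
  "gap_weight c g a t = (\<Prod>p\<in>{1..c}. (real t)\<^sup>2 - (real p)\<^sup>2) * (\<Prod>p\<in>{c+g+1..c+g+a}. (real p)\<^sup>2 - (real t)\<^sup>2)"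

text \<open>The parameter \<open>\<delta>\<close> tells whether the centre itself belongs to the symmetric set; it contributes
an extra factor \<open>t\<^sup>2\<close>.\<close>

definition gap_moment :: "nat \<Rightarrow> nat \<Rightarrow> nat \<Rightarrow> nat \<Rightarrow> real" where
  "gap_moment \<delta> c g a = (\<Sum>s\<in>{c+1..c+g}. 2 * real s ^ (1 + 2 * \<delta>) * gap_weight c g a s)"

lemma gap_weight_Suc_inner: "gap_weight (Suc c) g a t = gap_weight c (Suc g) a t
    * ((real t)\<^sup>2 - (real (Suc c))\<^sup>2)"
  by (simp add: gap_weight_def)

lemma gap_weight_Suc_outer: "gap_weight c g (Suc a) t = gap_weight c (Suc g) a t * ((real (c + g
    + 1))\<^sup>2 - (real t)\<^sup>2)"
proof -
  have "{c+g+1..c+g+Suc a} = insert (c+g+1) {c+Suc g+1..c+Suc g+a}" by auto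
  then show ?thesis by (simp add: gap_weight_def)
qed

text \<open>The difference of \<open>(c+g+2)\<^sup>2 - t\<^sup>2\<close> and \<open>(c+1)\<^sup>2 - t\<^sup>2\<close> does not depend on \<open>t\<close>, and
multiplying the weight by one of these factors only shifts its parameters, up to sign. Each factor
vanishes at one end of the range of summation, which therefore shrinks accordingly.\<close>

lemma gap_moment_rec:
  "((real (c + g + 2))\<^sup>2 - (real (c + 1))\<^sup>2) * gap_moment \<delta> c (Suc (Suc g)) a
   = gap_moment \<delta> (Suc c) (Suc g) a + gap_moment \<delta> c (Suc g) (Suc a)"
proof -
  let ?v = "\<lambda>s. 2 * real s ^ (1 + 2 * \<delta>)"
  have 1: "gap_moment \<delta> (Suc c) (Suc g) a
     = (\<Sum>s\<in>{c+1..c+Suc (Suc g)}. ?v s * (gap_weight c (Suc (Suc g)) a s * ((real s)\<^sup>2 - (real (Suc c))\<^sup>2)))"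
  proof -
    have "{c+1..c+Suc (Suc g)} = insert (Suc c) {Suc c+1..Suc c+Suc g}" by auto
    then show ?thesis unfolding gap_moment_def gap_weight_Suc_inner by simp
  qed
  have 2: "gap_moment \<delta> c (Suc g) (Suc a)
     = (\<Sum>s\<in>{c+1..c+Suc (Suc g)}. ?v s * (gap_weight c (Suc (Suc g)) a s * ((real (c + Suc g
         + 1))\<^sup>2 - (real s)\<^sup>2)))"
  proof -
    have "{c+1..c+Suc (Suc g)} = insert (c+Suc g+1) {c+1..c+Suc g}" by auto
    then show ?thesis unfolding gap_moment_def gap_weight_Suc_outer by simp
  qed
  show ?thesis
    unfolding 1 2 sum.distrib[symmetric] unfolding gap_moment_def sum_distrib_left
    by (rule sum.cong) (auto simp: algebra_simps)
qed

lemma prod_fact_diff_squares_inner: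
  "(\<Prod>p\<in>{1..c}. (real (c + 1))\<^sup>2 - (real p)\<^sup>2) * fact (c + 1) = fact c * fact (2 * c + 1)"
proof -
  have a: "(\<Prod>p\<in>{1..c}. real (c + 1) - real p) = fact c"
    unfolding fact_prod of_nat_prod
    by (rule prod.reindex_bij_witness[of _ "\<lambda>p. c + 1 - p" "\<lambda>p. c + 1 - p"]) auto
  have b: "(\<Prod>p\<in>{1..k}. real (c + 1) + real p) * fact (c + 1) = fact (c + 1 + k)" for k
    by (induction k) (simp_all add: algebra_simps)
  have "(\<Prod>p\<in>{1..c}. (real (c + 1))\<^sup>2 - (real p)\<^sup>2)
     = (\<Prod>p\<in>{1..c}. (real (c + 1) - real p) * (real (c + 1) + real p))"
    by (rule prod.cong[OF refl]) (simp only: power2_eq_square square_diff_square_factored mult.commute)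
  then have "(\<Prod>p\<in>{1..c}. (real (c + 1))\<^sup>2 - (real p)\<^sup>2) * fact (c + 1)
     = fact c * ((\<Prod>p\<in>{1..c}. real (c + 1) + real p) * fact (c + 1))"
    by (simp only: prod.distrib a mult.assoc)
  also have "\<dots> = fact c * fact (c + 1 + c)" by (simp only: b)
  also have "c + 1 + c = 2 * c + 1" by simp
  finally show ?thesis .
qed

lemma prod_fact_diff_squares_outer:
  "(\<Prod>p\<in>{c+2..c+1+a}. (real p)\<^sup>2 - (real (c + 1))\<^sup>2) * fact (2 * c + 2) = fact a * fact (2 * c + 2 + a)"
proof (induction a)
  case (Suc a)
  have "{c+2..c+1+Suc a} = insert (c+1+Suc a) {c+2..c+1+a}" by auto
  then have "(\<Prod>p\<in>{c+2..c+1+Suc a}. (real p)\<^sup>2 - (real (c + 1))\<^sup>2) * fact (2 * c + 2)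
    = ((real (c+1+Suc a))\<^sup>2 - (real (c + 1))\<^sup>2) * (fact a * fact (2 * c + 2 + a))"
    using Suc.IH by simp
  also have "(real (c+1+Suc a))\<^sup>2 - (real (c + 1))\<^sup>2 = real (Suc a) * real (2 * c + 3 + a)"
    by (simp add: power2_eq_square algebra_simps)
  also have "\<dots> * (fact a * fact (2 * c + 2 + a)) = fact (Suc a) * (fact (Suc (2 * c + 2 + a)) :: real)"
    unfolding fact_Suc by (simp add: algebra_simps)
  finally show ?case by simp
qed simp

text \<open>Both sides satisfy the recursion in \<open>g\<close>; for \<open>g = 1\<close> the sum has a single term. (It is a
very-well-poised hypergeometric sum.)\<close>

lemma gap_moment_Suc:
  assumes "\<delta> \<le> 1"
  shows "gap_moment \<delta> c (Suc g) a = fact (c + \<delta>) * fact a * fact (2 * c + g + a + 2) * fact (c + a + g + 1 + \<delta>)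
     / (fact g * fact (c + g + 1 - \<delta>) * fact (c + a + 1 + \<delta>))"
proof (induction g arbitrary: c a)
  case 0
  have "gap_moment \<delta> c (Suc 0) a = 2 * real (c + 1) ^ (1 + 2 * \<delta>)
      * (\<Prod>p\<in>{1..c}. (real (c + 1))\<^sup>2 - (real p)\<^sup>2) * (\<Prod>p\<in>{c+2..c+1+a}. (real p)\<^sup>2 - (real (c + 1))\<^sup>2)"
    by (simp add: gap_moment_def gap_weight_def)
  also have "\<dots> = 2 * real (c + 1) ^ (1 + 2 * \<delta>)
      * (fact c * fact (2 * c + 1) / fact (c + 1)) * (fact a * fact (2 * c + 2 + a) / fact (2 * c + 2))"
    unfolding prod_fact_diff_squares_inner[symmetric] prod_fact_diff_squares_outer[symmetric]
    by (simp only: nonzero_mult_div_cancel_right fact_nonzero not_False_eq_True)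
  also have "(fact (2 * c + 2) :: real) = 2 * real (c + 1) * fact (2 * c + 1)" by simp
  also have "2 * real (c + 1) ^ (1 + 2 * \<delta>)
      * (fact c * fact (2 * c + 1) / fact (c + 1)) * (fact a * fact (2 * c + 2 + a) / (2 * real (c + 1)
          * fact (2 * c + 1)))
    = real (c + 1) ^ (2 * \<delta>) * fact c / fact (c + 1) * (fact a * (fact (2 * c + 2 + a)::real))"
  proof -
    have aux: "2 * (x * y) * (f * D / s) * (E / (2 * x * D)) = y * f / s * E"
      if "x \<noteq> 0" "D \<noteq> 0" for x y f D s E :: real using that by simp
    show ?thesis unfolding power_add power_one_right by (rule aux) auto
  qed
  also have "\<dots> = fact (c + \<delta>) / fact (c + 1 - \<delta>) * (fact a * fact (2 * c + 2 + a))"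
  proof -
    have "real (c + 1) ^ (2 * \<delta>) * fact c / fact (c + 1) = fact (c + \<delta>) / fact (c + 1 - \<delta>)"
    proof (cases "\<delta> = 0")
      case False
      then have "\<delta> = 1" using assms by simp
      moreover have "x ^ 2 * f / (x * f) = x * f / f" if "x \<noteq> 0" "f \<noteq> 0" for x f :: real
        using that by (simp add: power2_eq_square)
      ultimately show ?thesis by (simp del: of_nat_Suc add: power2_eq_square)
    qed simp
    then show ?thesis by simp
  qed
  finally show ?case by (simp add: field_simps del: fact_Suc)
next
  case (Suc g)
  define m where "m = c + g + 1 - \<delta>"
  have m: "real m = real c + real g + 1 - real \<delta>" "c + Suc g + 1 - \<delta> = Suc m" "Suc c + g + 1 - \<delta> = Suc m"
    using assms by (auto simp: m_def)
  \<comment> \<open>All three moments are multiples of \<open>K\<close>, and the recursion becomes an identity between the cofactors.\<close>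
  define K where "K = fact (c + \<delta>) * fact a * fact (2 * c + g + a + 3) * fact (c + a + g + 2 + \<delta>)
     / (fact g * fact (Suc m) * (fact (Suc (c + a + 1 + \<delta>)) :: real))"
  have sq: "(real (c + g + 2))\<^sup>2 - (real (c + 1))\<^sup>2 = real (g + 1) * real (2 * c + g + 3)"
    by (simp add: power2_eq_square algebra_simps)
  have 1: "gap_moment \<delta> (Suc c) (Suc g) a = K * (real (Suc (c + \<delta>)) * real (Suc (2 * c + g + a + 3)))"
  proof -
    have e: "Suc c + \<delta> = Suc (c + \<delta>)" "2 * Suc c + g + a + 2 = Suc (2 * c + g + a + 3)"
      "Suc c + a + g + 1 + \<delta> = c + a + g + 2 + \<delta>" "Suc c + a + 1 + \<delta> = Suc (c + a + 1 + \<delta>)" by auto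
    have aux: "x * k * A * (y * F) * G / (h * f * w) = k * A * F * G / (h * f * w) * (x * y)"
      for k x A F G h f w y :: real
      by (simp only: times_divide_eq_left) (simp only: mult_ac)
    show ?thesis unfolding Suc.IH[of "Suc c" a] e m(3) K_def
      unfolding fact_Suc[of "c + \<delta>"] fact_Suc[of "2 * c + g + a + 3"] by (rule aux)
  qed
  have 2: "gap_moment \<delta> c (Suc g) (Suc a) = K * (real (Suc a) * real (Suc m))"
  proof -
    have e: "2 * c + g + Suc a + 2 = 2 * c + g + a + 3" "c + Suc a + g + 1 + \<delta> = c + a + g + 2 + \<delta>"
      "c + Suc a + 1 + \<delta> = Suc (c + a + 1 + \<delta>)" by auto
    have aux: "k * (x * A) * F * G / (h * f * w) = k * A * F * G / (h * (y * f) * w) * (x * y)"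
      if "y \<noteq> 0" for k x A F G h f w y :: real
    proof -
      have "k * A * F * G / (h * (y * f) * w) * (x * y) = (y * (k * (x * A) * F * G)) / (y * (h * f * w))"
        by (simp only: times_divide_eq_left) (simp only: mult_ac)
      then show ?thesis using that by (simp only: mult_divide_mult_cancel_left not_False_eq_True)
    qed
    show ?thesis unfolding Suc.IH[of c "Suc a"] e m_def[symmetric] K_def
      unfolding fact_Suc[of a] fact_Suc[of m] by (rule aux) simp
  qed
  have 3: "real (g + 1) * (fact (c + \<delta>) * fact a * fact (2 * c + Suc g + a + 2) * fact (c + a + Suc g + 1 + \<delta>)
     / (fact (Suc g) * fact (c + Suc g + 1 - \<delta>) * fact (c + a + 1 + \<delta>))) = K * real (Suc (c + a + 1 + \<delta>))"
  proof -
    have e: "2 * c + Suc g + a + 2 = 2 * c + g + a + 3" "c + a + Suc g + 1 + \<delta> = c + a + g + 2 + \<delta>"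
      by auto
    show ?thesis unfolding e m(2) K_def fact_Suc[of g] fact_Suc[of "c + a + 1 + \<delta>"]
      by (simp del: fact_Suc of_nat_Suc of_nat_add)
  qed
  have "real (g + 1) * real (2 * c + g + 3) * gap_moment \<delta> c (Suc (Suc g)) a
    = K * (real (Suc (c + \<delta>)) * real (Suc (2 * c + g + a + 3)) + real (Suc a) * real (Suc m))"
    unfolding sq[symmetric] gap_moment_rec 1 2 by (simp add: algebra_simps)
  also have "\<dots> = real (2 * c + g + 3) * (K * real (Suc (c + a + 1 + \<delta>)))"
  proof -
    have "real (Suc m) = real c + real g + 2 - real \<delta>" using m(1) by simp
    then show ?thesis by (simp only: of_nat_Suc of_nat_add of_nat_mult) (simp add: algebra_simps)
  qed
  also have "\<dots> = real (g + 1) * real (2 * c + g + 3) * (fact (c + \<delta>) * fact a * fact (2 * c + Suc g + a + 2)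
      * fact (c + a + Suc g + 1 + \<delta>)
     / (fact (Suc g) * fact (c + Suc g + 1 - \<delta>) * fact (c + a + 1 + \<delta>)))"
    unfolding 3[symmetric] by (simp only: mult_ac)
  finally have fin: "real (g + 1) * real (2 * c + g + 3) * gap_moment \<delta> c (Suc (Suc g)) a
    = real (g + 1) * real (2 * c + g + 3) * (fact (c + \<delta>) * fact a * fact (2 * c + Suc g + a + 2) * fact (c
        + a + Suc g + 1 + \<delta>)
     / (fact (Suc g) * fact (c + Suc g + 1 - \<delta>) * fact (c + a + 1 + \<delta>)))" .
  have nz: "real (g + 1) * real (2 * c + g + 3) \<noteq> 0"
    by (simp only: mult_eq_0_iff of_nat_eq_0_iff) simp
  show ?case using fin unfolding mult_left_cancel[OF nz] .
qed

lemma gap_moment_choose: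
  assumes "\<delta> \<le> 1"
  shows "gap_moment \<delta> c g a = fact (c + \<delta>) * fact a * fact (2 * c + g + a + 1) / fact (c + g - \<delta>)
     * real ((c + a + g + \<delta>) choose (c + a + 1 + \<delta>))"
proof (cases g)
  case 0
  then show ?thesis by (simp add: gap_moment_def)
next
  case (Suc g')
  have "real ((c + a + Suc g' + \<delta>) choose (c + a + 1 + \<delta>)) = fact (c + a + g' + 1 + \<delta>) / (fact (c + a + 1
      + \<delta>) * fact g')"
    by (subst binomial_fact) (auto simp del: fact_Suc binomial_Suc_Suc)
  then show ?thesis
    unfolding Suc gap_moment_Suc[OF assms] by (simp del: fact_Suc binomial_Suc_Suc add: mult_ac)
qed

text \<open>In the variable \<open>t\<^sup>2\<close>, the zeros are the squares of the first \<open>i\<close> points of the range starting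
at \<open>c + 1\<close>.\<close>

definition inner_poly :: "nat \<Rightarrow> nat \<Rightarrow> real poly" where
  "inner_poly c i = (\<Prod>l<i. [:- ((real (c + 1 + l))\<^sup>2), 1:])"

text \<open>In the variable \<open>t\<^sup>2\<close>, the zeros are the squares of the last \<open>j\<close> points of the range ending at
\<open>k\<close>.\<close>

definition outer_poly :: "nat \<Rightarrow> nat \<Rightarrow> real poly" where
  "outer_poly k j = (\<Prod>l<j. [:- ((real k - real l)\<^sup>2), 1:])"

lemma inner_poly_monic: "degree (inner_poly c i) = i" "coeff (inner_poly c i) i = 1"
  unfolding inner_poly_def by (rule monic_prod_linear)+

lemma outer_poly_monic: "degree (outer_poly c i) = i" "coeff (outer_poly c i) i = 1"
  unfolding outer_poly_def by (rule monic_prod_linear)+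

lemma gap_weight_inner_poly: "gap_weight (c + i) g a t = gap_weight c (g + i) a t
    * poly (inner_poly c i) ((real t)\<^sup>2)"
proof (induction i arbitrary: g)
  case (Suc i)
  have "gap_weight (c + Suc i) g a t = gap_weight (c + i) (Suc g) a t * ((real t)\<^sup>2 - (real (Suc (c + i)))\<^sup>2)"
    by (simp add: gap_weight_Suc_inner)
  then show ?case using Suc.IH[of "Suc g"] by (simp add: inner_poly_def poly_prod algebra_simps)
qed (simp add: inner_poly_def)

lemma gap_weight_outer_poly:
  "gap_weight c g (a + j) t = (- 1) ^ j * (gap_weight c (g + j) a t * poly (outer_poly (c + g
      + j) j) ((real t)\<^sup>2))"
proof (induction j arbitrary: g)
  case (Suc j)
  have "gap_weight c g (a + Suc j) t = gap_weight c (Suc g) (a + j) t * ((real (c + g + 1))\<^sup>2 - (real t)\<^sup>2)"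
    by (simp add: gap_weight_Suc_outer)
  then show ?case using Suc.IH[of "Suc g"] by (simp add: outer_poly_def poly_prod algebra_simps)
qed (simp add: outer_poly_def)

text \<open>The polynomials are chosen such that they are absorbed by the weight. If \<open>i + j > g\<close> then
every point of the range is a zero of one of them.\<close>

lemma moment_eq_gap_moment:
  "(\<Sum>s\<in>{c+1..c+g}. 2 * real s ^ (1 + 2 * \<delta>) * gap_weight c g a s * poly (inner_poly c i) ((real s)\<^sup>2)
      * poly (outer_poly (c + g) j) ((real s)\<^sup>2))
   = (if i + j \<le> g then (- 1) ^ j * gap_moment \<delta> (c + i) (g - i - j) (a + j) else 0)"
proof -
  have zi: "poly (inner_poly c i) ((real s)\<^sup>2) = 0" if "c + 1 \<le> s" "s \<le> c + i" for s
    unfolding inner_poly_def poly_prod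
    by (subst prod_zero_iff) (use that in \<open>auto intro!: bexI[of _ "s - (c + 1)"] simp: of_nat_diff\<close>)
  have zo: "poly (outer_poly (c + g) j) ((real s)\<^sup>2) = 0" if "s \<le> c + g" "c + g < s + j" for s
    unfolding outer_poly_def poly_prod
    by (subst prod_zero_iff) (use that in \<open>auto intro!: bexI[of _ "c + g - s"] simp: of_nat_diff\<close>)
  show ?thesis
  proof (cases "i + j \<le> g")
    case True
    define h where "h = g - i - j"
    have g: "g = h + i + j" using True by (simp add: h_def)
    have "gap_moment \<delta> (c + i) h (a + j) = (\<Sum>s\<in>{c+i+1..c+i+h}. 2 * real s ^ (1 + 2 * \<delta>) *
       ((- 1) ^ j * (gap_weight c g a s * poly (inner_poly c i) ((real s)\<^sup>2) * poly (outer_poly (c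
           + g) j) ((real s)\<^sup>2))))"
      unfolding gap_moment_def gap_weight_outer_poly gap_weight_inner_poly by (simp add: g add_ac)
    also have "\<dots> = (\<Sum>s\<in>{c+1..c+g}. 2 * real s ^ (1 + 2 * \<delta>) *
       ((- 1) ^ j * (gap_weight c g a s * poly (inner_poly c i) ((real s)\<^sup>2) * poly (outer_poly (c
           + g) j) ((real s)\<^sup>2))))"
    proof (rule sum.mono_neutral_left)
      show "\<forall>s\<in>{c+1..c+g} - {c+i+1..c+i+h}. 2 * real s ^ (1 + 2 * \<delta>) *
       ((- 1) ^ j * (gap_weight c g a s * poly (inner_poly c i) ((real s)\<^sup>2) * poly (outer_poly (c
           + g) j) ((real s)\<^sup>2))) = 0"
      proof
        fix s assume "s \<in> {c+1..c+g} - {c+i+1..c+i+h}"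
        then have "c + 1 \<le> s \<and> s \<le> c + i \<or> s \<le> c + g \<and> c + g < s + j" by (auto simp: g)
        then show "2 * real s ^ (1 + 2 * \<delta>) *
       ((- 1) ^ j * (gap_weight c g a s * poly (inner_poly c i) ((real s)\<^sup>2) * poly (outer_poly (c
           + g) j) ((real s)\<^sup>2))) = 0"
          using zi[of s] zo[of s] by auto
      qed
    qed (auto simp: g)
    finally have "(- 1) ^ j * gap_moment \<delta> (c + i) h (a + j) = (\<Sum>s\<in>{c+1..c+g}. 2 * real s ^ (1 + 2 * \<delta>)
        * gap_weight c g a s *
       poly (inner_poly c i) ((real s)\<^sup>2) * poly (outer_poly (c + g) j) ((real s)\<^sup>2))"
      by (simp add: sum_distrib_left mult_ac power_add[symmetric] flip: mult_2)
    then show ?thesis using True by (simp add: h_def)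
  next
    case False
    have "2 * real s ^ (1 + 2 * \<delta>) * gap_weight c g a s * poly (inner_poly c i) ((real s)\<^sup>2)
      * poly (outer_poly (c + g) j) ((real s)\<^sup>2) = 0" if "s \<in> {c+1..c+g}" for s
      using that False zi[of s] zo[of s] by (cases "s \<le> c + i") auto
    then have "(\<Sum>s\<in>{c+1..c+g}. 2 * real s ^ (1 + 2 * \<delta>) * gap_weight c g a s
        * poly (inner_poly c i) ((real s)\<^sup>2)
      * poly (outer_poly (c + g) j) ((real s)\<^sup>2)) = 0" by (intro sum.neutral ballI)
    then show ?thesis using False by simp
  qed
qed

text \<open>After the row and column factors of the moment matrix are removed, a Hankel matrix of binomial
coefficients remains.\<close>

lemma selberg_sum:
  assumes \<delta>: "\<delta> \<le> 1" and n: "n \<le> g"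
  shows "(\<Sum>S | S \<subseteq> {c+1..c+g} \<and> card S = n. (\<Prod>s\<in>S. 2 * real s ^ (1 + 2 * \<delta>) * gap_weight c g a s)
       * (pair_prod (\<lambda>p q. \<bar>(real q)\<^sup>2 - (real p)\<^sup>2\<bar>) S)\<^sup>2)
     = (\<Prod>i<n. fact (c + \<delta> + i) * fact (a + i) * fact i * fact (2 * c + g + a + 1 + i) * fact (c + a + g + \<delta> + i)
         / (fact (c + g - \<delta> - i) * fact (c + a + n + \<delta> + i) * fact (g - 1 - i)))" (is "?Z = _")
proof (cases "n = 0")
  case True
  have "{S. S \<subseteq> {c+1..c+g} \<and> card S = 0} = {{}}"
    using finite_subset[of _ "{c+1..c+g}"] by auto
  then show ?thesis using True by simp
next
  case False
  let ?N = "c + a + g + \<delta>" and ?B = "c + a + 1 + \<delta>"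
  have "?Z = det (mat n n (\<lambda>(i,j). \<Sum>s\<in>{c+1..c+g}. 2 * real s ^ (1 + 2 * \<delta>) * gap_weight c g a s
      * poly (inner_poly c i) ((real s)\<^sup>2) * poly (outer_poly (c + g) j) ((real s)\<^sup>2)))"
    by (rule andreief_subsets) (auto simp: inner_poly_monic outer_poly_monic)
  also have "\<dots> = det (mat n n (\<lambda>(i,j). (fact (c + \<delta> + i) * fact (2 * c + g + a + 1 + i))
      * ((- 1) ^ j * fact (a + j) / fact (c + g - \<delta> - j)) * real (?N choose (?B + i + j))))"
  proof -
    have "(if i + j \<le> g then (- 1) ^ j * gap_moment \<delta> (c + i) (g - i - j) (a + j) else 0)
      = (fact (c + \<delta> + i) * fact (2 * c + g + a + 1 + i))
      * ((- 1) ^ j * fact (a + j) / fact (c + g - \<delta> - j)) * real (?N choose (?B + i + j))" for i j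
    proof (cases "i + j \<le> g")
      case True
      then have e: "c + i + \<delta> = c + \<delta> + i" "2 * (c + i) + (g - i - j) + (a + j) + 1 = 2 * c + g + a + 1 + i"
        "c + i + (g - i - j) - \<delta> = c + g - \<delta> - j" "c + i + (a + j) + (g - i - j) + \<delta> = ?N"
        "c + i + (a + j) + 1 + \<delta> = ?B + i + j"
        by auto
      show ?thesis unfolding gap_moment_choose[OF \<delta>] e using True by simp
    qed (simp add: binomial_eq_0)
    then show ?thesis unfolding moment_eq_gap_moment by simp
  qed
  also have "\<dots> = (\<Prod>i<n. fact (c + \<delta> + i) * fact (2 * c + g + a + 1 + i))
      * (\<Prod>j<n. (- 1) ^ j * fact (a + j) / fact (c + g - \<delta> - j))
      * (\<Prod>j<n. (- 1) ^ j * fact j * fact (?N + j) / (fact (?B + n - 1 + j) * fact (?N - ?B - j)))"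
    unfolding det_scale_rows_cols by (subst det_hankel_binomial) (use False n in auto)
  also have "\<dots> = (\<Prod>i<n. fact (c + \<delta> + i) * fact (a + i) * fact i * fact (2 * c + g + a + 1 + i) * fact (c
      + a + g + \<delta> + i)
         / (fact (c + g - \<delta> - i) * fact (c + a + n + \<delta> + i) * fact (g - 1 - i)))"
    unfolding prod.distrib[symmetric]
  proof (rule prod.cong[OF refl])
    fix i
    have e: "?B + n - 1 + i = c + a + n + \<delta> + i" "?N - ?B - i = g - 1 - i" by auto
    have "(- 1) ^ i * (- 1) ^ i = (1::real)" by (simp add: power_add[symmetric] flip: mult_2)
    then show "fact (c + \<delta> + i) * fact (2 * c + g + a + 1 + i) * ((- 1) ^ i * fact (a + i) / fact (c
        + g - \<delta> - i))
      * ((- 1) ^ i * fact i * fact (?N + i) / (fact (?B + n - 1 + i) * fact (?N - ?B - i)))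
      = fact (c + \<delta> + i) * fact (a + i) * fact i * fact (2 * c + g + a + 1 + i) * fact (c + a + g + \<delta> + i)
         / (fact (c + g - \<delta> - i) * fact (c + a + n + \<delta> + i) * (fact (g - 1 - i) :: real))"
      unfolding e by (simp add: divide_simps del: fact_Suc)
  qed
  finally show ?thesis .
qed

section \<open>Superfactorials and Vandermonde products of blocks\<close>

abbreviation vandermonde :: "int set \<Rightarrow> real" where
  "vandermonde \<equiv> pair_prod (\<lambda>p q. \<bar>of_int q - of_int p\<bar>)"

lemma vandermonde_sym: "\<bar>of_int q - of_int p\<bar> = (\<bar>of_int p - of_int q\<bar> :: real)"
  by (rule abs_minus_commute)

lemma pair_prod_times: "pair_prod f D * pair_prod g D = pair_prod (\<lambda>p q. f p q * g p q) D"
  by (simp add: pair_prod_def prod.distrib)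

lemma prod_prod_sym:
  assumes "finite D" and sym: "\<And>p q. f p q = f q p"
  shows "(\<Prod>p\<in>D. \<Prod>q\<in>D. f p q) = (\<Prod>p\<in>D. f p p) * (pair_prod f D)\<^sup>2"
  using assms(1)
proof (induction D)
  case (insert s D)
  have "(\<Prod>p\<in>insert s D. \<Prod>q\<in>insert s D. f p q)
     = f s s * (\<Prod>q\<in>D. f s q) * ((\<Prod>p\<in>D. f p s) * (\<Prod>p\<in>D. \<Prod>q\<in>D. f p q))"
    using insert by (simp add: prod.distrib)
  also have "(\<Prod>p\<in>D. f p s) = (\<Prod>q\<in>D. f s q)" using sym by simp
  finally show ?case using insert
    by (simp add: pair_prod_insert[OF _ _ sym] power2_eq_square mult_ac)
qed simp

lemma pair_prod_image:
  assumes "inj_on h D" "finite D" and sym: "\<And>p q. f p q = f q p" and eq: "\<And>p q. f (h p) (h q) = g p q"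
  shows "pair_prod f (h ` D) = pair_prod g D"
  using assms(2,1)
proof (induction D)
  case (insert s D)
  have symg: "g p q = g q p" for p q using eq sym by metis
  have "h s \<notin> h ` D" "inj_on h D" using insert by auto
  then show ?case using insert
    by (simp add: pair_prod_insert[OF _ _ sym] pair_prod_insert[OF _ _ symg] prod.reindex eq)
qed simp

text \<open>This is \<open>G (n + 1)\<close> for the Barnes function \<open>G\<close>. The closed formulas below are quotients of
its values.\<close>

definition superfact :: "nat \<Rightarrow> real" where
  "superfact n = (\<Prod>k<n. fact k)"

lemma superfact_pos [simp]: "superfact n > 0" "superfact n \<noteq> 0"
proof -
  show "superfact n > 0" unfolding superfact_def by (rule prod_pos) simp
  then show "superfact n \<noteq> 0" by simp
qed

lemma superfact_simps [simp]: "superfact 0 = 1" "superfact (Suc n) = superfact n * fact n"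
  by (simp_all add: superfact_def)

lemma prod_shift_fact: "(\<Prod>j<c. real (k + 1 + j)) = fact (k + c) / fact k"
proof (induction c)
  case (Suc c)
  have "(\<Prod>j<Suc c. real (k + 1 + j)) = fact (k + c) / fact k * real (k + 1 + c)"
    by (simp only: prod.lessThan_Suc Suc.IH)
  also have "fact (k + c) / fact k * real (k + 1 + c) = (real (Suc (k + c)) * fact (k + c)) / fact k"
    by simp
  also have "real (Suc (k + c)) * fact (k + c) = fact (k + Suc c)" by simp
  finally show ?case .
qed simp

lemma prod_prod_shift:
  "(\<Prod>i<a. \<Prod>j<c. real (g + 1 + i + j)) = superfact (a + g + c) * superfact g / (superfact (a + g)
      * superfact (g + c))"
proof (induction a)
  case (Suc a)
  have "(\<Prod>j<c. real (g + 1 + a + j)) = fact (a + g + c) / fact (a + g)"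
    using prod_shift_fact[of "a + g" c] by (simp add: add_ac)
  then show ?case using Suc.IH by (simp add: mult_ac)
qed simp

lemma PP_superfact:
  "PP a b c = superfact a * superfact b * superfact c * superfact (a + b + c) / (superfact (a + b)
      * superfact (b + c) * superfact (a + c))"
proof -
  \<comment> \<open>The product over the middle index telescopes, which leaves two products over rectangles.\<close>
  have tel: "(\<Prod>j=1..b. (real i + real j + real k - 1) / (real i + real j + real k - 2)) = (real i + real k
      + real b - 1) / (real i + real k - 1)"
    if "1 \<le> i" "1 \<le> k" for i k
  proof (induction b)
    case (Suc b)
    have e: "real i + real (Suc b) + real k - 2 = real i + real k + real b - 1"
      "real i + real (Suc b) + real k - 1 = real i + real k + real (Suc b) - 1" by simp_all
    have "real i + real k + real b - 1 \<noteq> 0" using that by linarith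
    then have cancel: "x / y * (z / x) = z / y" if "x = real i + real k + real b - 1" for x y z
      using that by simp
    have "(\<Prod>j=1..Suc b. (real i + real j + real k - 1) / (real i + real j + real k - 2))
      = (real i + real k + real b - 1) / (real i + real k - 1) * ((real i + real k + real (Suc b) - 1)
          / (real i + real k + real b - 1))"
      by (subst prod.nat_ivl_Suc') (simp_all only: Suc.IH e, simp_all)
    then show ?case by (simp only: cancel)
  qed (use that in auto)
  have "PP a b c = (\<Prod>i=1..a. \<Prod>k=1..c. \<Prod>j=1..b. (real i + real j + real k - 1) / (real i + real j + real k - 2))"
    unfolding PP_def by (rule prod.cong[OF refl], rule prod.swap)
  also have "\<dots> = (\<Prod>i=1..a. \<Prod>k=1..c. (real i + real k + real b - 1) / (real i + real k - 1))"
    by (intro prod.cong refl tel) auto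
  also have "\<dots> = (\<Prod>i<a. \<Prod>k<c. real (b + 1 + i + k) / real (0 + 1 + i + k))"
  proof -
    have sh: "(\<Prod>i=1..n. F i) = (\<Prod>i<n. F (Suc i))" for n and F :: "nat \<Rightarrow> real"
      by (simp add: prod.atLeast1_atMost_eq)
    show ?thesis unfolding sh by (intro prod.cong refl) (simp add: add_ac)
  qed
  also have "\<dots> = (superfact (a + b + c) * superfact b / (superfact (a + b) * superfact (b + c)))
      / (superfact (a + 0 + c) * superfact 0 / (superfact (a + 0) * superfact (0 + c)))"
    unfolding prod_dividef prod_prod_shift ..
  finally show ?thesis by simp
qed

lemma PP_pos: "PP a b c > 0"
  unfolding PP_superfact by (intro divide_pos_pos mult_pos_pos) simp_all

lemma vandermonde_interval: "vandermonde {u..<u + int n} = superfact n"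
proof (induction n)
  case (Suc n)
  have "{u..<u + int (Suc n)} = insert (u + int n) {u..<u + int n}" by auto
  then have "vandermonde {u..<u + int (Suc n)} = superfact n * (\<Prod>q\<in>{u..<u + int n}. \<bar>of_int q - of_int (u
      + int n)\<bar>)"
    using Suc.IH by (simp add: pair_prod_insert[OF _ _ vandermonde_sym])
  also have "(\<Prod>q\<in>{u..<u + int n}. \<bar>of_int q - of_int (u + int n)\<bar>) = (\<Prod>i<n. real (Suc i))"
    by (rule prod.reindex_bij_witness[of _ "\<lambda>i. u + int n - 1 - int i" "\<lambda>q. nat (u + int n - 1 - q)"]) auto
  also have "\<dots> = fact n" by (simp add: fact_prod_Suc atLeast0LessThan)
  finally show ?case by simp
qed simp

text \<open>The positions covered by the two ferns when the unit segments of the axis are numbered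
\<open>0, 1, \<dots>\<close> from the left. The centre is the segment \<open>a + g + c\<close>.\<close>

definition two_blocks :: "nat \<Rightarrow> nat \<Rightarrow> nat \<Rightarrow> int set" where
  "two_blocks a g c = {0..<int a} \<union> {int (a + g)..<int (a + g + c)}"

text \<open>Equivalently: \<open>PP a g c\<close> counts the tilings of the trapezoid with two blocks of dents, in
which only a hexagon is not forced.\<close>

lemma vandermonde_two_blocks: "vandermonde (two_blocks a g c) = PP a g c * superfact (a + c)"
proof -
  have "vandermonde (two_blocks a g c) = vandermonde {0..<0 + int a} * vandermonde {int (a + g)..<int (a
      + g) + int c}
      * (\<Prod>p\<in>{0..<int a}. \<Prod>q\<in>{int (a + g)..<int (a + g + c)}. \<bar>of_int q - of_int p\<bar>)"
    unfolding two_blocks_def by (subst pair_prod_union[OF _ _ _ vandermonde_sym]) auto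
  also have "(\<Prod>p\<in>{0..<int a}. \<Prod>q\<in>{int (a + g)..<int (a + g + c)}. \<bar>of_int q - of_int p\<bar>)
      = (\<Prod>i<a. \<Prod>j<c. real (g + 1 + i + j))"
  proof (rule prod.reindex_bij_witness[of _ "\<lambda>i. int a - 1 - int i" "\<lambda>p. nat (int a - 1 - p)"])
    fix p assume p: "p \<in> {0..<int a}"
    show "(\<Prod>j<c. real (g + 1 + nat (int a - 1 - p) + j)) = (\<Prod>q\<in>{int (a + g)..<int (a + g
        + c)}. \<bar>of_int q - of_int p\<bar>)"
      by (rule prod.reindex_bij_witness[of _ "\<lambda>q. nat (q - int (a + g))" "\<lambda>j. int (a + g) + int j"])
        (use p in auto)
  qed auto
  finally show ?thesis unfolding vandermonde_interval prod_prod_shift PP_superfact by simp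
qed

section \<open>Summing over symmetric sets of positions\<close>

text \<open>The segments of the axis at which a lozenge may cross: neither they nor their mirror images
are covered by a fern.\<close>

definition gap_positions :: "nat \<Rightarrow> nat \<Rightarrow> nat \<Rightarrow> int set" where
  "gap_positions a g c = {i \<in> {0..2 * int (a + g + c)}. i \<notin> two_blocks a g c \<and> 2 * int (a + g
      + c) - i \<notin> two_blocks a g c}"

text \<open>The factor that all regions with the same fern lengths and the same gap have in common.\<close>

definition gap_sum :: "nat \<Rightarrow> nat \<Rightarrow> nat \<Rightarrow> nat \<Rightarrow> real" where
  "gap_sum a g c y = (\<Sum>S | S \<subseteq> gap_positions a g c \<and> (\<lambda>i. 2 * int (a + g + c) - i) ` S = S \<and> card S = y.
     vandermonde S * (\<Prod>p\<in>two_blocks a g c. \<Prod>s\<in>S. \<bar>of_int s - of_int p\<bar>))"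

text \<open>A symmetric set of positions in terms of the distances from the centre \<open>M\<close>, with the centre
added if \<open>\<delta>\<close> is not \<open>0\<close>.\<close>

definition mirror_set :: "int \<Rightarrow> nat \<Rightarrow> nat set \<Rightarrow> int set" where
  "mirror_set M \<delta> S = (\<lambda>s. M + int s) ` S \<union> (\<lambda>s. M - int s) ` S \<union> (if \<delta> = 0 then {} else {M})"

lemma gap_weight_abs:
  assumes "c < t" "t \<le> c + g"
  shows "gap_weight c g a t = (\<Prod>d\<in>{1..c} \<union> {c+g+1..c+g+a}. \<bar>(real t)\<^sup>2 - (real d)\<^sup>2\<bar>)"
proof -
  have "(real d)\<^sup>2 \<le> (real t)\<^sup>2" if "d \<in> {1..c}" for d using that assms by (intro power_mono) auto
  then have 1: "(\<Prod>p\<in>{1..c}. (real t)\<^sup>2 - (real p)\<^sup>2) = (\<Prod>p\<in>{1..c}. \<bar>(real t)\<^sup>2 - (real p)\<^sup>2\<bar>)"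
    by (intro prod.cong refl) simp
  have "(real t)\<^sup>2 \<le> (real d)\<^sup>2" if "d \<in> {c+g+1..c+g+a}" for d using that assms by (intro power_mono) auto
  then have 2: "(\<Prod>p\<in>{c+g+1..c+g+a}. (real p)\<^sup>2 - (real t)\<^sup>2) = (\<Prod>p\<in>{c+g+1..c+g+a}. \<bar>(real t)\<^sup>2 - (real p)\<^sup>2\<bar>)"
    by (intro prod.cong refl) simp
  show ?thesis unfolding gap_weight_def 1 2 by (subst prod.union_disjoint) auto
qed

lemma two_blocks_distances: "two_blocks a g c = (\<lambda>d. int (a + g + c) - int d) ` ({1..c} \<union> {c+g+1..c+g+a})"
proof (intro subset_antisym subsetI)
  fix i assume i: "i \<in> two_blocks a g c"
  show "i \<in> (\<lambda>d. int (a + g + c) - int d) ` ({1..c} \<union> {c+g+1..c+g+a})"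
    by (rule image_eqI[of _ _ "nat (int (a + g + c) - i)"]) (use i in \<open>auto simp: two_blocks_def\<close>)
qed (auto simp: two_blocks_def)

text \<open>For \<open>p = M - d\<close> the two distances from \<open>p\<close> to \<open>M - t\<close> and \<open>M + t\<close> have the product
\<open>\<bar>t\<^sup>2 - d\<^sup>2\<bar>\<close>. In the same way the pairs within the mirror set combine to the square of a
Vandermonde product in the squares, up to the factors \<open>2 * t\<close> from the mirror pairs. The centre, if
present, contributes \<open>t\<^sup>2\<close> for each mirror pair and the constant in front.\<close>

lemma mirror_weight:
  fixes a c g \<delta> :: nat
  assumes S: "S \<subseteq> {c+1..c+g}" and \<delta>: "\<delta> \<le> 1"
  defines "T \<equiv> mirror_set (int (a + g + c)) \<delta> S"
  shows "vandermonde T * (\<Prod>p\<in>two_blocks a g c. \<Prod>s\<in>T. \<bar>of_int s - of_int p\<bar>)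
    = (fact c * fact (c + g + a) / fact (c + g)) ^ \<delta>
      * ((\<Prod>s\<in>S. 2 * real s ^ (1 + 2 * \<delta>) * gap_weight c g a s)
          * (pair_prod (\<lambda>p q. \<bar>(real q)\<^sup>2 - (real p)\<^sup>2\<bar>) S)\<^sup>2)"
proof -
  let ?M = "int (a + g + c)" and ?D = "{1..c} \<union> {c+g+1..c+g+a}"
  let ?X = "(\<lambda>s. ?M + int s) ` S" and ?Y = "(\<lambda>s. ?M - int s) ` S" and ?C = "if \<delta> = 0 then {} else {?M}"
  have fin: "finite S" using S finite_subset by blast
  have pos: "0 < s" if "s \<in> S" for s using that S by auto
  have injX: "inj_on (\<lambda>s. ?M + int s) S" and injY: "inj_on (\<lambda>s. ?M - int s) S" by (auto simp: inj_on_def)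
  have XY: "?X \<inter> ?Y = {}" using pos by force
  have C: "(?X \<union> ?Y) \<inter> ?C = {}" using pos by force
  have prodXY: "(\<Prod>s\<in>?X \<union> ?Y. F s) = (\<Prod>s\<in>S. F (?M + int s) * F (?M - int s))" for F :: "int \<Rightarrow> real"
  proof -
    have "(\<Prod>s\<in>?X \<union> ?Y. F s) = (\<Prod>s\<in>?X. F s) * (\<Prod>s\<in>?Y. F s)"
      by (rule prod.union_disjoint[OF _ _ XY]) (use fin in auto)
    then show ?thesis by (simp only: prod.reindex[OF injX] prod.reindex[OF injY] comp_def prod.distrib)
  qed
  have prodT: "(\<Prod>s\<in>T. F s) = (\<Prod>s\<in>S. F (?M + int s) * F (?M - int s)) * F ?M ^ \<delta>" for F :: "int \<Rightarrow> real"
  proof -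
    have "(\<Prod>s\<in>?C. F s) = F ?M ^ \<delta>" using \<delta> by (cases "\<delta> = 0") (auto simp: le_Suc_eq)
    moreover have "(\<Prod>s\<in>T. F s) = (\<Prod>s\<in>?X \<union> ?Y. F s) * (\<Prod>s\<in>?C. F s)"
      unfolding T_def mirror_set_def by (rule prod.union_disjoint[OF _ _ C]) (use fin in auto)
    ultimately show ?thesis by (simp only: prodXY)
  qed
  have VX: "vandermonde ?X = pair_prod (\<lambda>p q. \<bar>real q - real p\<bar>) S"
    by (rule pair_prod_image[OF injX fin vandermonde_sym]) simp
  have VY: "vandermonde ?Y = pair_prod (\<lambda>p q. \<bar>real q - real p\<bar>) S"
    by (rule pair_prod_image[OF injY fin vandermonde_sym]) (simp add: abs_minus_commute)
  have cross: "(\<Prod>x\<in>?X. \<Prod>y\<in>?Y. \<bar>of_int y - of_int x\<bar>) = (\<Prod>s\<in>S. 2 * real s) * (pair_prod (\<lambda>p q. real q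
      + real p) S)\<^sup>2"
  proof -
    have "(\<Prod>x\<in>?X. \<Prod>y\<in>?Y. \<bar>of_int y - of_int x\<bar>) = (\<Prod>s\<in>S. \<Prod>t\<in>S. real t + real s)"
      by (simp only: prod.reindex[OF injX] prod.reindex[OF injY] comp_def)
        (intro prod.cong refl, simp)
    also have "\<dots> = (\<Prod>s\<in>S. real s + real s) * (pair_prod (\<lambda>p q. real q + real p) S)\<^sup>2"
      by (rule prod_prod_sym[OF fin]) simp
    finally show ?thesis by simp
  qed
  have "vandermonde (?X \<union> ?Y) = (\<Prod>s\<in>S. 2 * real s) *
     (pair_prod (\<lambda>p q. \<bar>real q - real p\<bar>) S * pair_prod (\<lambda>p q. real q + real p) S)\<^sup>2"
    by (subst pair_prod_union[OF _ _ XY vandermonde_sym], simp_all only: VX VY cross finite_imageI fin)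
      (simp only: power2_eq_square mult_ac)
  also have "pair_prod (\<lambda>p q. \<bar>real q - real p\<bar>) S * pair_prod (\<lambda>p q. real q + real p) S
     = pair_prod (\<lambda>p q. \<bar>(real q)\<^sup>2 - (real p)\<^sup>2\<bar>) S"
    unfolding pair_prod_times
    by (intro arg_cong[of _ _ "\<lambda>f. pair_prod f S"] ext)
        (simp add: power2_eq_square square_diff_square_factored abs_mult)
  finally have VXY: "vandermonde (?X \<union> ?Y) = (\<Prod>s\<in>S. 2 * real s)
      * (pair_prod (\<lambda>p q. \<bar>(real q)\<^sup>2 - (real p)\<^sup>2\<bar>) S)\<^sup>2" .
  have VT: "vandermonde T = (\<Prod>s\<in>S. 2 * real s) * (pair_prod (\<lambda>p q. \<bar>(real q)\<^sup>2 - (real p)\<^sup>2\<bar>) S)\<^sup>2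
      * (\<Prod>s\<in>S. real s ^ (2 * \<delta>))"
  proof (cases "\<delta> = 0")
    case False
    then have \<delta>1: "\<delta> = 1" using \<delta> by simp
    have "T = insert ?M (?X \<union> ?Y)" unfolding T_def mirror_set_def using False by auto
    then have "vandermonde T = vandermonde (?X \<union> ?Y) * (\<Prod>q\<in>?X \<union> ?Y. \<bar>of_int q - of_int ?M\<bar>)"
      using pair_prod_insert[OF _ _ vandermonde_sym, of "?X \<union> ?Y" ?M] C fin False by simp
    also have "(\<Prod>q\<in>?X \<union> ?Y. \<bar>of_int q - of_int ?M\<bar>) = (\<Prod>s\<in>S. real s ^ (2 * \<delta>))"
      unfolding prodXY \<delta>1 by (rule prod.cong[OF refl]) (simp add: power2_eq_square)
    finally show ?thesis unfolding VXY .
  qed (use VXY in \<open>simp add: T_def mirror_set_def\<close>)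
  have injD: "inj_on (\<lambda>d. ?M - int d) ?D" by (auto simp: inj_on_def)
  have W: "(\<Prod>p\<in>two_blocks a g c. \<Prod>s\<in>T. \<bar>of_int s - of_int p\<bar>)
     = (\<Prod>s\<in>S. gap_weight c g a s) * (\<Prod>d\<in>?D. real d) ^ \<delta>"
  proof -
    have "(\<Prod>p\<in>two_blocks a g c. \<Prod>s\<in>T. \<bar>of_int s - of_int p\<bar>)
      = (\<Prod>d\<in>?D. (\<Prod>s\<in>S. \<bar>(real s)\<^sup>2 - (real d)\<^sup>2\<bar>) * real d ^ \<delta>)"
      unfolding two_blocks_distances prod.reindex[OF injD] comp_def
    proof (rule prod.cong[OF refl])
      fix d
      have "\<bar>of_int (?M + int s) - of_int (?M - int d)\<bar> * \<bar>of_int (?M - int s) - of_int (?M - int d)\<bar>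
          = \<bar>(real s)\<^sup>2 - (real d)\<^sup>2\<bar>" for s
        by (simp add: power2_eq_square square_diff_square_factored abs_mult abs_minus_commute)
      then show "(\<Prod>s\<in>T. \<bar>of_int s - of_int (?M - int d)\<bar>) = (\<Prod>s\<in>S. \<bar>(real s)\<^sup>2 - (real d)\<^sup>2\<bar>) * real d ^ \<delta>"
        unfolding prodT by simp
    qed
    also have "\<dots> = (\<Prod>s\<in>S. \<Prod>d\<in>?D. \<bar>(real s)\<^sup>2 - (real d)\<^sup>2\<bar>) * (\<Prod>d\<in>?D. real d) ^ \<delta>"
      unfolding prod.distrib prod_power_distrib by (subst prod.swap) simp
    also have "(\<Prod>s\<in>S. \<Prod>d\<in>?D. \<bar>(real s)\<^sup>2 - (real d)\<^sup>2\<bar>) = (\<Prod>s\<in>S. gap_weight c g a s)"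
      by (intro prod.cong refl gap_weight_abs[symmetric]) (use S in auto)
    finally show ?thesis .
  qed
  have D: "(\<Prod>d\<in>?D. real d) = fact c * fact (c + g + a) / fact (c + g)"
  proof -
    have "(\<Prod>d\<in>{c+g+1..c+g+a}. real d) = fact (c + g + a) / fact (c + g)"
      by (induction a) (simp_all add: field_simps atLeastAtMostSuc_conv)
    then show ?thesis by (subst prod.union_disjoint) (auto simp: fact_prod)
  qed
  show ?thesis unfolding VT W D by (simp add: prod.distrib power_add mult_ac)
qed

lemma gap_positions_iff:
  "i \<in> gap_positions a g c \<longleftrightarrow> int a \<le> i \<and> i < int (a + g) \<or> i = int (a + g + c)
     \<or> int (a + g + c) + int c < i \<and> i \<le> int (a + g + c) + int (c + g)"
  by (auto simp: gap_positions_def two_blocks_def)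

lemma mirror_set_subset:
  assumes "S \<subseteq> {c+1..c+g}"
  shows "mirror_set (int (a + g + c)) \<delta> S \<subseteq> gap_positions a g c"
  using assms by (auto simp: mirror_set_def gap_positions_iff subset_iff)

lemma mirror_set_sym: "(\<lambda>i. 2 * M - i) ` mirror_set M \<delta> S = mirror_set M \<delta> S"
  unfolding mirror_set_def image_Un image_image by (auto simp: algebra_simps image_iff)

lemma card_mirror_set:
  assumes "S \<subseteq> {c+1..c+g}" "\<delta> \<le> 1"
  shows "card (mirror_set M \<delta> S) = 2 * card S + \<delta>"
proof -
  let ?X = "(\<lambda>s. M + int s) ` S" and ?Y = "(\<lambda>s. M - int s) ` S"
  have fin: "finite S" using assms(1) finite_subset by blast
  have pos: "0 < s" if "s \<in> S" for s using that assms by auto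
  have "card ?X = card S" "card ?Y = card S" by (auto intro!: card_image simp: inj_on_def)
  moreover have "?X \<inter> ?Y = {}" using pos by force
  moreover have "M \<notin> ?X \<union> ?Y" using pos by force
  ultimately have "card (?X \<union> ?Y) = 2 * card S" "card (insert M (?X \<union> ?Y)) = Suc (2 * card S)"
    using fin by (simp_all add: card_Un_disjoint)
  moreover have "mirror_set M \<delta> S = (if \<delta> = 0 then ?X \<union> ?Y else insert M (?X \<union> ?Y))"
    by (auto simp: mirror_set_def)
  ultimately show ?thesis using assms(2) by auto
qed

lemma mirror_set_recover:
  assumes "S \<subseteq> {c+1..c+g}"
  shows "{s\<in>{c+1..c+g}. M + int s \<in> mirror_set M \<delta> S} = S"
  using assms by (auto simp: mirror_set_def split: if_splits)

lemma symmetric_gap_set: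
  assumes T: "T \<subseteq> gap_positions a g c" "(\<lambda>i. 2 * int (a + g + c) - i) ` T = T"
  shows "T = mirror_set (int (a + g + c)) (of_bool (int (a + g + c) \<in> T)) {s\<in>{c+1..c+g}. int (a + g + c)
      + int s \<in> T}"
proof -
  let ?M = "int (a + g + c)"
  have sym: "2 * ?M - i \<in> T" if "i \<in> T" for i using T(2) that by blast
  show ?thesis
  proof (intro subset_antisym subsetI)
    fix i assume i: "i \<in> T"
    then consider "i = ?M" | "?M < i" "nat (i - ?M) \<in> {c+1..c+g}" | "i < ?M" "nat (?M - i) \<in> {c+1..c+g}"
      using T(1) gap_positions_iff[of i a g c] by fastforce
    then show "i \<in> mirror_set ?M (of_bool (?M \<in> T)) {s\<in>{c+1..c+g}. ?M + int s \<in> T}"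
    proof cases
      case 2
      then have "nat (i - ?M) \<in> {s\<in>{c+1..c+g}. ?M + int s \<in> T}" "i = ?M + int (nat (i - ?M))" using i by auto
      then show ?thesis unfolding mirror_set_def by blast
    next
      case 3
      have eq: "?M + int (nat (?M - i)) = 2 * ?M - i" using 3 by simp
      have "?M + int (nat (?M - i)) \<in> T" unfolding eq by (rule sym[OF i])
      then have "nat (?M - i) \<in> {s\<in>{c+1..c+g}. ?M + int s \<in> T}" "i = ?M - int (nat (?M - i))"
        using 3 by auto
      then show ?thesis unfolding mirror_set_def by blast
    qed (use i in \<open>simp add: mirror_set_def\<close>)
  next
    fix i assume "i \<in> mirror_set ?M (of_bool (?M \<in> T)) {s\<in>{c+1..c+g}. ?M + int s \<in> T}"
    then consider "i = ?M" "?M \<in> T" | t where "i = ?M + int t" "?M + int t \<in> T" | t where "i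
        = ?M - int t" "?M + int t \<in> T"
      unfolding mirror_set_def by (auto split: if_splits)
    then show "i \<in> T"
    proof cases
      case (3 t)
      have "2 * ?M - (?M + int t) = i" using 3(1) by simp
      then show ?thesis using sym[OF 3(2)] by (simp only:)
    qed auto
  qed
qed

text \<open>Symmetric sets correspond to sets of distances, and the parity of the cardinality decides
whether the centre belongs to the set.\<close>

lemma gap_sum_eq:
  assumes \<delta>: "\<delta> \<le> 1" and n: "n \<le> g"
  shows "gap_sum a g c (2 * n + \<delta>) = (fact c * fact (c + g + a) / fact (c + g)) ^ \<delta>
     * (\<Prod>i<n. fact (c + \<delta> + i) * fact (a + i) * fact i * fact (2 * c + g + a + 1 + i) * fact (c + a + g + \<delta> + i)
         / (fact (c + g - \<delta> - i) * fact (c + a + n + \<delta> + i) * fact (g - 1 - i)))"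
proof -
  let ?M = "int (a + g + c)"
  let ?A = "{S. S \<subseteq> {c+1..c+g} \<and> card S = n}"
  let ?B = "{S. S \<subseteq> gap_positions a g c \<and> (\<lambda>i. 2 * ?M - i) ` S = S \<and> card S = 2 * n + \<delta>}"
  have "bij_betw (mirror_set ?M \<delta>) ?A ?B"
  proof (rule bij_betw_byWitness[where f' = "\<lambda>T. {s\<in>{c+1..c+g}. ?M + int s \<in> T}"])
    have parity: "of_bool (?M \<in> T) = \<delta> \<and> card {s\<in>{c+1..c+g}. ?M + int s \<in> T} = n" if "T \<in> ?B" for T
    proof -
      let ?S = "{s\<in>{c+1..c+g}. ?M + int s \<in> T}"
      have "T = mirror_set ?M (of_bool (?M \<in> T)) ?S"
        by (rule symmetric_gap_set) (use that in simp_all)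
      moreover have "card (mirror_set ?M (of_bool (?M \<in> T)) ?S) = 2 * card ?S + of_bool (?M \<in> T)"
        by (rule card_mirror_set[of _ c g]) auto
      ultimately have "card T = 2 * card ?S + of_bool (?M \<in> T)" by (simp only:)
      then have "2 * n + \<delta> = 2 * card ?S + of_bool (?M \<in> T)" using that by simp
      then show ?thesis using \<delta> by (cases "?M \<in> T") (simp_all, presburger+)
    qed
    show "\<forall>S\<in>?A. {s\<in>{c+1..c+g}. ?M + int s \<in> mirror_set ?M \<delta> S} = S"
      using mirror_set_recover by blast
    show "\<forall>T\<in>?B. mirror_set ?M \<delta> {s\<in>{c+1..c+g}. ?M + int s \<in> T} = T"
    proof
      fix T assume T: "T \<in> ?B"
      then show "mirror_set ?M \<delta> {s\<in>{c+1..c+g}. ?M + int s \<in> T} = T"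
        using symmetric_gap_set[of T a g c] parity[OF T] by simp
    qed
    show "mirror_set ?M \<delta> ` ?A \<subseteq> ?B"
    proof (rule image_subsetI)
      fix S assume "S \<in> ?A"
      then have S: "S \<subseteq> {c+1..c+g}" "card S = n" by auto
      show "mirror_set ?M \<delta> S \<in> ?B"
        using mirror_set_subset[OF S(1), of a \<delta>] mirror_set_sym[of ?M \<delta> S] card_mirror_set[OF S(1) \<delta>, of ?M] S(2)
        by (intro CollectI conjI) (simp_all only:)
    qed
    show "(\<lambda>T. {s\<in>{c+1..c+g}. ?M + int s \<in> T}) ` ?B \<subseteq> ?A"
      using parity by (intro image_subsetI) blast
  qed
  then have "gap_sum a g c (2 * n + \<delta>) = (\<Sum>S\<in>?A. vandermonde (mirror_set ?M \<delta> S)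
      * (\<Prod>p\<in>two_blocks a g c. \<Prod>s\<in>mirror_set ?M \<delta> S. \<bar>of_int s - of_int p\<bar>))"
    unfolding gap_sum_def by (rule sum.reindex_bij_betw[symmetric])
  also have "\<dots> = (\<Sum>S\<in>?A. (fact c * fact (c + g + a) / fact (c + g)) ^ \<delta>
      * ((\<Prod>s\<in>S. 2 * real s ^ (1 + 2 * \<delta>) * gap_weight c g a s)
          * (pair_prod (\<lambda>p q. \<bar>(real q)\<^sup>2 - (real p)\<^sup>2\<bar>) S)\<^sup>2))"
    by (rule sum.cong[OF refl], rule mirror_weight) (use \<delta> in auto)
  also have "\<dots> = (fact c * fact (c + g + a) / fact (c + g)) ^ \<delta>
     * (\<Prod>i<n. fact (c + \<delta> + i) * fact (a + i) * fact i * fact (2 * c + g + a + 1 + i) * fact (c + a + g + \<delta> + i)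
         / (fact (c + g - \<delta> - i) * fact (c + a + n + \<delta> + i) * fact (g - 1 - i)))"
    unfolding sum_distrib_left[symmetric] selberg_sum[OF \<delta> n] ..
  finally show ?thesis .
qed

section \<open>The closed product formulas\<close>

lemma prod_fact_up: "(\<Prod>i<n. fact (k + i)) = superfact (k + n) / superfact k"
  by (induction n) simp_all

lemma prod_fact_down: "n \<le> k \<Longrightarrow> (\<Prod>i<n. fact (k - 1 - i)) = superfact k / superfact (k - n)"
proof (induction n)
  case (Suc n)
  then have "superfact (k - n) = superfact (k - Suc n) * fact (k - 1 - n)"
    using superfact_simps(2)[of "k - Suc n"] by (simp add: Suc_diff_Suc)
  then show ?case using Suc by simp
qed simp

text \<open>Rows of consecutive integers: the product is one over a rectangle of an affine function.\<close>

lemma prod_pochhammer: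
  "(\<Prod>i=1..n. pochhammer (real k + real i) m) = superfact (n + k + m) * superfact k / (superfact (n + k)
      * superfact (k + m))"
proof -
  have "(\<Prod>i=1..n. pochhammer (real k + real i) m) = (\<Prod>i<n. \<Prod>j<m. real (k + 1 + i + j))"
    by (simp add: prod.atLeast1_atMost_eq pochhammer_prod atLeast0LessThan add_ac)
  then show ?thesis unfolding prod_prod_shift .
qed

lemma fact_superfact: "fact k = superfact (Suc k) / superfact k"
  by simp

lemma gap_sum_even:
  "gap_sum a (X + n) c (2 * n)
     = superfact (c + n) / superfact c * (superfact (a + n) / superfact a) * superfact n
       * (superfact (a + 2 * c + X + 2 * n + 1) / superfact (a + 2 * c + X + n + 1)) * (superfact (a + c + X
           + 2 * n) / superfact (a + c + X + n))
       / (superfact (c + X + n + 1) / superfact (c + X + 1) * (superfact (a + c + 2 * n) / superfact (a + c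
           + n)) * (superfact (X + n) / superfact X))"
proof -
  have "gap_sum a (X + n) c (2 * n) = (\<Prod>i<n. fact (c + i) * fact (a + i) * fact (0 + i) * fact ((a + 2 * c
      + X + n + 1) + i) * fact ((a + c + X + n) + i)
         / (fact ((c + X + n + 1) - 1 - i) * fact ((a + c + n) + i) * fact ((X + n) - 1 - i)))"
    using gap_sum_eq[of 0 n "X + n" a c] by (simp add: add_ac)
  also have "\<dots> = superfact (c + n) / superfact c * (superfact (a + n) / superfact a) * (superfact (0 + n)
      / superfact 0)
       * (superfact (a + 2 * c + X + n + 1 + n) / superfact (a + 2 * c + X + n + 1)) * (superfact (a + c + X
           + n + n) / superfact (a + c + X + n))
       / (superfact (c + X + n + 1) / superfact (c + X + n + 1 - n) * (superfact (a + c + n + n)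
           / superfact (a + c + n)) * (superfact (X + n) / superfact (X + n - n)))"
    unfolding prod_dividef prod.distrib prod_fact_up by (subst prod_fact_down, simp)+ (rule refl)
  finally show ?thesis by (simp add: add_ac mult_2)
qed

lemma gap_sum_odd:
  "gap_sum a (X + n) c (2 * n + 1)
     = (superfact (c + 1) / superfact c) * (superfact (a + c + X + n + 1) / superfact (a + c + X + n))
         / (superfact (c + X + n + 1) / superfact (c + X + n))
       * (superfact (c + n + 1) / superfact (c + 1) * (superfact (a + n) / superfact a) * superfact n
       * (superfact (a + 2 * c + X + 2 * n + 1) / superfact (a + 2 * c + X + n + 1)) * (superfact (a + c + X
           + 2 * n + 1) / superfact (a + c + X + n + 1))
       / (superfact (c + X + n) / superfact (c + X) * (superfact (a + c + 2 * n + 1) / superfact (a + c + n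
           + 1)) * (superfact (X + n) / superfact X)))"
proof -
  have "gap_sum a (X + n) c (2 * n + 1) = fact c * fact (a + c + X + n) / fact (c + X + n) *
      (\<Prod>i<n. fact (c + 1 + i) * fact (a + i) * fact (0 + i) * fact ((a + 2 * c + X + n + 1) + i) * fact ((a
          + c + X + n + 1) + i)
         / (fact ((c + X + n) - 1 - i) * fact ((a + c + n + 1) + i) * fact ((X + n) - 1 - i)))"
    using gap_sum_eq[of 1 n "X + n" a c] by (simp add: add_ac)
  also have "(\<Prod>i<n. fact (c + 1 + i) * fact (a + i) * fact (0 + i) * fact ((a + 2 * c + X + n + 1) + i)
      * fact ((a + c + X + n + 1) + i)
         / (fact ((c + X + n) - 1 - i) * fact ((a + c + n + 1) + i) * fact ((X + n) - 1 - i)))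
     = superfact (c + 1 + n) / superfact (c + 1) * (superfact (a + n) / superfact a) * (superfact (0 + n)
         / superfact 0)
       * (superfact (a + 2 * c + X + n + 1 + n) / superfact (a + 2 * c + X + n + 1)) * (superfact (a + c + X
           + n + 1 + n) / superfact (a + c + X + n + 1))
       / (superfact (c + X + n) / superfact (c + X + n - n) * (superfact (a + c + n + 1 + n) / superfact (a
           + c + n + 1)) * (superfact (X + n) / superfact (X + n - n)))"
    unfolding prod_dividef prod.distrib prod_fact_up by (subst prod_fact_down, simp)+ (rule refl)
  finally show ?thesis unfolding fact_superfact by (simp add: add_ac mult_2 del: superfact_simps(2))
qed

text \<open>Both sides are turned into quotients of superfactorials with arguments in a common normal
form, and then agree factor by factor.\<close>

lemma central_count_even:
  "PP a (X + n) c * superfact (a + c) * gap_sum a (X + n) c (2 * n) / superfact (a + c + 2 * n)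
   = PP (X + c + 1) n c
     * (\<Prod>i=1..X. pochhammer (real (n + a) + real i) c / pochhammer (real i) c)
     * (\<Prod>i=1..n. pochhammer (real (n + a + c) + real i) X / pochhammer (real c + real i) X
          * (pochhammer (real (n + a + c) + real i) (X + c + 1) / pochhammer (real c + real i) (X + c + 1)))"
proof -
  have 1: "PP a (X + n) c = superfact a * superfact (X + n) * superfact c * superfact (a + c + X + n)
      / (superfact (a + X + n) * superfact (c + X + n) * superfact (a + c))"
    unfolding PP_superfact by (simp add: add_ac)
  have 2: "PP (X + c + 1) n c = superfact (c + X + 1) * superfact n * superfact c * superfact (2 * c + X + n
      + 1) / (superfact (c + X + n + 1) * superfact (c + n) * superfact (2 * c + X + 1))"
    unfolding PP_superfact by (simp add: add_ac mult_2 del: superfact_simps)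
  have 3: "(\<Prod>i=1..X. pochhammer (real (n + a) + real i) c) = superfact (a + c + X + n) * superfact (a + n)
      / (superfact (a + X + n) * superfact (a + c + n))"
    unfolding prod_pochhammer by (simp add: add_ac)
  have 4: "(\<Prod>i=1..X. pochhammer (real i) c) = superfact (c + X) / (superfact X * superfact c)"
    using prod_pochhammer[of 0 c X] by (simp add: add_ac)
  have 5: "(\<Prod>i=1..n. pochhammer (real (n + a + c) + real i) X) = superfact (a + c + X + 2 * n)
      * superfact (a + c + n) / (superfact (a + c + 2 * n) * superfact (a + c + X + n))"
    unfolding prod_pochhammer by (simp add: add_ac mult_2)
  have 6: "(\<Prod>i=1..n. pochhammer (real c + real i) X) = superfact (c + X + n) * superfact c / (superfact (c
      + n) * superfact (c + X))"
    unfolding prod_pochhammer by (simp add: add_ac)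
  have 7: "(\<Prod>i=1..n. pochhammer (real (n + a + c) + real i) (X + c + 1)) = superfact (a + 2 * c + X + 2 * n
      + 1) * superfact (a + c + n) / (superfact (a + c + 2 * n) * superfact (a + 2 * c + X + n + 1))"
    unfolding prod_pochhammer by (simp add: add_ac mult_2 del: superfact_simps)
  have 8: "(\<Prod>i=1..n. pochhammer (real c + real i) (X + c + 1)) = superfact (2 * c + X + n + 1) * superfact c
      / (superfact (c + n) * superfact (2 * c + X + 1))"
    unfolding prod_pochhammer by (simp add: add_ac mult_2 del: superfact_simps)
  show ?thesis
    unfolding prod_dividef prod.distrib 1 2 3 4 5 6 7 8 gap_sum_even
    by (simp add: divide_simps del: superfact_simps)
qed

lemma central_count_odd:
  "PP a (X + n) c * superfact (a + c) * gap_sum a (X + n) c (2 * n + 1) / superfact (a + c + (2 * n + 1))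
   = PP (X + c) n (c + 1)
     * (\<Prod>i=1..n. pochhammer (real (n + a + c + 1) + real i) c / pochhammer (real (c + 1) + real i) c)
     * (\<Prod>i=1..X. pochhammer (real (n + a) + real i) (n + c + 1) / pochhammer (real i) (n + c + 1)
          * (pochhammer (real (n + a + 2 * c + 1) + real i) n / pochhammer (real (2 * c + 1) + real i) n))"
proof -
  have 1: "PP a (X + n) c = superfact a * superfact (X + n) * superfact c * superfact (a + c + X + n)
      / (superfact (a + X + n) * superfact (c + X + n) * superfact (a + c))"
    unfolding PP_superfact by (simp add: add_ac)
  have 2: "PP (X + c) n (c + 1) = superfact (c + X) * superfact n * superfact (c + 1) * superfact (2 * c + X
      + n + 1) / (superfact (c + X + n) * superfact (c + n + 1) * superfact (2 * c + X + 1))"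
    unfolding PP_superfact by (simp add: add_ac mult_2 del: superfact_simps)
  have 3: "(\<Prod>i=1..n. pochhammer (real (n + a + c + 1) + real i) c) = superfact (a + 2 * c + 2 * n + 1)
      * superfact (a + c + n + 1) / (superfact (a + c + 2 * n + 1) * superfact (a + 2 * c + n + 1))"
    unfolding prod_pochhammer by (simp add: add_ac mult_2 del: superfact_simps)
  have 4: "(\<Prod>i=1..n. pochhammer (real (c + 1) + real i) c) = superfact (2 * c + n + 1) * superfact (c + 1)
      / (superfact (c + n + 1) * superfact (2 * c + 1))"
    unfolding prod_pochhammer by (simp add: add_ac mult_2 del: superfact_simps)
  have 5: "(\<Prod>i=1..X. pochhammer (real (n + a) + real i) (n + c + 1)) = superfact (a + c + X + 2 * n + 1)
      * superfact (a + n) / (superfact (a + X + n) * superfact (a + c + 2 * n + 1))"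
    unfolding prod_pochhammer by (simp add: add_ac mult_2 del: superfact_simps)
  have 6: "(\<Prod>i=1..X. pochhammer (real i) (n + c + 1)) = superfact (c + X + n + 1) / (superfact X
      * superfact (c + n + 1))"
    using prod_pochhammer[of 0 "n + c + 1" X] by (simp add: add_ac del: superfact_simps(2))
  have 7: "(\<Prod>i=1..X. pochhammer (real (n + a + 2 * c + 1) + real i) n) = superfact (a + 2 * c + X + 2 * n
      + 1) * superfact (a + 2 * c + n + 1) / (superfact (a + 2 * c + X + n + 1) * superfact (a + 2 * c + 2
          * n + 1))"
    unfolding prod_pochhammer by (simp add: add_ac mult_2 del: superfact_simps)
  have 8: "(\<Prod>i=1..X. pochhammer (real (2 * c + 1) + real i) n) = superfact (2 * c + X + n + 1)
      * superfact (2 * c + 1) / (superfact (2 * c + X + 1) * superfact (2 * c + n + 1))"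
    unfolding prod_pochhammer by (simp add: add_ac mult_2 del: superfact_simps)
  have 9: "a + c + (2 * n + 1) = a + c + 2 * n + 1" by simp
  show ?thesis
    unfolding prod_dividef prod.distrib 1 2 3 4 5 6 7 8 9 gap_sum_odd
    by (simp add: divide_simps del: superfact_simps)
qed

section \<open>Lozenges, tilings and horizontal cuts\<close>

text \<open>Each lozenge contains exactly one up-pointing triangle and is named after the position of the
down-pointing one: below it (a lozenge crossing a horizontal lattice line), to its right, or to its
left.\<close>

definition vloz :: "int \<Rightarrow> int \<Rightarrow> unit_triangle set" where
  "vloz i j = {Up (i, j), Down (i, j)}"

definition rloz :: "int \<Rightarrow> int \<Rightarrow> unit_triangle set" where
  "rloz i j = {Up (i, j), Down (i, j + 1)}"

definition lloz :: "int \<Rightarrow> int \<Rightarrow> unit_triangle set" where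
  "lloz i j = {Up (i, j), Down (i - 1, j + 1)}"

lemmas loz_defs = vloz_def rloz_def lloz_def

text \<open>Describing the vertices by inequalities reduces adjacency of unit triangles to linear
arithmetic.\<close>

lemma verts_Up_iff: "(a, b) \<in> verts (Up (i, j)) \<longleftrightarrow> i \<le> a \<and> j \<le> b \<and> a + b \<le> i + j + 1"
  by auto

lemma verts_Down_iff: "(a, b) \<in> verts (Down (k, l)) \<longleftrightarrow> a \<le> k + 1 \<and> b \<le> l \<and> k + l \<le> a + b"
  by auto

lemma card_2_int_pairs:
  assumes "card (A \<inter> B) = 2"
  obtains a b a' b' :: int where "a \<noteq> a' \<or> b \<noteq> b'" "(a, b) \<in> A" "(a', b') \<in> A" "(a, b) \<in> B" "(a', b') \<in> B"
proof -
  obtain u v where uv: "A \<inter> B = {u, v}" "u \<noteq> v" using assms unfolding card_2_iff by blast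
  obtain a b a' b' where "u = (a, b)" "v = (a', b')" by fastforce
  then show ?thesis using uv by (intro that[of a a' b b']) blast+
qed

lemma up_down_adjacent:
  "card (verts (Up (i, j)) \<inter> verts (Down (k, l))) = 2
     \<longleftrightarrow> (k = i \<and> l = j) \<or> (k = i \<and> l = j + 1) \<or> (k = i - 1 \<and> l = j + 1)"
proof
  assume "card (verts (Up (i, j)) \<inter> verts (Down (k, l))) = 2"
  then show "(k = i \<and> l = j) \<or> (k = i \<and> l = j + 1) \<or> (k = i - 1 \<and> l = j + 1)"
  proof (rule card_2_int_pairs)
    fix a b a' b' assume "a \<noteq> a' \<or> b \<noteq> b'" "(a, b) \<in> verts (Up (i, j))" "(a', b') \<in> verts (Up (i, j))"
      "(a, b) \<in> verts (Down (k, l))" "(a', b') \<in> verts (Down (k, l))"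
    then show ?thesis unfolding verts_Up_iff verts_Down_iff by arith
  qed
next
  assume "(k = i \<and> l = j) \<or> (k = i \<and> l = j + 1) \<or> (k = i - 1 \<and> l = j + 1)"
  then have "verts (Up (i, j)) \<inter> verts (Down (k, l)) = {(i, j), (i + 1, j)} \<or>
    verts (Up (i, j)) \<inter> verts (Down (k, l)) = {(i + 1, j), (i, j + 1)} \<or>
    verts (Up (i, j)) \<inter> verts (Down (k, l)) = {(i, j), (i, j + 1)}"
    by (elim disjE conjE) auto
  then show "card (verts (Up (i, j)) \<inter> verts (Down (k, l))) = 2"
    by (elim disjE) simp_all
qed

lemma up_up_adjacent: "card (verts (Up p) \<inter> verts (Up q)) = 2 \<Longrightarrow> p = q"
proof -
  assume c: "card (verts (Up p) \<inter> verts (Up q)) = 2"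
  obtain i j k l where pq: "p = (i, j)" "q = (k, l)" by fastforce
  from c have "i = k \<and> j = l" unfolding pq
  proof (rule card_2_int_pairs)
    fix a b a' b' assume "a \<noteq> a' \<or> b \<noteq> b'" "(a, b) \<in> verts (Up (i, j))" "(a', b') \<in> verts (Up (i, j))"
      "(a, b) \<in> verts (Up (k, l))" "(a', b') \<in> verts (Up (k, l))"
    then show ?thesis unfolding verts_Up_iff by arith
  qed
  then show ?thesis using pq by simp
qed

lemma down_down_adjacent: "card (verts (Down p) \<inter> verts (Down q)) = 2 \<Longrightarrow> p = q"
proof -
  assume c: "card (verts (Down p) \<inter> verts (Down q)) = 2"
  obtain i j k l where pq: "p = (i, j)" "q = (k, l)" by fastforce
  from c have "i = k \<and> j = l" unfolding pq
  proof (rule card_2_int_pairs)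
    fix a b a' b' assume "a \<noteq> a' \<or> b \<noteq> b'" "(a, b) \<in> verts (Down (i, j))" "(a', b') \<in> verts (Down (i, j))"
      "(a, b) \<in> verts (Down (k, l))" "(a', b') \<in> verts (Down (k, l))"
    then show ?thesis unfolding verts_Down_iff by arith
  qed
  then show ?thesis using pq by simp
qed

lemma lozenge_iff: "lozenge L \<longleftrightarrow> (\<exists>i j. L = vloz i j \<or> L = rloz i j \<or> L = lloz i j)"
proof
  assume "lozenge L"
  then obtain t t' where L: "t \<noteq> t'" "card (verts t \<inter> verts t') = 2" "L = {t, t'}"
    unfolding lozenge_def by blast
  show "\<exists>i j. L = vloz i j \<or> L = rloz i j \<or> L = lloz i j"
  proof (cases t; cases t')
    fix p q assume t: "t = Up p" "t' = Down q"
    obtain i j k l where pq: "p = (i, j)" "q = (k, l)" by fastforce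
    show ?thesis using L(2,3) unfolding t pq up_down_adjacent loz_defs by blast
  next
    fix p q assume t: "t = Down q" "t' = Up p"
    obtain i j k l where pq: "p = (i, j)" "q = (k, l)" by fastforce
    have "card (verts (Up (i, j)) \<inter> verts (Down (k, l))) = 2" using L(2) t pq by (simp add: Int_commute)
    then show ?thesis using L(3) unfolding t pq up_down_adjacent loz_defs by blast
  qed (use L up_up_adjacent down_down_adjacent in blast)+
next
  assume "\<exists>i j. L = vloz i j \<or> L = rloz i j \<or> L = lloz i j"
  then obtain i j where ij: "L = vloz i j \<or> L = rloz i j \<or> L = lloz i j" by blast
  then obtain k l where kl: "L = {Up (i, j), Down (k, l)}"
    "(k = i \<and> l = j) \<or> (k = i \<and> l = j + 1) \<or> (k = i - 1 \<and> l = j + 1)"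
    unfolding loz_defs by blast
  then show "lozenge L"
    unfolding lozenge_def using up_down_adjacent[of i j k l]
    by (intro exI[of _ "Up (i, j)"] exI[of _ "Down (k, l)"]) simp
qed

lemma lozenge_nonempty: "lozenge L \<Longrightarrow> L \<noteq> {}"
  by (auto simp: lozenge_def)

lemma lozenge_tiling_iff:
  "lozenge_tiling R T \<longleftrightarrow> \<Union>T = R \<and> disjoint T \<and> (\<forall>L\<in>T. lozenge L)"
  by (auto simp: lozenge_tiling_def partition_on_def dest: lozenge_nonempty)

lemma tiling_tile:
  assumes "lozenge_tiling R T" "L \<in> T"
  shows "lozenge L" "L \<subseteq> R" "L \<noteq> {}"
  using assms lozenge_nonempty[of L] by (auto simp: lozenge_tiling_iff)

definition tilings :: "region \<Rightarrow> unit_triangle set set set" where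
  "tilings R = {T. lozenge_tiling R T}"

lemma num_tilings_eq: "num_tilings R = card (tilings R)"
  by (simp add: num_tilings_def tilings_def)

lemma tilings_subset: "tilings R \<subseteq> Pow (Pow R)"
  by (auto simp: tilings_def lozenge_tiling_iff)

lemma finite_tilings: "finite R \<Longrightarrow> finite (tilings R)"
  using tilings_subset by (rule finite_subset) simp

lemma tile_unique:
  assumes "lozenge_tiling R T" "L \<in> T" "L' \<in> T" "t \<in> L" "t \<in> L'"
  shows "L = L'"
  using assms by (auto simp: lozenge_tiling_iff disjoint_def)

lemma tiles_disjoint:
  assumes "lozenge_tiling R T" "S \<subseteq> T" "S' \<subseteq> T" "S \<inter> S' = {}"
  shows "\<Union>S \<inter> \<Union>S' = {}"
proof (rule ccontr)
  assume "\<Union>S \<inter> \<Union>S' \<noteq> {}"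
  then obtain t L L' where t: "t \<in> L" "t \<in> L'" "L \<in> S" "L' \<in> S'" by blast
  then have "L = L'" using tile_unique[OF assms(1), of L L' t] assms(2,3) by blast
  then show False using t assms(4) by blast
qed

lemma tiling_Un:
  assumes "lozenge_tiling A T" "lozenge_tiling B T'" "A \<inter> B = {}"
  shows "lozenge_tiling (A \<union> B) (T \<union> T')"
proof -
  have "disjoint (T \<union> T')"
    using assms by (intro disjoint_union) (auto simp: lozenge_tiling_iff)
  then show ?thesis using assms by (auto simp: lozenge_tiling_iff)
qed

lemma tiling_Diff:
  assumes "lozenge_tiling R T" "V \<subseteq> T"
  shows "lozenge_tiling (R - \<Union>V) (T - V)"
proof -
  have "\<Union>(T - V) = R - \<Union>V"
  proof (intro subset_antisym subsetI)
    fix t assume "t \<in> \<Union>(T - V)"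
    then obtain L where L: "t \<in> L" "L \<in> T" "L \<notin> V" by blast
    then have "t \<notin> \<Union>V" using tile_unique[OF assms(1)] assms(2) by blast
    then show "t \<in> R - \<Union>V" using L assms(1) by (auto simp: lozenge_tiling_iff)
  next
    fix t assume "t \<in> R - \<Union>V"
    then show "t \<in> \<Union>(T - V)" using assms(1) unfolding lozenge_tiling_iff by blast
  qed
  moreover have "disjoint (T - V)"
    using assms(1) by (auto simp: lozenge_tiling_iff disjoint_def)
  ultimately show ?thesis using assms(1) by (auto simp: lozenge_tiling_iff)
qed

lemma num_tilings_forced:
  assumes "lozenge_tiling Q V" "Q \<subseteq> R" and forced: "\<And>T. lozenge_tiling R T \<Longrightarrow> V \<subseteq> T"
  shows "num_tilings R = num_tilings (R - Q)"
proof -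
  have Q: "\<Union>V = Q" using assms(1) by (simp add: lozenge_tiling_iff)
  have "bij_betw (\<lambda>T. T - V) (tilings R) (tilings (R - Q))"
  proof (rule bij_betw_byWitness[where f' = "\<lambda>T. T \<union> V"])
    show "\<forall>T\<in>tilings R. T - V \<union> V = T" using forced by (auto simp: tilings_def)
    show "\<forall>T\<in>tilings (R - Q). T \<union> V - V = T"
    proof
      fix T assume T: "T \<in> tilings (R - Q)"
      have "T \<inter> V = {}"
      proof (rule ccontr)
        assume "T \<inter> V \<noteq> {}"
        then obtain L where L: "L \<in> T" "L \<in> V" by blast
        then have "L \<noteq> {}" using assms(1) tiling_tile(3) by blast
        moreover have "L \<subseteq> R - Q" "L \<subseteq> Q" using L T Q by (auto simp: tilings_def lozenge_tiling_iff)
        ultimately show False by blast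
      qed
      then show "T \<union> V - V = T" by blast
    qed
    show "(\<lambda>T. T - V) ` tilings R \<subseteq> tilings (R - Q)"
      using tiling_Diff[OF _ forced] Q by (auto simp: tilings_def)
    have "lozenge_tiling R (T \<union> V)" if "lozenge_tiling (R - Q) T" for T
    proof -
      have "R - Q \<union> Q = R" "(R - Q) \<inter> Q = {}" using assms(2) by blast+
      then show ?thesis using tiling_Un[OF that assms(1)] by simp
    qed
    then show "(\<lambda>T. T \<union> V) ` tilings (R - Q) \<subseteq> tilings R" by (auto simp: tilings_def)
  qed
  then show ?thesis unfolding num_tilings_eq by (rule bij_betw_same_card)
qed

fun above :: "int \<Rightarrow> unit_triangle \<Rightarrow> bool" where
  "above h (Up (i, j)) \<longleftrightarrow> h \<le> j"
| "above h (Down (i, j)) \<longleftrightarrow> h < j"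

definition ups :: "int \<Rightarrow> int set \<Rightarrow> region" where
  "ups h E = (\<lambda>i. Up (i, h)) ` E"

definition downs :: "int \<Rightarrow> int set \<Rightarrow> region" where
  "downs h E = (\<lambda>i. Down (i, h)) ` E"

definition vlozs :: "int \<Rightarrow> int set \<Rightarrow> unit_triangle set set" where
  "vlozs h E = (\<lambda>i. vloz i h) ` E"

lemma ups_iff [simp]: "Up (i, j) \<in> ups h E \<longleftrightarrow> j = h \<and> i \<in> E" "Down p \<notin> ups h E"
  by (auto simp: ups_def)

lemma downs_iff [simp]: "Down (i, j) \<in> downs h E \<longleftrightarrow> j = h \<and> i \<in> E" "Up p \<notin> downs h E"
  by (auto simp: downs_def)

lemma vloz_inj: "vloz i j = vloz k l \<longleftrightarrow> i = k \<and> j = l"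
  by (auto simp: vloz_def doubleton_eq_iff)

lemma tiling_vlozs: "lozenge_tiling (ups h E \<union> downs h E) (vlozs h E)"
  unfolding lozenge_tiling_iff
proof (intro conjI)
  show "\<Union>(vlozs h E) = ups h E \<union> downs h E" by (auto simp: vlozs_def vloz_def ups_def downs_def)
  show "disjoint (vlozs h E)" by (auto simp: vlozs_def vloz_def disjoint_def)
  show "\<forall>L\<in>vlozs h E. lozenge L" by (auto simp: vlozs_def lozenge_iff)
qed

lemma lozenge_crossing:
  assumes "lozenge L" "t \<in> L" "t' \<in> L" "above h t" "\<not> above h t'"
  obtains i where "L = vloz i h"
proof -
  from assms(1) obtain i j where "L = vloz i j \<or> L = rloz i j \<or> L = lloz i j"
    unfolding lozenge_iff by blast
  then have "L = vloz i h" using assms(2-) by (auto simp: loz_defs)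
  then show ?thesis by (rule that)
qed

text \<open>A region that is divided by the horizontal line at height \<open>h\<close>. The only lozenges meeting both
parts are the vertical ones crossing the line, so a tiling amounts to a set of crossings together
with tilings of what these crossings leave of both parts.\<close>

locale horizontal_cut =
  fixes h :: int and A B :: region
  assumes A_above: "t \<in> A \<Longrightarrow> above h t"
    and B_below: "t \<in> B \<Longrightarrow> \<not> above h t"
begin

definition crossings :: "int set" where
  "crossings = {i. Up (i, h) \<in> A \<and> Down (i, h) \<in> B}"

lemma AB_disjoint: "A \<inter> B = {}"
  using A_above B_below by blast

lemma glue:
  assumes "E \<subseteq> crossings" "lozenge_tiling (A - ups h E) TA" "lozenge_tiling (B - downs h E) TB"
  shows "lozenge_tiling (A \<union> B) (TA \<union> TB \<union> vlozs h E)"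
proof -
  have E: "ups h E \<subseteq> A" "downs h E \<subseteq> B" using assms(1) by (auto simp: crossings_def ups_def downs_def)
  have "lozenge_tiling ((A - ups h E \<union> (B - downs h E)) \<union> (ups h E \<union> downs h E)) (TA \<union> TB \<union> vlozs h E)"
    by (intro tiling_Un tiling_vlozs assms(2,3)) (use AB_disjoint E in blast)+
  also have "(A - ups h E \<union> (B - downs h E)) \<union> (ups h E \<union> downs h E) = A \<union> B"
    using E by blast
  finally show ?thesis .
qed

lemma glue_parts:
  assumes "lozenge_tiling (A - ups h E) TA" "lozenge_tiling (B - downs h E) TB"
  shows "{L \<in> TA \<union> TB \<union> vlozs h E. L \<subseteq> A} = TA" "{L \<in> TA \<union> TB \<union> vlozs h E. L \<subseteq> B} = TB"
    "{i. vloz i h \<in> TA \<union> TB \<union> vlozs h E} = E"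
proof -
  have ne: "L \<noteq> {}" if "L \<in> TA \<union> TB" for L
    using that assms tiling_tile(3) by blast
  have sub: "L \<in> TA \<Longrightarrow> L \<subseteq> A" "L \<in> TB \<Longrightarrow> L \<subseteq> B" for L
    using assms by (auto simp: lozenge_tiling_iff)
  have v: "\<not> vloz i h \<subseteq> A" "\<not> vloz i h \<subseteq> B" for i
    using A_above[of "Down (i, h)"] B_below[of "Up (i, h)"] by (auto simp: vloz_def)
  show "{L \<in> TA \<union> TB \<union> vlozs h E. L \<subseteq> A} = TA" "{L \<in> TA \<union> TB \<union> vlozs h E. L \<subseteq> B} = TB"
    using ne sub v AB_disjoint unfolding vlozs_def by blast+
  show "{i. vloz i h \<in> TA \<union> TB \<union> vlozs h E} = E"
    using sub(1)[of "vloz _ h"] sub(2)[of "vloz _ h"] v by (auto simp: vlozs_def vloz_inj)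
qed

lemma cut:
  assumes T: "lozenge_tiling (A \<union> B) T"
  defines "E \<equiv> {i. vloz i h \<in> T}"
  shows "E \<subseteq> crossings" "lozenge_tiling (A - ups h E) {L \<in> T. L \<subseteq> A}"
    "lozenge_tiling (B - downs h E) {L \<in> T. L \<subseteq> B}"
    "T = {L \<in> T. L \<subseteq> A} \<union> {L \<in> T. L \<subseteq> B} \<union> vlozs h E"
proof -
  have loz: "lozenge L" "L \<subseteq> A \<union> B" if "L \<in> T" for L using tiling_tile[OF T that] by blast+
  show E: "E \<subseteq> crossings"
  proof
    fix i assume "i \<in> E"
    then have "vloz i h \<subseteq> A \<union> B" using loz by (auto simp: E_def)
    then show "i \<in> crossings"
      using A_above[of "Down (i, h)"] B_below[of "Up (i, h)"] by (auto simp: vloz_def crossings_def)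
  qed
  have trich: "L \<subseteq> A \<or> L \<subseteq> B \<or> L \<in> vlozs h E" if L: "L \<in> T" for L
  proof (rule ccontr)
    assume c: "\<not> (L \<subseteq> A \<or> L \<subseteq> B \<or> L \<in> vlozs h E)"
    then obtain t t' where "t \<in> L" "t' \<in> L" "t \<in> A" "t' \<in> B" using loz(2)[OF L] by blast
    then obtain i where "L = vloz i h" using lozenge_crossing[OF loz(1)[OF L]] A_above B_below by metis
    then show False using c L by (auto simp: E_def vlozs_def)
  qed
  have vT: "vlozs h E \<subseteq> T" by (auto simp: E_def vlozs_def)
  show eq: "T = {L \<in> T. L \<subseteq> A} \<union> {L \<in> T. L \<subseteq> B} \<union> vlozs h E" using trich vT by blast
  have v: "\<not> vloz i h \<subseteq> A" "\<not> vloz i h \<subseteq> B" for i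
    using A_above[of "Down (i, h)"] B_below[of "Up (i, h)"] by (auto simp: vloz_def)
  define TA TB where "TA = {L \<in> T. L \<subseteq> A}" and "TB = {L \<in> T. L \<subseteq> B}"
  have T_eq: "T = TA \<union> TB \<union> vlozs h E" using eq unfolding TA_def TB_def .
  have Uv: "\<Union>(vlozs h E) = ups h E \<union> downs h E"
    using tiling_vlozs[of h E] by (simp add: lozenge_tiling_iff)
  have ud: "ups h E \<subseteq> A" "downs h E \<subseteq> B" using E by (auto simp: crossings_def ups_def downs_def)
  have "\<Union>T = A \<union> B" using T by (simp add: lozenge_tiling_iff)
  then have U: "\<Union>TA \<union> \<Union>TB \<union> (ups h E \<union> downs h E) = A \<union> B"
    unfolding T_eq Union_Un_distrib Uv .
  have sub: "\<Union>TA \<subseteq> A" "\<Union>TB \<subseteq> B" unfolding TA_def TB_def by blast+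
  have v0: "TA \<inter> vlozs h E = {}" "TB \<inter> vlozs h E = {}"
    using v unfolding TA_def TB_def vlozs_def by blast+
  have sT: "TA \<subseteq> T" "TB \<subseteq> T" unfolding TA_def TB_def by blast+
  have "\<Union>TA \<inter> \<Union>(vlozs h E) = {}" "\<Union>TB \<inter> \<Union>(vlozs h E) = {}"
    by (rule tiles_disjoint[OF T sT(1) vT v0(1)], rule tiles_disjoint[OF T sT(2) vT v0(2)])
  then have dj: "\<Union>TA \<inter> ups h E = {}" "\<Union>TB \<inter> downs h E = {}"
    unfolding Uv by blast+
  have aux: "X = C - P" if "X \<inter> P = {}" "X \<subseteq> C" "C \<inter> D = {}" "Y \<subseteq> D" "Q \<subseteq> D" "P \<subseteq> C"
    "X \<union> Y \<union> (P \<union> Q) = C \<union> D" for X Y P Q C D :: "unit_triangle set"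
  proof (intro subset_antisym subsetI)
    fix t assume t: "t \<in> C - P"
    then have "t \<in> X \<union> Y \<union> (P \<union> Q)" unfolding that(7) by simp
    then show "t \<in> X" using t that(3,4,5) by auto
  qed (use that(1,2) in auto)
  have "\<Union>TA = A - ups h E"
    by (rule aux[OF dj(1) sub(1) AB_disjoint sub(2) ud(2,1) U])
  moreover have "\<Union>TB = B - downs h E"
    by (rule aux[OF dj(2) sub(2) _ sub(1) ud(1,2)]) (use AB_disjoint U in \<open>simp_all add: ac_simps\<close>)
  moreover have "disjoint TA" "disjoint TB"
    using T by (auto simp: lozenge_tiling_iff disjoint_def TA_def TB_def)
  ultimately show "lozenge_tiling (A - ups h E) {L \<in> T. L \<subseteq> A}" "lozenge_tiling (B - downs h E) {L \<in> T. L \<subseteq> B}"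
    using loz(1) unfolding lozenge_tiling_iff TA_def TB_def by blast+
qed

lemma finite_crossings: "finite A \<Longrightarrow> finite crossings"
proof -
  assume "finite A"
  then have "finite ((\<lambda>i. Up (i, h)) -` A)" by (rule finite_vimageI) (simp add: inj_on_def)
  then show ?thesis by (rule rev_finite_subset) (auto simp: crossings_def)
qed

lemma num_tilings_cut:
  assumes "finite A" "finite B"
  shows "num_tilings (A \<union> B)
     = (\<Sum>E\<in>Pow crossings. num_tilings (A - ups h E) * num_tilings (B - downs h E))"
proof -
  let ?S = "SIGMA E:Pow crossings. tilings (A - ups h E) \<times> tilings (B - downs h E)"
  let ?cut = "\<lambda>T. ({i. vloz i h \<in> T}, {L \<in> T. L \<subseteq> A}, {L \<in> T. L \<subseteq> B})"
  let ?glue = "\<lambda>(E, TA, TB). TA \<union> TB \<union> vlozs h E"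
  have "bij_betw ?cut (tilings (A \<union> B)) ?S"
  proof (rule bij_betw_byWitness[where f' = ?glue])
    show "\<forall>T\<in>tilings (A \<union> B). ?glue (?cut T) = T"
      using cut(4) unfolding tilings_def by simp
    show "\<forall>X\<in>?S. ?cut (?glue X) = X"
    proof
      fix X assume "X \<in> ?S"
      then obtain E TA TB where X: "X = (E, TA, TB)"
        "lozenge_tiling (A - ups h E) TA" "lozenge_tiling (B - downs h E) TB"
        unfolding tilings_def by (elim SigmaE) simp
      show "?cut (?glue X) = X" using glue_parts[OF X(2,3)] X(1) by simp
    qed
    show "?cut ` tilings (A \<union> B) \<subseteq> ?S"
      using cut(1-3) unfolding tilings_def by (intro image_subsetI SigmaI) simp_all
    show "?glue ` ?S \<subseteq> tilings (A \<union> B)"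
    proof
      fix T assume "T \<in> ?glue ` ?S"
      then obtain E TA TB where X: "T = TA \<union> TB \<union> vlozs h E" "E \<subseteq> crossings"
        "lozenge_tiling (A - ups h E) TA" "lozenge_tiling (B - downs h E) TB"
        unfolding tilings_def by (auto elim!: imageE SigmaE)
      show "T \<in> tilings (A \<union> B)" unfolding tilings_def X(1) using glue[OF X(2-4)] by simp
    qed
  qed
  then have "num_tilings (A \<union> B) = card ?S" unfolding num_tilings_eq by (rule bij_betw_same_card)
  also have "\<dots> = (\<Sum>E\<in>Pow crossings. card (tilings (A - ups h E) \<times> tilings (B - downs h E)))"
    by (rule card_SigmaI) (use finite_crossings assms in \<open>auto intro: finite_tilings\<close>)
  finally show ?thesis by (simp add: card_cartesian_product num_tilings_eq)
qed

end

section \<open>Centrally symmetric tilings\<close>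

lemma rot_rot [simp]: "rot z (rot z t) = t"
  by (cases z; cases t rule: unit_triangle.exhaust) (auto split: prod.splits)

lemma rot_vloz: "rot (z1, 2 * h) ` vloz i h = vloz (z1 - 1 - i) h"
  by (auto simp: vloz_def)

lemma lozenge_rot: "lozenge L \<Longrightarrow> lozenge (rot z ` L)"
proof -
  assume "lozenge L"
  then obtain i j where ij: "L = vloz i j \<or> L = rloz i j \<or> L = lloz i j" unfolding lozenge_iff by blast
  obtain z1 z2 where z: "z = (z1, z2)" by fastforce
  have "rot z ` vloz i j = vloz (z1 - i - 1) (z2 - j)" "rot z ` rloz i j = rloz (z1 - i - 1) (z2 - j - 1)"
    "rot z ` lloz i j = lloz (z1 - i) (z2 - j - 1)"
    by (auto simp: loz_defs z)
  then show "lozenge (rot z ` L)" using ij unfolding lozenge_iff by metis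
qed

lemma tiling_rot: "lozenge_tiling R T \<Longrightarrow> lozenge_tiling (rot z ` R) ((`) (rot z) ` T)"
proof -
  assume T: "lozenge_tiling R T"
  have inj: "inj (rot z)" by (metis injI rot_rot)
  have "disjoint ((`) (rot z) ` T)"
  proof (rule disjointI)
    fix a b assume "a \<in> (`) (rot z) ` T" "b \<in> (`) (rot z) ` T" "a \<noteq> b"
    then obtain L L' where L: "a = rot z ` L" "b = rot z ` L'" "L \<in> T" "L' \<in> T" "L \<noteq> L'" by blast
    then have "L \<inter> L' = {}" using T by (auto simp: lozenge_tiling_iff disjoint_def)
    then show "a \<inter> b = {}" using L(1,2) image_Int[OF inj, of L L'] by simp
  qed
  moreover have "\<Union>((`) (rot z) ` T) = rot z ` R" using T by (auto simp: lozenge_tiling_iff)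
  ultimately show ?thesis using T lozenge_rot by (auto simp: lozenge_tiling_iff)
qed

text \<open>In a symmetric tiling the lower half is the image of the upper half, so only the upper half
and a symmetric set of crossings can be chosen.\<close>

lemma Mc_cut:
  assumes fin: "finite A" and A: "\<And>t. t \<in> A \<Longrightarrow> above h t"
  shows "Mc (z1, 2 * h) (A \<union> rot (z1, 2 * h) ` A)
     = (\<Sum>E | E \<subseteq> {i. Up (i, h) \<in> A \<and> Up (z1 - 1 - i, h) \<in> A} \<and> (\<lambda>i. z1 - 1 - i) ` E
         = E. num_tilings (A - ups h E))"
proof -
  let ?r = "rot (z1, 2 * h)"
  let ?B = "?r ` A"
  let ?f = "\<lambda>i. z1 - 1 - i"
  have mem: "t \<in> ?B \<longleftrightarrow> ?r t \<in> A" for t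
  proof
    assume "?r t \<in> A"
    then have "?r (?r t) \<in> ?B" by (rule imageI)
    then show "t \<in> ?B" by simp
  qed auto
  have below: "\<not> above h t" if "t \<in> ?B" for t
  proof -
    have "above h (?r t)" using that A mem by blast
    then show ?thesis by (cases t rule: unit_triangle.exhaust) auto
  qed
  interpret horizontal_cut h A ?B using A below by unfold_locales auto
  have cr: "crossings = {i. Up (i, h) \<in> A \<and> Up (z1 - 1 - i, h) \<in> A}"
    unfolding crossings_def mem by (simp add: algebra_simps)
  let ?I = "{E. E \<subseteq> crossings \<and> ?f ` E = E}"
  let ?S = "SIGMA E:?I. tilings (A - ups h E)"
  let ?g = "\<lambda>(E, TA). TA \<union> (`) ?r ` TA \<union> vlozs h E"
  have rot_vlozs: "(`) ?r ` vlozs h E = vlozs h (?f ` E)" for E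
    by (simp add: vlozs_def image_image rot_vloz)
  have rotB: "?r ` (A - ups h E) = ?B - downs h E" if "?f ` E = E" for E
  proof -
    have "?r ` ups h E = downs h (?f ` E)"
      by (auto simp: ups_def downs_def image_image algebra_simps)
    moreover have "inj ?r" by (metis injI rot_rot)
    ultimately show ?thesis using that by (simp add: image_set_diff)
  qed
  have invol: "(`) ?r ` ((`) ?r ` T) = T" for T by (simp add: image_image)
  have subset_iff: "?r ` L \<subseteq> ?B \<longleftrightarrow> L \<subseteq> A" for L
  proof
    assume "?r ` L \<subseteq> ?B"
    then have "?r ` ?r ` L \<subseteq> ?r ` ?B" by (rule image_mono)
    then show "L \<subseteq> A" by (simp add: image_image)
  qed (rule image_mono)
  have "bij_betw ?g ?S {T. lozenge_tiling (A \<union> ?B) T \<and> (`) ?r ` T = T}"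
  proof (rule bij_betw_byWitness[where f' = "\<lambda>T. ({i. vloz i h \<in> T}, {L \<in> T. L \<subseteq> A})"])
    show "\<forall>X\<in>?S. (\<lambda>T. ({i. vloz i h \<in> T}, {L \<in> T. L \<subseteq> A})) (?g X) = X"
    proof
      fix X assume "X \<in> ?S"
      then obtain E TA where X: "X = (E, TA)" "E \<in> ?I" "lozenge_tiling (A - ups h E) TA"
        unfolding tilings_def by (auto elim!: imageE SigmaE)
      have "lozenge_tiling (?B - downs h E) ((`) ?r ` TA)"
        using tiling_rot[OF X(3), of "(z1, 2 * h)"] rotB[of E] X(2) by simp
      from glue_parts[OF X(3) this] show "(\<lambda>T. ({i. vloz i h \<in> T}, {L \<in> T. L \<subseteq> A})) (?g X) = X"
        using X(1) by simp
    qed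
    have part: "{L \<in> T. L \<subseteq> ?B} = (`) ?r ` {L \<in> T. L \<subseteq> A}" if "(`) ?r ` T = T" for T
    proof -
      have "{L \<in> (`) ?r ` T. L \<subseteq> ?B} = (`) ?r ` {L \<in> T. L \<subseteq> A}" using subset_iff by blast
      then show ?thesis using that by simp
    qed
    show "\<forall>T\<in>{T. lozenge_tiling (A \<union> ?B) T \<and> (`) ?r ` T = T}. ?g ({i. vloz i h \<in> T}, {L \<in> T. L \<subseteq> A}) = T"
    proof
      fix T assume "T \<in> {T. lozenge_tiling (A \<union> ?B) T \<and> (`) ?r ` T = T}"
      then have T: "lozenge_tiling (A \<union> ?B) T" "(`) ?r ` T = T" by simp_all
      show "?g ({i. vloz i h \<in> T}, {L \<in> T. L \<subseteq> A}) = T"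
        using cut(4)[OF T(1)] part[OF T(2)] by simp
    qed
    show "?g ` ?S \<subseteq> {T. lozenge_tiling (A \<union> ?B) T \<and> (`) ?r ` T = T}"
    proof
      fix T assume "T \<in> ?g ` ?S"
      then obtain E TA where X: "T = ?g (E, TA)" "E \<in> ?I" "lozenge_tiling (A - ups h E) TA"
        unfolding tilings_def by (auto elim!: imageE SigmaE)
      have "lozenge_tiling (?B - downs h E) ((`) ?r ` TA)"
        using tiling_rot[OF X(3), of "(z1, 2 * h)"] rotB[of E] X(2) by simp
      then have "lozenge_tiling (A \<union> ?B) T" using glue[OF _ X(3)] X(1,2) by simp
      moreover have "(`) ?r ` T = T"
        using X(1,2) by (simp add: image_Un invol rot_vlozs Un_commute)
      ultimately show "T \<in> {T. lozenge_tiling (A \<union> ?B) T \<and> (`) ?r ` T = T}" by blast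
    qed
    show "(\<lambda>T. ({i. vloz i h \<in> T}, {L \<in> T. L \<subseteq> A})) ` {T. lozenge_tiling (A \<union> ?B) T \<and> (`) ?r ` T = T} \<subseteq> ?S"
    proof (rule image_subsetI)
      fix T assume "T \<in> {T. lozenge_tiling (A \<union> ?B) T \<and> (`) ?r ` T = T}"
      then have T: "lozenge_tiling (A \<union> ?B) T" "(`) ?r ` T = T" by simp_all
      have sym: "vloz (?f i) h \<in> T" if "vloz i h \<in> T" for i
      proof -
        have "?r ` vloz i h \<in> (`) ?r ` T" using that by blast
        then show ?thesis using T(2) by (simp add: rot_vloz)
      qed
      have "?f ` {i. vloz i h \<in> T} = {i. vloz i h \<in> T}"
      proof (intro subset_antisym subsetI)
        fix i assume "i \<in> {i. vloz i h \<in> T}"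
        then have "vloz (?f i) h \<in> T" "i = ?f (?f i)" using sym by auto
        then show "i \<in> ?f ` {i. vloz i h \<in> T}" by blast
      qed (use sym in auto)
      then show "({i. vloz i h \<in> T}, {L \<in> T. L \<subseteq> A}) \<in> ?S"
        using cut(1,2)[OF T(1)] by (simp add: tilings_def)
    qed
  qed
  then have "Mc (z1, 2 * h) (A \<union> ?B) = card ?S" unfolding Mc_def by (rule bij_betw_same_card[symmetric])
  also have "\<dots> = (\<Sum>E\<in>?I. num_tilings (A - ups h E))"
    unfolding num_tilings_eq by (rule card_SigmaI) (use fin finite_crossings in \<open>auto intro: finite_tilings\<close>)
  finally show ?thesis unfolding cr .
qed

section \<open>Tilings of one row\<close>

text \<open>The unit triangles between the heights \<open>h\<close> and \<open>h + 1\<close> of a trapezoid with base \<open>w\<close>, without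
the up-pointing ones at \<open>D\<close> and the down-pointing ones at \<open>E\<close>, which are covered from below and from
above.\<close>

definition row_region :: "int \<Rightarrow> int \<Rightarrow> int set \<Rightarrow> int set \<Rightarrow> region" where
  "row_region h w D E = ups h ({0..<w} - D) \<union> downs (h + 1) ({0..<w - 1} - E)"

lemma row_region_iff [simp]:
  "Up (i, j) \<in> row_region h w D E \<longleftrightarrow> j = h \<and> 0 \<le> i \<and> i < w \<and> i \<notin> D"
  "Down (i, j) \<in> row_region h w D E \<longleftrightarrow> j = h + 1 \<and> 0 \<le> i \<and> i < w - 1 \<and> i \<notin> E"
  by (auto simp: row_region_def)

lemma loz_mem:
  "Up (i, j) \<in> vloz k l \<longleftrightarrow> i = k \<and> j = l" "Down (i, j) \<in> vloz k l \<longleftrightarrow> i = k \<and> j = l"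
  "Up (i, j) \<in> rloz k l \<longleftrightarrow> i = k \<and> j = l" "Down (i, j) \<in> rloz k l \<longleftrightarrow> i = k \<and> j = l + 1"
  "Up (i, j) \<in> lloz k l \<longleftrightarrow> i = k \<and> j = l" "Down (i, j) \<in> lloz k l \<longleftrightarrow> i = k - 1 \<and> j = l + 1"
  by (simp_all add: loz_defs)

lemma loz_eq:
  "rloz i j = rloz k l \<longleftrightarrow> i = k \<and> j = l" "lloz i j = lloz k l \<longleftrightarrow> i = k \<and> j = l"
  "rloz i j \<noteq> lloz k l" "lloz i j \<noteq> rloz k l"
proof -
  show "rloz i j = rloz k l \<longleftrightarrow> i = k \<and> j = l" using loz_mem(3)[of i j] by blast
  show "lloz i j = lloz k l \<longleftrightarrow> i = k \<and> j = l" using loz_mem(5)[of i j] by blast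
  show "rloz i j \<noteq> lloz k l" "lloz i j \<noteq> rloz k l"
    using loz_mem(3-6)[of i] loz_mem(4,6)[of _ "j + 1"]
        by (metis add_cancel_right_right diff_add_cancel zero_neq_one)+
qed

lemma row_tiles:
  assumes "lozenge_tiling (row_region h w D E) T" "L \<in> T"
  obtains i where "L = rloz i h" | i where "L = lloz i h"
proof -
  have L: "lozenge L" "L \<subseteq> row_region h w D E" using tiling_tile[OF assms] by blast+
  then obtain i j where ij: "L = vloz i j \<or> L = rloz i j \<or> L = lloz i j" unfolding lozenge_iff by blast
  have no_v: "\<not> vloz i j \<subseteq> row_region h w D E" for i j by (simp add: vloz_def)
  have row_eq: "j = h" if "rloz i j \<subseteq> row_region h w D E \<or> lloz i j \<subseteq> row_region h w D E" for i j
    using that by (auto simp: rloz_def lloz_def)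
  consider "L = rloz i h" | "L = lloz i h"
    using ij L(2) no_v[of i j] row_eq[of i j] by metis
  then show ?thesis using that by cases blast+
qed

text \<open>A unit triangle of the region lies in exactly one tile, which leans to the left or to the
right. Written with indicator functions this becomes a system of linear equations for the tiles.\<close>

lemma row_balance:
  assumes T: "lozenge_tiling (row_region h w D E) T"
  shows "of_bool (Up (i, h) \<in> row_region h w D E) = of_bool (lloz i h \<in> T) + (of_bool (rloz i h \<in> T) :: int)"
    and "of_bool (Down (i, h + 1) \<in> row_region h w D E) = of_bool (rloz i h \<in> T) + (of_bool (lloz (i
        + 1) h \<in> T) :: int)"
proof -
  have U: "\<Union>T = row_region h w D E" using T by (simp add: lozenge_tiling_iff)
  have up: "Up (i, h) \<in> L \<longleftrightarrow> L = lloz i h \<or> L = rloz i h" if "L \<in> T" for L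
    using T that by (rule row_tiles) (auto simp add: loz_eq loz_mem)
  have dn: "Down (i, h + 1) \<in> L \<longleftrightarrow> L = lloz (i + 1) h \<or> L = rloz i h" if "L \<in> T" for L
    using T that by (rule row_tiles) (auto simp add: loz_eq loz_mem)
  have "Up (i, h) \<in> row_region h w D E \<longleftrightarrow> lloz i h \<in> T \<or> rloz i h \<in> T"
    unfolding U[symmetric] using up by blast
  moreover have "\<not> (lloz i h \<in> T \<and> rloz i h \<in> T)"
    using tile_unique[OF T, of "lloz i h" "rloz i h" "Up (i, h)"] by (auto simp: loz_eq loz_mem)
  ultimately show "of_bool (Up (i, h) \<in> row_region h w D E) = of_bool (lloz i h \<in> T)
      + (of_bool (rloz i h \<in> T) :: int)"
    by auto
  have "Down (i, h + 1) \<in> row_region h w D E \<longleftrightarrow> lloz (i + 1) h \<in> T \<or> rloz i h \<in> T"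
    unfolding U[symmetric] using dn by blast
  moreover have "\<not> (lloz (i + 1) h \<in> T \<and> rloz i h \<in> T)"
    using tile_unique[OF T, of "lloz (i + 1) h" "rloz i h" "Down (i, h + 1)"] by (auto simp: loz_eq loz_mem)
  ultimately show "of_bool (Down (i, h + 1) \<in> row_region h w D E) = of_bool (rloz i h \<in> T)
      + (of_bool (lloz (i + 1) h \<in> T) :: int)"
    by auto
qed

text \<open>Along a row the indicator of the left-leaning tiles changes by the difference of available
down- and up-pointing triangles.\<close>

lemma row_flow:
  assumes T: "lozenge_tiling (row_region h w D E) T" and "u \<le> v"
  shows "of_bool (lloz v h \<in> T) - of_bool (lloz u h \<in> T)
     = (\<Sum>i\<in>{u..<v}. of_bool (Down (i, h
         + 1) \<in> row_region h w D E) - of_bool (Up (i, h) \<in> row_region h w D E) :: int)"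
  using assms(2)
proof (induction v rule: int_ge_induct)
  case (step v)
  have "{u..<v + 1} = insert v {u..<v}" using step by auto
  then show ?case using step row_balance[OF T, of v] by simp
qed simp

lemma lloz_outside:
  assumes T: "lozenge_tiling (row_region h w D E) T" and "i \<le> 0 \<or> i \<ge> w \<or> i \<in> D"
  shows "lloz i h \<notin> T"
proof
  assume "lloz i h \<in> T"
  then have "lloz i h \<subseteq> row_region h w D E" using T by (auto simp: lozenge_tiling_iff)
  then show False using assms(2) by (auto simp: loz_defs)
qed

text \<open>The left-leaning tiles are determined from left to right, as there is none at the left end.\<close>

lemma row_tiling_unique:
  assumes T: "lozenge_tiling (row_region h w D E) T" and T': "lozenge_tiling (row_region h w D E) T'"
  shows "T = T'"
proof -
  have l: "lloz i h \<in> T \<longleftrightarrow> lloz i h \<in> T'" for i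
  proof (cases "i \<le> 0")
    case False
    then have "of_bool (lloz i h \<in> T) = (of_bool (lloz i h \<in> T') :: int)"
      using row_flow[OF T, of 0 i] row_flow[OF T', of 0 i] lloz_outside[OF T, of 0] lloz_outside[OF T', of 0] by simp
    then show ?thesis by (simp add: of_bool_eq_iff)
  qed (use lloz_outside[OF T] lloz_outside[OF T'] in blast)
  have r: "rloz i h \<in> T \<longleftrightarrow> rloz i h \<in> T'" for i
  proof -
    have "of_bool (rloz i h \<in> T) = (of_bool (rloz i h \<in> T') :: int)"
      using row_balance(1)[OF T, of i] row_balance(1)[OF T', of i] l[of i] by simp
    then show ?thesis by (simp add: of_bool_eq_iff)
  qed
  show ?thesis
  proof (intro subset_antisym subsetI)
    fix L assume "L \<in> T" then show "L \<in> T'" using row_tiles[OF T \<open>L \<in> T\<close>] l r by metis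
  next
    fix L assume "L \<in> T'" then show "L \<in> T" using row_tiles[OF T' \<open>L \<in> T'\<close>] l r by metis
  qed
qed

lemma sum_of_bool_eq_card:
  "finite A \<Longrightarrow> (\<Sum>i\<in>A. of_bool (P i) :: int) = int (card {i\<in>A. P i})"
  by (simp add: of_bool_def sum.If_cases Int_def)

text \<open>Between two places without a left-leaning tile, for instance between two dents, there are as
many up-pointing as down-pointing triangles.\<close>

lemma row_balance_card:
  assumes T: "lozenge_tiling (row_region h w D E) T" and "u \<le> v" "lloz u h \<notin> T" "lloz v h \<notin> T"
  shows "card ({u..<v} \<inter> {0..<w} - D) = card ({u..<v} \<inter> {0..<w-1} - E)"
proof -
  have "(\<Sum>i\<in>{u..<v}. of_bool (Down (i, h + 1) \<in> row_region h w D E) :: int)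
      = (\<Sum>i\<in>{u..<v}. of_bool (Up (i, h) \<in> row_region h w D E))"
    using row_flow[OF T assms(2)] assms(3,4) by (simp add: sum_subtractf)
  moreover have "{i\<in>{u..<v}. Down (i, h + 1) \<in> row_region h w D E} = {u..<v} \<inter> {0..<w-1} - E"
    "{i\<in>{u..<v}. Up (i, h) \<in> row_region h w D E} = {u..<v} \<inter> {0..<w} - D" by auto
  ultimately show ?thesis by (simp add: sum_of_bool_eq_card del: row_region_iff sum_of_bool_eq)
qed

lemma row_no_dents:
  assumes "0 < w" shows "\<not> lozenge_tiling (row_region h w {} E) T"
proof
  assume T: "lozenge_tiling (row_region h w {} E) T"
  have "card ({0..<w} \<inter> {0..<w} - {}) = card ({0..<w} \<inter> {0..<w-1} - E)"
    by (rule row_balance_card[OF T]) (use assms lloz_outside[OF T] in auto)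
  also have "\<dots> \<le> card {0..<w-1}" by (rule card_mono) auto
  finally show False using assms by simp
qed

lemma between_consecutive:
  fixes d :: "nat \<Rightarrow> int"
  assumes "d 0 \<le> x" "x < d m"
  obtains k where "k < m" "d k \<le> x" "x < d (Suc k)"
proof -
  have "\<exists>k<m. d k \<le> x \<and> x < d (Suc k)" using assms(2)
  proof (induction m)
    case (Suc m)
    then show ?case by (cases "x < d m") (use less_Suc_eq in \<open>auto simp: not_less\<close>)
  qed (use assms(1) in simp)
  then show ?thesis using that by blast
qed

text \<open>Between two consecutive dents of \<open>D\<close> there is one up-pointing triangle fewer than there are
places for down-pointing ones, so exactly one down-pointing triangle has to be missing. To the left
of the first dent and to the right of the last one none is missing.\<close>

lemma row_tiling_interlaces:
  fixes d :: "nat \<Rightarrow> int"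
  assumes d: "\<And>i j. i < j \<Longrightarrow> j \<le> m \<Longrightarrow> d i < d j" and D: "D = d ` {..m}" "D \<subseteq> {0..<w}"
    and E: "E \<subseteq> {0..<w-1}" and T: "lozenge_tiling (row_region h w D E) T"
  shows "\<exists>e\<in>PiE {..<m} (\<lambda>k. {d k..<d (Suc k)}). E = e ` {..<m}"
proof -
  have dm: "d i \<le> d j" if "i \<le> j" "j \<le> m" for i j using d[of i j] that by (cases "i = j") auto
  have dr: "0 \<le> d i" "d i < w" if "i \<le> m" for i using D that by auto
  have out: "lloz i h \<notin> T" if "i \<le> 0 \<or> i \<ge> w \<or> i \<in> D" for i using lloz_outside[OF T that] .
  have finE: "finite E" using E finite_subset by blast
  have one: "\<exists>x. E \<inter> {d k..<d (Suc k)} = {x}" if k: "k < m" for k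
  proof -
    let ?J = "{d k..<d (Suc k)}"
    have b: "0 \<le> d k" "d k < d (Suc k)" "d (Suc k) < w" using dr[of k] dr[of "Suc k"] d[of k "Suc k"] k by auto
    have "?J \<inter> {0..<w} - D = {d k<..<d (Suc k)}"
    proof -
      have "x = d k" if xD: "x \<in> D" and xJ: "x \<in> ?J" for x
      proof -
        obtain i where i: "x = d i" "i \<le> m" using xD unfolding D(1) by blast
        then have "\<not> i < k" "\<not> Suc k \<le> i" using xJ dm[of "Suc k" i] d[of i k] k by auto
        then have "i = k" by simp
        then show ?thesis using i by simp
      qed
      then have "x \<notin> D" if "d k < x" "x < d (Suc k)" for x using that by fastforce
      moreover have "d k \<in> D" using D k by auto
      ultimately show ?thesis using b by (auto simp: order_less_le)
    qed
    moreover have "?J \<inter> {0..<w-1} - E = ?J - E" using b by auto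
    moreover have "card (?J \<inter> {0..<w} - D) = card (?J \<inter> {0..<w-1} - E)"
      by (rule row_balance_card[OF T]) (use b out D k in auto)
    ultimately have "card (?J - E) = card {d k<..<d (Suc k)}" by (simp only:)
    moreover have "card ?J = card (?J \<inter> E) + card (?J - E)" by (rule card_Int_Diff) simp
    ultimately have "card (E \<inter> ?J) = 1" using b by (simp add: Int_commute)
    then show ?thesis by (rule card_1_singletonE) blast
  qed
  have low: "E \<inter> {0..<d 0} = {}"
  proof -
    have b: "0 \<le> d 0" "d 0 < w" using dr[of 0] by auto
    have "{0..<d 0} \<inter> {0..<w} - D = {0..<d 0}" using b dm[of 0] D by force
    moreover have "{0..<d 0} \<inter> {0..<w-1} - E = {0..<d 0} - E" using b by auto
    moreover have "card ({0..<d 0} \<inter> {0..<w} - D) = card ({0..<d 0} \<inter> {0..<w-1} - E)"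
      by (rule row_balance_card[OF T]) (use b out D in auto)
    ultimately have "card ({0..<d 0} - E) = card {0..<d 0}" by (simp only:)
    moreover have "card {0..<d 0} = card ({0..<d 0} \<inter> E) + card ({0..<d 0} - E)" by (rule card_Int_Diff) simp
    ultimately have "card (E \<inter> {0..<d 0}) = 0" by (simp add: Int_commute)
    then show ?thesis using finE by simp
  qed
  have high: "E \<inter> {d m..<w-1} = {}"
  proof -
    have b: "0 \<le> d m" "d m < w" using dr[of m] by auto
    have "{d m..<w} \<inter> {0..<w} - D = {d m<..<w}" using b dm[of _ m] D by force
    moreover have "{d m..<w} \<inter> {0..<w-1} - E = {d m..<w-1} - E" using b by auto
    moreover have "card ({d m..<w} \<inter> {0..<w} - D) = card ({d m..<w} \<inter> {0..<w-1} - E)"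
      by (rule row_balance_card[OF T]) (use b out D in auto)
    ultimately have "card ({d m..<w-1} - E) = card {d m<..<w}" by (simp only:)
    moreover have "card {d m..<w-1} = card ({d m..<w-1} \<inter> E) + card ({d m..<w-1} - E)"
        by (rule card_Int_Diff) simp
    moreover have "card {d m..<w-1} = card {d m<..<w}" using b by simp
    ultimately have "card (E \<inter> {d m..<w-1}) = 0" by (simp add: Int_commute)
    then show ?thesis using finE by simp
  qed
  define e where "e = restrict (\<lambda>k. THE x. E \<inter> {d k..<d (Suc k)} = {x}) {..<m}"
  have e: "E \<inter> {d k..<d (Suc k)} = {e k}" if k: "k < m" for k
  proof -
    obtain x where x: "E \<inter> {d k..<d (Suc k)} = {x}" using one[OF k] by blast
    then have "e k = x" using k by (simp add: e_def)
    then show ?thesis using x by simp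
  qed
  have "e \<in> PiE {..<m} (\<lambda>k. {d k..<d (Suc k)})"
  proof (rule PiE_I)
    show "e k \<in> {d k..<d (Suc k)}" if "k \<in> {..<m}" for k using e[of k] that by blast
  qed (simp add: e_def)
  moreover have "E = e ` {..<m}"
  proof (intro subset_antisym subsetI)
    fix x assume x: "x \<in> E"
    then have "d 0 \<le> x" "x < d m" using low high E by (force simp: disjoint_iff)+
    then obtain k where "k < m" "d k \<le> x" "x < d (Suc k)" by (rule between_consecutive)
    then show "x \<in> e ` {..<m}" using e[of k] x by auto
  next
    fix x assume "x \<in> e ` {..<m}"
    then show "x \<in> E" using e by blast
  qed
  ultimately show ?thesis by blast
qed

text \<open>The triangles between a dent and the next element of \<open>E\<close> lean to the left, as do those behind
the last dent; all others lean to the right. It suffices to see that this rule is injective, as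
there are equally many triangles of both kinds.\<close>

lemma interlacing_row_tiling:
  fixes d e :: "nat \<Rightarrow> int"
  assumes d: "\<And>i j. i < j \<Longrightarrow> j \<le> m \<Longrightarrow> d i < d j" and D: "D = d ` {..m}" "D \<subseteq> {0..<w}"
    and e: "\<And>k. k < m \<Longrightarrow> d k \<le> e k \<and> e k < d (Suc k)" and E: "E = e ` {..<m}"
  shows "\<exists>T. lozenge_tiling (row_region h w D E) T"
proof -
  have dm: "d i \<le> d j" if "i \<le> j" "j \<le> m" for i j using d[of i j] that by (cases "i = j") auto
  have dr: "0 \<le> d i" "d i < w" if "i \<le> m" for i using D that by auto
  \<comment> \<open>\<open>c i\<close> says that the up-pointing triangle at \<open>i\<close> leans to the left; its partner is then at \<open>f i\<close>.\<close>
  define c where "c i \<longleftrightarrow> (\<exists>k<m. d k < i \<and> i \<le> e k) \<or> d m < i" for i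
  define f where "f i = (if c i then i - 1 else i)" for i
  let ?U = "{0..<w} - D" and ?B = "{0..<w-1} - E"
  have em: "e i < e j" if "i < j" "j < m" for i j
    using e[of i] e[of j] dm[of "Suc i" j] that by auto
  have eD: "e k < d m" "0 \<le> e k" if "k < m" for k
    using e[OF that] dm[of "Suc k" m] dr[of k] that by auto
  have fB: "f i \<in> ?B" if i: "i \<in> ?U" for i
  proof (cases "c i")
    case True
    have "i - 1 \<noteq> e k'" if k': "k' < m" for k'
    proof
      assume eq: "i - 1 = e k'"
      from True consider k where "k < m" "d k < i" "i \<le> e k" | "d m < i" unfolding c_def by blast
      then show False
      proof cases
        case (1 k)
        have "k' < k" using em[of k k'] 1 k' eq by (cases rule: linorder_cases[of k k']) auto
        then have "d (Suc k') \<le> d k" using dm[of "Suc k'" k] 1 by auto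
        then show False using e[OF k'] 1 eq by auto
      next
        case 2
        then show False using eD[OF k'] eq by auto
      qed
    qed
    moreover have "0 \<le> i - 1"
      using True dr(1) unfolding c_def by (smt (verit) less_imp_le_nat order_refl)
    ultimately show ?thesis using i True E by (auto simp: f_def)
  next
    case False
    have "i \<noteq> e k" if k: "k < m" for k
    proof
      assume "i = e k"
      moreover have "i \<noteq> d k" using i D k by auto
      ultimately have "c i" using e[OF k] k unfolding c_def by force
      then show False using False by simp
    qed
    moreover have "i < w - 1"
    proof -
      have "i \<noteq> d m" using i D by auto
      then have "i < d m" using False unfolding c_def by auto
      then show ?thesis using dr(2)[of m] by simp
    qed
    ultimately show ?thesis using i False E by (auto simp: f_def)
  qed
  have "inj_on f ?U"
  proof (rule linorder_inj_onI)
    fix i i' assume ii: "i < i'" "i \<in> ?U" "i' \<in> ?U"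
    show "f i \<noteq> f i'"
    proof
      assume eq: "f i = f i'"
      then have i': "i' = i + 1" "\<not> c i" "c i'" using ii(1) by (auto simp: f_def split: if_splits)
      have "i \<notin> D" using ii by auto
      have "c i"
      proof -
        from i'(3) consider k where "k < m" "d k < i'" "i' \<le> e k" | "d m < i'" unfolding c_def by blast
        then show ?thesis
        proof cases
          case (1 k)
          then have "d k \<noteq> i" using \<open>i \<notin> D\<close> D by auto
          then show ?thesis using 1 i'(1) unfolding c_def by (intro disjI1 exI[of _ k]) auto
        next
          case 2
          have "d m \<noteq> i" using \<open>i \<notin> D\<close> D by auto
          then show ?thesis using 2 i'(1) unfolding c_def by auto
        qed
      qed
      then show False using i'(2) by simp
    qed
  qed auto
  moreover have "f ` ?U = ?B"
  proof (rule card_subset_eq)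
    have "inj_on d {..m}" by (rule linorder_inj_onI) (use d in force)+
    then have cD: "card D = Suc m" using D by (simp add: card_image)
    have "inj_on e {..<m}" by (rule linorder_inj_onI) (use em in force)+
    then have cE: "card E = m" using E by (simp add: card_image)
    have E': "E \<subseteq> {0..<w-1}" using eD dr(2)[of m] E by force
    have "card ?U = nat w - Suc m" using cD D by (subst card_Diff_subset) (auto intro: finite_subset)
    moreover have "card ?B = nat (w - 1) - m" using cE E'
        by (subst card_Diff_subset) (auto intro: finite_subset)
    ultimately show "card (f ` ?U) = card ?B" using \<open>inj_on f ?U\<close> by (simp add: card_image nat_diff_distrib)
  qed (use fB in auto)
  ultimately have bij: "bij_betw f ?U ?B" by (simp add: bij_betw_def)
  define T where "T = (\<lambda>i. {Up (i, h), Down (f i, h + 1)}) ` ?U"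
  have "lozenge_tiling (row_region h w D E) T"
    unfolding lozenge_tiling_iff
  proof (intro conjI)
    have "\<Union>T = ups h ?U \<union> downs (h + 1) (f ` ?U)" by (auto simp: T_def ups_def downs_def)
    then show "\<Union>T = row_region h w D E" using bij by (simp add: row_region_def bij_betw_def)
    show "disjoint T"
    proof (rule disjointI)
      fix a b assume ab: "a \<in> T" "b \<in> T" "a \<noteq> b"
      then obtain i k where ik: "i \<in> ?U" "k \<in> ?U" "a = {Up (i, h), Down (f i, h + 1)}" "b
          = {Up (k, h), Down (f k, h + 1)}"
        unfolding T_def by blast
      then have "i \<noteq> k" using ab(3) by auto
      then have "f i \<noteq> f k" using bij ik by (auto simp: bij_betw_def inj_on_def)
      then show "a \<inter> b = {}" using ik \<open>i \<noteq> k\<close> by auto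
    qed
    have "{Up (i, h), Down (f i, h + 1)} = lloz i h \<or> {Up (i, h), Down (f i, h + 1)} = rloz i h" for i
      by (simp add: f_def loz_defs)
    then show "\<forall>L\<in>T. lozenge L" unfolding T_def lozenge_iff by blast
  qed
  then show ?thesis by blast
qed

lemma num_row_tilings:
  fixes d :: "nat \<Rightarrow> int"
  assumes d: "\<And>i j. i < j \<Longrightarrow> j \<le> m \<Longrightarrow> d i < d j" and D: "D = d ` {..m}" "D \<subseteq> {0..<w}"
    and E: "E \<subseteq> {0..<w-1}"
  shows "num_tilings (row_region h w D E)
     = of_bool (\<exists>e\<in>PiE {..<m} (\<lambda>k. {d k..<d (Suc k)}). E = e ` {..<m})"
proof (cases "\<exists>e\<in>PiE {..<m} (\<lambda>k. {d k..<d (Suc k)}). E = e ` {..<m}")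
  case True
  then obtain e where e: "e \<in> PiE {..<m} (\<lambda>k. {d k..<d (Suc k)})" "E = e ` {..<m}" by blast
  have "\<exists>T. lozenge_tiling (row_region h w D E) T"
    by (rule interlacing_row_tiling[OF d D _ e(2)]) (use e(1) in \<open>auto simp: PiE_def Pi_def\<close>)
  then obtain T where "lozenge_tiling (row_region h w D E) T" by blast
  then have "tilings (row_region h w D E) = {T}"
    using row_tiling_unique unfolding tilings_def by blast
  then show ?thesis using True by (simp add: num_tilings_eq)
next
  case False
  then have "tilings (row_region h w D E) = {}"
    using row_tiling_interlaces[OF d D E] unfolding tilings_def by blast
  then show ?thesis using False by (simp add: num_tilings_eq)
qed

section \<open>Tilings of a dented trapezoid\<close>

text \<open>The trapezoid with base \<open>n + e\<close> at height \<open>h\<close>, whose left end is the point \<open>(0, h)\<close>, with legs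
\<open>n\<close> and top \<open>e\<close>. The height is a parameter since removing the lowest row raises it.\<close>

definition trap :: "int \<Rightarrow> nat \<Rightarrow> nat \<Rightarrow> region" where
  "trap h n e = {t. case t of
       Up (i, j) \<Rightarrow> 0 \<le> i \<and> h \<le> j \<and> j < h + int n \<and> i + j < h + int n + int e
     | Down (i, j) \<Rightarrow> 0 \<le> i \<and> h < j \<and> j \<le> h + int n \<and> i + j < h + int n + int e}"

lemma trap_iff [simp]:
  "Up (i, j) \<in> trap h n e \<longleftrightarrow> 0 \<le> i \<and> h \<le> j \<and> j < h + int n \<and> i + j < h + int n + int e"
  "Down (i, j) \<in> trap h n e \<longleftrightarrow> 0 \<le> i \<and> h < j \<and> j \<le> h + int n \<and> i + j < h + int n + int e"
  by (simp_all add: trap_def)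

lemma region_eqI:
  assumes "\<And>i j. Up (i, j) \<in> A \<longleftrightarrow> Up (i, j) \<in> B" "\<And>i j. Down (i, j) \<in> A \<longleftrightarrow> Down (i, j) \<in> B"
  shows "A = B"
proof (rule Set.set_eqI)
  fix t show "t \<in> A \<longleftrightarrow> t \<in> B" using assms by (cases t rule: unit_triangle.exhaust) auto
qed

lemma finite_trap: "finite (trap h n e)"
proof (rule finite_subset)
  let ?P = "{0..int n + int e} \<times> {h..h + int n}"
  show "trap h n e \<subseteq> Up ` ?P \<union> Down ` ?P"
  proof
    fix t assume "t \<in> trap h n e"
    then show "t \<in> Up ` ?P \<union> Down ` ?P" by (cases t rule: unit_triangle.exhaust) auto
  qed
qed auto

lemma vandermonde_strict_mono:
  fixes d :: "nat \<Rightarrow> int"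
  assumes "\<And>i j. i < j \<Longrightarrow> j < n \<Longrightarrow> d i < d j"
  shows "vandermonde (d ` {..<n}) = seq_vandermonde (\<lambda>i. of_int (d i)) n"
proof -
  have "inj_on d {..<n}" by (rule linorder_inj_onI) (use assms in force)+
  then have "vandermonde (d ` {..<n}) = (\<Prod>j<n. \<Prod>i<j. \<bar>of_int (d j) - of_int (d i)\<bar>)"
    by (rule pair_prod_enum) simp
  also have "\<dots> = seq_vandermonde (\<lambda>i. of_int (d i)) n"
    unfolding seq_vandermonde_def by (intro prod.cong refl) (use assms in \<open>force intro: less_imp_le\<close>)
  finally show ?thesis .
qed

lemma strict_mono_enum:
  fixes D :: "int set"
  assumes "finite D" "card D = n"
  obtains d where "\<And>i j. i < j \<Longrightarrow> j < n \<Longrightarrow> d i < d j" "D = d ` {..<n}"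
proof -
  let ?l = "sorted_list_of_set D"
  have len: "length ?l = n" "set ?l = D" "sorted_wrt (<) ?l" using assms by simp_all
  have "D = (\<lambda>i. ?l ! i) ` {..<n}" using len by (metis atLeast0LessThan atLeast_upt list.set_map map_nth)
  moreover have "?l ! i < ?l ! j" if "i < j" "j < n" for i j
    using sorted_wrt_nth_less[OF len(3), of i j] that len(1) by simp
  ultimately show ?thesis using that by blast
qed

lemma num_tilings_trap_row:
  assumes D: "D \<subseteq> {0..<int (Suc n + e)}"
  defines "I \<equiv> (if n = 0 then {} else {0..<int (n + e)})"
  shows "num_tilings (trap h (Suc n) e - ups h D)
    = (\<Sum>E\<in>Pow I. num_tilings (trap (h + 1) n e - ups (h + 1) E) * num_tilings (row_region h (int (Suc n
        + e)) D E))"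
proof -
  let ?A = "trap (h + 1) n e" and ?B = "row_region h (int (Suc n + e)) D {}"
  have "above (h + 1) t" if "t \<in> ?A" for t using that by (cases t rule: unit_triangle.exhaust) auto
  moreover have "\<not> above (h + 1) t" if "t \<in> ?B" for t using that by (cases t rule: unit_triangle.exhaust) auto
  ultimately interpret horizontal_cut "h + 1" ?A ?B by unfold_locales
  have "finite ?B" by (simp add: row_region_def ups_def downs_def)
  moreover have "trap h (Suc n) e - ups h D = ?A \<union> ?B"
    by (rule region_eqI) (use D in auto)
  moreover have "crossings = I" unfolding crossings_def by (auto simp: I_def)
  moreover have "?B - downs (h + 1) E = row_region h (int (Suc n + e)) D E" for E
    by (rule region_eqI) auto
  ultimately show ?thesis using num_tilings_cut[OF finite_trap] by simp
qed

lemma inj_on_image_interlacing: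
  fixes d :: "nat \<Rightarrow> int"
  assumes d: "\<And>i j. i < j \<Longrightarrow> j \<le> m \<Longrightarrow> d i < d j"
  shows "inj_on (\<lambda>e. e ` {..<m}) (PiE {..<m} (\<lambda>k. {d k..<d (Suc k)}))"
proof (rule inj_onI)
  fix e e' assume e: "e \<in> PiE {..<m} (\<lambda>k. {d k..<d (Suc k)})" "e' \<in> PiE {..<m} (\<lambda>k. {d k..<d (Suc k)})"
    and eq: "e ` {..<m} = e' ` {..<m}"
  have dm: "d i \<le> d j" if "i \<le> j" "j \<le> m" for i j using d[of i j] that by (cases "i = j") auto
  have "e k = e' k" if k: "k < m" for k
  proof -
    obtain l where l: "l < m" "e k = e' l" using eq k by blast
    have "d k \<le> e k" "e k < d (Suc k)" "d l \<le> e' l" "e' l < d (Suc l)"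
      using e k l by (auto simp: PiE_def Pi_def)
    then have "k = l" using dm[of "Suc k" l] dm[of "Suc l" k] l k
      by (cases rule: linorder_cases[of k l]) auto
    then show ?thesis using l by simp
  qed
  then show "e = e'" using e by (auto intro: PiE_ext)
qed

lemma sum_of_bool_restrict:
  fixes G :: "'a \<Rightarrow> real"
  shows "finite A \<Longrightarrow> (\<Sum>x\<in>A. G x * of_bool (x \<in> B)) = (\<Sum>x\<in>A \<inter> B. G x)"
  by (simp add: sum.inter_restrict of_bool_def if_distrib cong: if_cong)

text \<open>The theorem of Cohn, Larsen and Propp. The dents of the next row are the crossings of the line
above the lowest row, and they interlace with \<open>D\<close>. The statement includes that there is no tiling
unless there are \<open>n\<close> dents, and \<open>n = 0\<close> needs a separate condition because the empty trapezoid has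
no triangles to remove.\<close>

lemma num_tilings_trap:
  assumes "D \<subseteq> {0..<int (n + e)}" "n = 0 \<longrightarrow> D = {}"
  shows "real (num_tilings (trap h n e - ups h D)) = (if card D = n then vandermonde D / superfact n else 0)"
  using assms
proof (induction n arbitrary: h D)
  case 0
  have "trap h 0 e = {}" by (rule region_eqI) auto
  moreover have "tilings {} = {{}}"
    by (auto simp: tilings_def lozenge_tiling_iff disjoint_def dest: lozenge_nonempty)
  ultimately show ?case using 0 by (simp add: num_tilings_eq superfact_def)
next
  case (Suc n)
  let ?w = "int (Suc n + e)"
  define I where "I = (if n = 0 then {} else {0..<int (n + e)})"
  have fin: "finite D" using Suc.prems finite_subset by blast
  have IH: "real (num_tilings (trap (h + 1) n e - ups (h + 1) E)) = (if card E = n then vandermonde E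
      / superfact n else 0)"
    if "E \<in> Pow I" for E
    using that by (intro Suc.IH) (auto simp: I_def split: if_splits)
  have N: "num_tilings (trap h (Suc n) e - ups h D)
    = (\<Sum>E\<in>Pow I. num_tilings (trap (h + 1) n e - ups (h + 1) E) * num_tilings (row_region h ?w D E))"
    unfolding I_def by (rule num_tilings_trap_row[OF Suc.prems(1)])
  show ?case
  proof (cases "card D")
    case 0
    then have "D = {}" using fin by simp
    then have "num_tilings (row_region h ?w D E) = 0" for E
      using row_no_dents[of ?w h E] by (simp add: num_tilings_eq tilings_def)
    then show ?thesis using N 0 by simp
  next
    case (Suc m)
    obtain d where d: "\<And>i j. i < j \<Longrightarrow> j < Suc m \<Longrightarrow> d i < d j" "D = d ` {..<Suc m}"
      using strict_mono_enum[OF fin Suc] by blast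
    have d': "\<And>i j. i < j \<Longrightarrow> j \<le> m \<Longrightarrow> d i < d j" "D = d ` {..m}"
      using d by (auto simp: lessThan_Suc_atMost)
    let ?P = "PiE {..<m} (\<lambda>k. {d k..<d (Suc k)})"
    let ?g = "\<lambda>e. e ` {..<m}"
    let ?G = "\<lambda>E. if card E = n then vandermonde E / superfact n else 0"
    have row: "num_tilings (row_region h ?w D E) = of_bool (E \<in> ?g ` ?P)" if "E \<in> Pow I" for E
    proof -
      have "E \<subseteq> {0..<?w - 1}" using that by (auto simp: I_def split: if_splits)
      then show ?thesis
        using num_row_tilings[OF d'(1,2) Suc.prems(1), of E h] by (simp add: image_iff Bex_def)
    qed
    have finI: "finite I" by (simp add: I_def)
    have "real (num_tilings (trap h (Suc n) e - ups h D)) = (\<Sum>E\<in>Pow I. ?G E * of_bool (E \<in> ?g ` ?P))"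
      unfolding N of_nat_sum of_nat_mult by (rule sum.cong[OF refl]) (simp only: IH row of_nat_of_bool)
    also have "\<dots> = (\<Sum>E\<in>Pow I \<inter> ?g ` ?P. ?G E)"
      by (rule sum_of_bool_restrict) (simp add: finI)
    also have "\<dots> = (if m = n then vandermonde D / superfact (Suc n) else 0)"
    proof (cases "m = n")
      case True
      have sub: "?g ` ?P \<subseteq> Pow I"
      proof (rule image_subsetI)
        fix r assume r: "r \<in> ?P"
        have "0 \<le> r k \<and> r k < int (n + e)" if "k < m" for k
        proof -
          have "d k \<le> r k" "r k < d (Suc k)" using r that by (auto simp: PiE_def Pi_def)
          moreover have "d k \<in> D" "d (Suc k) \<in> D" using d'(2) that by auto
          ultimately show ?thesis using Suc.prems(1) by auto
        qed
        then show "r ` {..<m} \<in> Pow I" using True by (auto simp: I_def)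
      qed
      have "(\<Sum>E\<in>Pow I \<inter> ?g ` ?P. ?G E) = (\<Sum>E\<in>?g ` ?P. ?G E)"
        using sub by (simp add: Int_absorb1)
      also have "\<dots> = (\<Sum>e\<in>?P. ?G (?g e))"
        using inj_on_image_interlacing[of m d] d'(1) by (subst sum.reindex) auto
      also have "\<dots> = (\<Sum>e\<in>?P. seq_vandermonde (\<lambda>i. of_int (e i)) n / superfact n)"
      proof (rule sum.cong[OF refl])
        fix e assume e: "e \<in> ?P"
        have em: "e i < e j" if "i < j" "j < m" for i j
        proof -
          have "e i < d (Suc i)" "d j \<le> e j" using e that by (auto simp: PiE_def Pi_def)
          moreover have "d (Suc i) \<le> d j" using d'(1)[of "Suc i" j] that by (cases "Suc i = j") auto
          ultimately show ?thesis by simp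
        qed
        then have "inj_on e {..<m}" by (intro linorder_inj_onI) force+
        then have "card (?g e) = n" using True by (simp add: card_image)
        then show "?G (?g e) = seq_vandermonde (\<lambda>i. of_int (e i)) n / superfact n"
          using vandermonde_strict_mono[of m e] em True by simp
      qed
      also have "\<dots> = seq_vandermonde (\<lambda>i. of_int (d i)) (Suc n) / fact n / superfact n"
        unfolding sum_divide_distrib[symmetric] True
        by (subst sum_seq_vandermonde_interlacing) (use d'(1) True in \<open>auto intro: less_imp_le\<close>)
      also have "\<dots> = vandermonde D / superfact (Suc n)"
        using vandermonde_strict_mono[of "Suc m" d] d True by (simp add: superfact_def)
      finally show ?thesis using True by simp
    next
      case False
      have "?G E = 0" if "E \<in> Pow I \<inter> ?g ` ?P" for E
      proof -
        obtain e where e: "e \<in> ?P" "E = ?g e" using \<open>E \<in> Pow I \<inter> ?g ` ?P\<close> by blast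
        have em: "e i < e j" if "i < j" "j < m" for i j
        proof -
          have "e i < d (Suc i)" "d j \<le> e j" using e that by (auto simp: PiE_def Pi_def)
          moreover have "d (Suc i) \<le> d j" using d'(1)[of "Suc i" j] that by (cases "Suc i = j") auto
          ultimately show ?thesis by simp
        qed
        then have "inj_on e {..<m}" by (intro linorder_inj_onI) force+
        then have "card E = m" using e(2) by (simp add: card_image)
        then show ?thesis using False by simp
      qed
      then show ?thesis using False by simp
    qed
    finally show ?thesis using Suc by simp
  qed
qed

section \<open>Triangular holes standing on the base\<close>

text \<open>A down-pointing triangle of a hole has its two up-pointing neighbours in the row below inside
the hole. These are removed or, by induction on the height, covered from below, so only the lozenge
across its upper side is left. The hypotheses are the closure properties of a union of up-pointing
triangles that stand on the line at height \<open>h\<close>.\<close>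

lemma num_tilings_holes_forced:
  assumes HR: "H \<subseteq> R"
    and up: "\<And>i j. Up (i, j) \<in> H \<Longrightarrow> h \<le> j"
    and down: "\<And>i j. Down (i, j) \<in> H \<Longrightarrow> h < j \<and> Up (i, j) \<in> H \<and> Up (i, j - 1) \<in> H \<and> Up (i + 1, j - 1) \<in> H"
    and up_down: "\<And>i j. Up (i, j) \<in> H \<Longrightarrow> h < j \<Longrightarrow> Down (i, j) \<in> H"
  shows "num_tilings (R - ups h {i. Up (i, h) \<in> H}) = num_tilings (R - H)"
proof -
  let ?U = "{i. Up (i, h) \<in> H}"
  let ?V = "{vloz i j | i j. Up (i, j) \<in> H \<and> h < j}"
  have V: "lozenge_tiling (H - ups h ?U) ?V"
    unfolding lozenge_tiling_iff
  proof (intro conjI)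
    show "\<Union>?V = H - ups h ?U"
    proof (intro subset_antisym subsetI)
      fix t assume "t \<in> \<Union>?V"
      then obtain i j where ij: "t \<in> vloz i j" "Up (i, j) \<in> H" "h < j" by blast
      then show "t \<in> H - ups h ?U" using up_down[OF ij(2,3)] by (auto simp: vloz_def)
    next
      fix t assume t: "t \<in> H - ups h ?U"
      show "t \<in> \<Union>?V"
      proof (cases t rule: unit_triangle.exhaust)
        case (Up p)
        obtain i j where p: "p = (i, j)" by fastforce
        then have "Up (i, j) \<in> H" "h < j" using t Up up[of i j] by (cases "j = h"; auto)+
        then show ?thesis using Up p by (auto simp: vloz_def)
      next
        case (Down p)
        obtain i j where p: "p = (i, j)" by fastforce
        then have "Up (i, j) \<in> H" "h < j" using t Down down[of i j] by auto
        then show ?thesis using Down p by (auto simp: vloz_def)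
      qed
    qed
    show "disjoint ?V" by (rule disjointI) (auto simp: vloz_def)
    show "\<forall>L\<in>?V. lozenge L" unfolding lozenge_iff by blast
  qed
  have forced: "?V \<subseteq> T" if T: "lozenge_tiling (R - ups h ?U) T" for T
  proof -
    have cover: "\<exists>L\<in>T. t \<in> L" if "t \<in> R - ups h ?U" for t
      using T that unfolding lozenge_tiling_iff by blast
    \<comment> \<open>Here \<open>k\<close> is the height above the base.\<close>
    have key: "vloz i j \<in> T" if "Down (i, j) \<in> H" "j = h + int k" for i j k
      using that
    proof (induction k arbitrary: i j rule: less_induct)
      case (less k)
      note dn = down[OF less.prems(1)]
      have taken: "\<exists>L\<in>T. Up (i', j - 1) \<in> L \<and> Down (i, j) \<notin> L" if "Up (i', j - 1) \<in> H" "h \<noteq> j - 1" for i'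
      proof -
        have "h < j - 1" using up[OF that(1)] that(2) by simp
        then have "Down (i', j - 1) \<in> H" "j - 1 = h + int (k - 1)" "k - 1 < k"
          using up_down[OF that(1)] less.prems(2) by auto
        then have "vloz i' (j - 1) \<in> T" using less.IH by blast
        then show ?thesis by (intro bexI[of _ "vloz i' (j - 1)"]) (auto simp: loz_mem)
      qed
      have not_up: "Up (i', j - 1) \<notin> L" if uH: "Up (i', j - 1) \<in> H" and LT: "L \<in> T"
          and dL: "Down (i, j) \<in> L" for i' L
      proof
        assume m: "Up (i', j - 1) \<in> L"
        show False
        proof (cases "h = j - 1")
          case True
          then have "Up (i', j - 1) \<in> ups h ?U" using uH by simp
          then show False using tiling_tile(2)[OF T LT] m by blast
        next
          case False
          then obtain L' where "L' \<in> T" "Up (i', j - 1) \<in> L'" "Down (i, j) \<notin> L'" using taken[OF uH] by blast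
          then show False using tile_unique[OF T LT _ m] dL by blast
        qed
      qed
      have "Down (i, j) \<in> R - ups h ?U" using less.prems(1) HR by auto
      then obtain L where L: "L \<in> T" "Down (i, j) \<in> L" using cover by blast
      then obtain k l where kl: "L = vloz k l \<or> L = rloz k l \<or> L = lloz k l"
        using tiling_tile(1)[OF T] unfolding lozenge_iff by blast
      have "Up (i, j - 1) \<notin> L" "Up (i + 1, j - 1) \<notin> L" using not_up[OF _ L] dn by blast+
      then have "L = vloz i j" using kl L(2) by (auto simp: loz_mem)
      then show ?case using L(1) by simp
    qed
    show "?V \<subseteq> T"
    proof
      fix L assume "L \<in> ?V"
      then obtain i j where ij: "L = vloz i j" "Up (i, j) \<in> H" "h < j" by blast
      have "vloz i j \<in> T" by (rule key[of i j "nat (j - h)"]) (use up_down ij in auto)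
      then show "L \<in> T" using ij(1) by simp
    qed
  qed
  have "ups h ?U \<subseteq> H" by (auto simp: ups_def)
  then have "R - ups h ?U - (H - ups h ?U) = R - H" by blast
  moreover have "H - ups h ?U \<subseteq> R - ups h ?U" using HR by blast
  ultimately show ?thesis using num_tilings_forced[OF V _ forced] by simp
qed

text \<open>A set of pairs \<open>(p, b)\<close> stands for the triangles of side-length \<open>b\<close> on the segments from \<open>p\<close>
to \<open>p + b\<close>; this is the set of unit segments below them.\<close>

definition cover :: "(int \<times> nat) set \<Rightarrow> int set" where
  "cover C = (\<Union>(p, b)\<in>C. {p..<p + int b})"

definition up_triangles :: "int \<Rightarrow> (int \<times> nat) set \<Rightarrow> region" where
  "up_triangles h C = (\<Union>(p, b)\<in>C. up_triangle (p, h) b)"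

lemma up_triangle_iff:
  "Up (i, j) \<in> up_triangle (p, h) b \<longleftrightarrow> p \<le> i \<and> h \<le> j \<and> i + j < p + h + int b"
  "Down (i, j) \<in> up_triangle (p, h) b \<longleftrightarrow> p \<le> i \<and> h < j \<and> i + j < p + h + int b"
  by (auto simp: up_triangle_def region_of_def)

lemma down_triangle_iff:
  "Up (i, j) \<in> down_triangle (p, h) b \<longleftrightarrow> i < p + int b \<and> j < h \<and> p + h \<le> i + j"
  "Down (i, j) \<in> down_triangle (p, h) b \<longleftrightarrow> i < p + int b \<and> j \<le> h \<and> p + h \<le> i + j"
  by (auto simp: down_triangle_def region_of_def)

lemma up_triangles_iff:
  "Up (i, j) \<in> up_triangles h C \<longleftrightarrow> (\<exists>p b. (p, b) \<in> C \<and> p \<le> i \<and> h \<le> j \<and> i + j < p + h + int b)"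
  "Down (i, j) \<in> up_triangles h C \<longleftrightarrow> (\<exists>p b. (p, b) \<in> C \<and> p \<le> i \<and> h < j \<and> i + j < p + h + int b)"
proof -
  have "t \<in> up_triangles h C \<longleftrightarrow> (\<exists>p b. (p, b) \<in> C \<and> t \<in> up_triangle (p, h) b)" for t
    unfolding up_triangles_def by blast
  then show "Up (i, j) \<in> up_triangles h C \<longleftrightarrow> (\<exists>p b. (p, b) \<in> C \<and> p \<le> i \<and> h \<le> j \<and> i + j < p + h + int b)"
    "Down (i, j) \<in> up_triangles h C \<longleftrightarrow> (\<exists>p b. (p, b) \<in> C \<and> p \<le> i \<and> h < j \<and> i + j < p + h + int b)"
    by (simp_all add: up_triangle_iff)
qed

lemma cover_iff: "i \<in> cover C \<longleftrightarrow> (\<exists>p b. (p, b) \<in> C \<and> p \<le> i \<and> i < p + int b)"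
  unfolding cover_def by fastforce

text \<open>A hole of side-length \<open>b\<close> has the same effect as \<open>b\<close> adjacent unit dents at its base.\<close>

lemma num_tilings_trap_holes:
  assumes C: "\<And>p b. (p, b) \<in> C \<Longrightarrow> 0 \<le> p \<and> p + int b \<le> int (n + e) \<and> b \<le> n"
    and S: "S \<subseteq> {0..<int (n + e)}" "S \<inter> cover C = {}" "n = 0 \<longrightarrow> S = {}"
  shows "real (num_tilings (trap h n e - up_triangles h C - ups h S))
    = (if card (cover C \<union> S) = n then vandermonde (cover C \<union> S) / superfact n else 0)"
proof -
  let ?H = "up_triangles h C"
  have base: "{i. Up (i, h) \<in> ?H} = cover C"
    by (rule Set.set_eqI) (simp add: up_triangles_iff cover_iff)
  have "num_tilings (trap h n e - ups h S - ups h {i. Up (i, h) \<in> ?H})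
      = num_tilings (trap h n e - ups h S - ?H)"
  proof (rule num_tilings_holes_forced)
    show "?H \<subseteq> trap h n e - ups h S"
    proof
      fix t assume t: "t \<in> ?H"
      show "t \<in> trap h n e - ups h S"
      proof (cases t rule: unit_triangle.exhaust)
        case (Up q)
        obtain i j where q: "q = (i, j)" by fastforce
        from t obtain p b where pb: "(p, b) \<in> C" "p \<le> i" "h \<le> j" "i + j < p + h + int b"
          unfolding Up q up_triangles_iff by blast
        have "i \<notin> S" if "j = h"
        proof -
          have "i \<in> cover C" using pb that unfolding cover_iff by force
          then show ?thesis using S(2) by blast
        qed
        then show ?thesis using C[OF pb(1)] pb(2-) unfolding Up q by auto
      next
        case (Down q)
        obtain i j where q: "q = (i, j)" by fastforce
        from t obtain p b where pb: "(p, b) \<in> C" "p \<le> i" "h < j" "i + j < p + h + int b"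
          unfolding Down q up_triangles_iff by blast
        then show ?thesis using C[OF pb(1)] unfolding Down q by auto
      qed
    qed
  qed (unfold up_triangles_iff, fastforce+)
  moreover have "trap h n e - ups h S - ups h (cover C) = trap h n e - ups h (cover C \<union> S)"
    by (auto simp: ups_def)
  moreover have "trap h n e - ups h S - ?H = trap h n e - ?H - ups h S" by blast
  ultimately have "num_tilings (trap h n e - ?H - ups h S) = num_tilings (trap h n e - ups h (cover C \<union> S))"
    unfolding base by simp
  moreover have "cover C \<subseteq> {0..<int (n + e)}"
    unfolding cover_def using C by fastforce
  moreover have "n = 0 \<longrightarrow> cover C = {}"
    unfolding cover_def using C by fastforce
  ultimately show ?thesis using num_tilings_trap[of "cover C \<union> S" n e h] S by simp
qed

text \<open>Starting points and lengths of every other segment in a chain of segments that starts at \<open>p\<close>.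
The flag says whether the first segment is taken; for a fern, \<open>True\<close> selects the up-pointing
triangles and \<open>False\<close> the down-pointing ones.\<close>

fun fern_segs :: "bool \<Rightarrow> int \<Rightarrow> nat list \<Rightarrow> (int \<times> nat) set" where
  "fern_segs f p [] = {}"
| "fern_segs f p (b # bs) = (if f then {(p, b)} else {}) \<union> fern_segs (\<not> f) (p + int b) bs"

lemma fern_segs_append:
  "fern_segs f p (xs @ ys) = fern_segs f p xs \<union> fern_segs (f = even (length xs)) (p + int (sum_list xs)) ys"
  by (induction xs arbitrary: f p) (auto simp: add.assoc)

text \<open>Reversing the list is reflecting the segments. The parity of the length decides whether the
flag has to be changed.\<close>

lemma fern_segs_rev:
  "fern_segs f p (rev ns) = (\<lambda>(q, b). (p + p' + int (sum_list ns) - q - int b, b)) ` fern_segs (f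
      = odd (length ns)) p' ns"
proof (induction ns arbitrary: f p p')
  case (Cons b bs)
  have "fern_segs f p (rev (b # bs)) = fern_segs f p (rev bs) \<union> fern_segs (f = even (length bs)) (p
      + int (sum_list bs)) [b]"
    by (simp add: fern_segs_append)
  also have "fern_segs f p (rev bs) = (\<lambda>(q, b'). (p + (p' + int b)
      + int (sum_list bs) - q - int b', b')) ` fern_segs (f = odd (length bs)) (p' + int b) bs"
    by (rule Cons.IH)
  finally show ?case by (auto simp: image_Un add_ac)
qed simp

lemma fern_segs_bounds: "(q, b) \<in> fern_segs f p ns \<Longrightarrow> p \<le> q \<and> q + int b \<le> p + int (sum_list ns)"
proof (induction ns arbitrary: f p)
  case (Cons b' bs)
  from Cons.prems consider "q = p" "b = b'" | "(q, b) \<in> fern_segs (\<not> f) (p + int b') bs" by (auto split: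
      if_splits)
  then show ?case using Cons.IH[of "\<not> f" "p + int b'"] by cases auto
qed simp

lemma fern_segs_nth: "fern_segs f p ns = {(p + int (sum_list (take l ns)), ns ! l) | l. l < length ns
    \<and> even l = f}"
proof (induction ns arbitrary: f p)
  case (Cons b bs)
  show ?case
  proof (intro subset_antisym subsetI)
    fix x assume "x \<in> fern_segs f p (b # bs)"
    then consider "f" "x = (p, b)" | "x \<in> fern_segs (\<not> f) (p + int b) bs" by (auto split: if_splits)
    then show "x \<in> {(p + int (sum_list (take l (b # bs))), (b # bs) ! l) | l. l < length (b # bs) \<and> even l = f}"
    proof cases
      case 1
      then show ?thesis by (intro CollectI exI[of _ 0]) auto
    next
      case 2
      then obtain l where "x = (p + int b + int (sum_list (take l bs)), bs ! l)" "l < length bs" "even l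
          = (\<not> f)"
        unfolding Cons.IH by blast
      then show ?thesis by (intro CollectI exI[of _ "Suc l"]) auto
    qed
  next
    fix x assume "x \<in> {(p + int (sum_list (take l (b # bs))), (b # bs) ! l) | l. l < length (b # bs)
        \<and> even l = f}"
    then obtain l where l: "x = (p
        + int (sum_list (take l (b # bs))), (b # bs) ! l)" "l < length (b # bs)" "even l = f" by blast
    show "x \<in> fern_segs f p (b # bs)"
    proof (cases l)
      case 0
      then show ?thesis using l by auto
    next
      case (Suc k)
      then have "x \<in> fern_segs (\<not> f) (p + int b) bs"
        unfolding Cons.IH using l by (intro CollectI exI[of _ k]) auto
      then show ?thesis by simp
    qed
  qed
qed simp

lemma cover_Un: "cover (C \<union> C') = cover C \<union> cover C'"
  by (auto simp: cover_def)

lemma cover_fern_segs_subset: "cover (fern_segs f p ns) \<subseteq> {p..<p + int (sum_list ns)}"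
  unfolding cover_def using fern_segs_bounds by fastforce

lemma cover_fern_segs_Cons:
  "cover (fern_segs f p (b # bs)) = (if f then {p..<p + int b} else {}) \<union> cover (fern_segs (\<not> f) (p
      + int b) bs)"
  by (auto simp: cover_def)

lemma cover_fern_segs_partition:
  "cover (fern_segs True p ns) \<union> cover (fern_segs False p ns) = {p..<p + int (sum_list ns)} \<and>
   cover (fern_segs True p ns) \<inter> cover (fern_segs False p ns) = {}"
proof (induction ns arbitrary: p)
  case (Cons b bs)
  have "{p..<p + int b} \<inter> cover (fern_segs True (p + int b) bs) = {}"
    using cover_fern_segs_subset[of True "p + int b" bs] by force
  moreover have "{p..<p + int b} \<union> {p + int b..<p + int b + int (sum_list bs)} = {p..<p
      + int (sum_list (b # bs))}"
    by auto
  ultimately show ?case unfolding cover_fern_segs_Cons if_True if_False not_True_eq_False not_False_eq_True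
    using Cons.IH[of "p + int b"] by blast
qed (simp add: cover_def)

lemma card_cover_fern_segs: "card (cover (fern_segs f p ns)) = (\<Sum>l | l < length ns \<and> even l = f. ns ! l)"
proof (induction ns arbitrary: f p)
  case (Cons b bs)
  have cs: "cover (fern_segs f p (b # bs)) = (if f then {p..<p + int b} else {}) \<union> cover (fern_segs (\<not> f) (p
      + int b) bs)"
    by (rule cover_fern_segs_Cons)
  have sub: "cover (fern_segs (\<not> f) (p + int b) bs) \<subseteq> {p + int b..<p + int b + int (sum_list bs)}"
      by (rule cover_fern_segs_subset)
  have "card (cover (fern_segs f p (b # bs))) = (if f then b else 0) + card (cover (fern_segs (\<not> f) (p
      + int b) bs))"
    unfolding cs by (subst card_Un_disjoint) (use sub finite_subset[OF sub] in auto)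
  also have "\<dots> = (if f then b else 0) + (\<Sum>l | l < length bs \<and> even l = (\<not> f). bs ! l)"
    by (simp only: Cons.IH)
  also have "\<dots> = (\<Sum>l | l < length (b # bs) \<and> even l = f. (b # bs) ! l)"
  proof -
    have "{l. l < length (b # bs) \<and> even l = f} = (if f then {0} else {}) \<union> Suc ` {l. l < length bs \<and> even l
        = (\<not> f)}"
    proof (rule Set.set_eqI)
      fix l show "l \<in> {l. l < length (b # bs) \<and> even l = f} \<longleftrightarrow> l \<in> (if f then {0} else {})
          \<union> Suc ` {l. l < length bs \<and> even l = (\<not> f)}"
        by (cases l) auto
    qed
    then show ?thesis by (simp add: sum.union_disjoint sum.reindex)
  qed
  finally show ?case .
qed (simp add: cover_def)

section \<open>Centrally symmetric tilings of a region with triangular holes\<close>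

lemma prod_reflection_invariant:
  fixes z :: int
  assumes "finite S" "(\<lambda>i. z - i) ` S = S"
  shows "(\<Prod>t\<in>S. \<bar>of_int t - of_int (z - u)\<bar>) = (\<Prod>t\<in>S. \<bar>of_int t - of_int u\<bar> :: real)"
proof -
  have "(\<Prod>t\<in>(\<lambda>i. z - i) ` S. \<bar>of_int t - of_int (z - u)\<bar>) = (\<Prod>t\<in>S. \<bar>of_int t - of_int u\<bar> :: real)"
    by (subst prod.reindex) (auto simp: inj_on_def abs_minus_commute)
  then show ?thesis using assms(2) by simp
qed

text \<open>The observation on which the theorem rests: for symmetric \<open>S\<close> the product of distances to \<open>S\<close>
is the same for a position and for its mirror image.\<close>

lemma vandermonde_union_symmetric:
  fixes z :: int
  assumes fin: "finite Q" "finite Q'" "finite S"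
    and S: "(\<lambda>i. z - i) ` S = S"
    and dj: "Q \<inter> Q' = {}" "Q \<inter> (\<lambda>i. z - i) ` Q' = {}" "(Q \<union> (\<lambda>i. z - i) ` Q') \<inter> S = {}"
  shows "vandermonde (Q \<union> (\<lambda>i. z - i) ` Q' \<union> S)
    = vandermonde (Q \<union> (\<lambda>i. z - i) ` Q') * (vandermonde S * (\<Prod>p\<in>Q \<union> Q'. \<Prod>t\<in>S. \<bar>of_int t - of_int p\<bar>))"
proof -
  let ?\<phi> = "\<lambda>u. \<Prod>t\<in>S. \<bar>of_int t - of_int u\<bar> :: real"
  let ?R = "(\<lambda>i. z - i) ` Q'"
  have inj: "inj_on (\<lambda>i. z - i) Q'" by (auto simp: inj_on_def)
  have "vandermonde (Q \<union> ?R \<union> S) = vandermonde (Q \<union> ?R) * vandermonde S * (\<Prod>u\<in>Q \<union> ?R. ?\<phi> u)"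
    by (rule pair_prod_union[OF _ _ dj(3) vandermonde_sym]) (use fin in auto)
  also have "(\<Prod>u\<in>Q \<union> ?R. ?\<phi> u) = (\<Prod>u\<in>Q. ?\<phi> u) * (\<Prod>u\<in>?R. ?\<phi> u)"
    by (rule prod.union_disjoint[OF _ _ dj(2)]) (use fin in auto)
  also have "(\<Prod>u\<in>?R. ?\<phi> u) = (\<Prod>u\<in>Q'. ?\<phi> u)"
    unfolding prod.reindex[OF inj] comp_def prod_reflection_invariant[OF fin(3) S] ..
  also have "(\<Prod>u\<in>Q. ?\<phi> u) * (\<Prod>u\<in>Q'. ?\<phi> u) = (\<Prod>u\<in>Q \<union> Q'. ?\<phi> u)"
    by (rule prod.union_disjoint[OF _ _ dj(1), symmetric]) (use fin in auto)
  finally show ?thesis by (simp only: mult.assoc)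
qed

text \<open>The case \<open>n = 0\<close> is included: no lozenge can cross the axis then, and only the empty set has
the required cardinality.\<close>

lemma Mc_trap_holes:
  fixes M :: int and h :: int and n e :: nat
  assumes C: "\<And>p b. (p, b) \<in> C \<Longrightarrow> 0 \<le> p \<and> p + int b \<le> int (n + e) \<and> b \<le> n"
  defines "A \<equiv> trap h n e - up_triangles h C"
    and "I \<equiv> {i \<in> {0..<int (n + e)} - cover C. 2 * M - i \<in> {0..<int (n + e)} - cover C}"
  shows "real (Mc (2 * M + 1, 2 * h) (A \<union> rot (2 * M + 1, 2 * h) ` A)) * superfact n
    = (\<Sum>S | S \<subseteq> I \<and> (\<lambda>i. 2 * M - i) ` S = S \<and> card (cover C) + card S = n. vandermonde (cover C \<union> S))"
proof -
  have finA: "finite A" unfolding A_def by (rule finite_Diff[OF finite_trap])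
  have above: "above h t" if "t \<in> A" for t
    using that unfolding A_def by (cases t rule: unit_triangle.exhaust) auto
  \<comment> \<open>For \<open>n = 0\<close> the trapezoid is empty, and the axis cannot be crossed although \<open>I\<close> need not be empty.\<close>
  define J where "J = (if n = 0 then {} else I)"
  have finI: "finite I" by (rule finite_subset[of _ "{0..<int (n + e)}"]) (auto simp: I_def)
  have J: "{i. Up (i, h) \<in> A \<and> Up (2 * M + 1 - 1 - i, h) \<in> A} = J"
    unfolding A_def J_def I_def by (auto simp: up_triangles_iff cover_iff)
  have cov: "cover C \<subseteq> {0..<int (n + e)}" unfolding cover_def using C by fastforce
  then have fcov: "finite (cover C)" using finite_subset by blast
  have N: "real (num_tilings (A - ups h S)) = (if card (cover C) + card S = n then vandermonde (cover C \<union> S)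
      / superfact n else 0)"
    if S: "S \<subseteq> J" for S
  proof -
    have SI: "S \<subseteq> I" and n0: "n = 0 \<longrightarrow> S = {}" using S by (auto simp: J_def split: if_splits)
    have "S \<subseteq> {0..<int (n + e)}" "S \<inter> cover C = {}" using SI unfolding I_def by auto
    moreover have "card (cover C \<union> S) = card (cover C) + card S"
      by (rule card_Un_disjoint) (use calculation fcov finite_subset[OF SI finI] in auto)
    ultimately show ?thesis
      unfolding A_def using num_tilings_trap_holes[of C n e S h, OF C _ _ n0] by simp
  qed
  have "real (Mc (2 * M + 1, 2 * h) (A \<union> rot (2 * M + 1, 2 * h) ` A))
    = (\<Sum>S | S \<subseteq> J \<and> (\<lambda>i. 2 * M - i) ` S = S. real (num_tilings (A - ups h S)))"
    using Mc_cut[OF finA above, of "2 * M + 1"] unfolding J by simp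
  also have "\<dots> = (\<Sum>S | S \<subseteq> J \<and> (\<lambda>i. 2 * M - i) ` S = S. if card (cover C) + card S
      = n then vandermonde (cover C \<union> S) / superfact n else 0)"
    by (rule sum.cong[OF refl]) (use N in auto)
  also have "\<dots> = (\<Sum>S\<in>{S \<in> {S. S \<subseteq> J \<and> (\<lambda>i. 2 * M - i) ` S = S}. card (cover C) + card S
      = n}. vandermonde (cover C \<union> S) / superfact n)"
    by (rule sum.inter_filter[symmetric], rule finite_subset[of _ "Pow I"])
        (use finI in \<open>auto simp: J_def split: if_splits\<close>)
  also have "{S \<in> {S. S \<subseteq> J \<and> (\<lambda>i. 2 * M - i) ` S = S}. card (cover C) + card S = n}
    = {S. S \<subseteq> I \<and> (\<lambda>i. 2 * M - i) ` S = S \<and> card (cover C) + card S = n}"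
  proof (cases "n = 0")
    case True
    have "S = {}" if "S \<subseteq> I" "card S = 0" for S using that finite_subset[OF that(1) finI] by simp
    then show ?thesis using True by (auto simp: J_def)
  qed (auto simp: J_def)
  finally show ?thesis unfolding sum_divide_distrib[symmetric] by simp
qed

definition fern_triangles :: "nat \<Rightarrow> nat list \<Rightarrow> nat list \<Rightarrow> bool \<Rightarrow> (int \<times> nat) set" where
  "fern_triangles g as cs f = fern_segs f 0 as \<union> fern_segs f (int (sum_list as + g)) cs"

text \<open>The up-pointing triangles above the axis: those of the two ferns, and the images under the
rotation of their down-pointing ones.\<close>

definition upper_holes :: "nat \<Rightarrow> nat list \<Rightarrow> nat list \<Rightarrow> (int \<times> nat) set" where
  "upper_holes g as cs = fern_triangles g as cs True
     \<union> (\<lambda>(q, b). (2 * int (sum_list as + g + sum_list cs) + 1 - q - int b, b)) ` fern_triangles g as cs False"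

lemma cover_reflect: "cover ((\<lambda>(q, b). (K + 1 - q - int b, b)) ` C) = (\<lambda>i. K - i) ` cover C"
proof -
  have "(\<lambda>i. K - i) ` {q..<q + int b} = {K + 1 - q - int b..<K + 1 - q - int b + int b}" for q b
    by (auto intro!: image_eqI[of _ _ "K - _"])
  then show ?thesis unfolding cover_def by (simp add: image_UN case_prod_beta)
qed

lemma cover_upper_holes:
  "cover (upper_holes g as cs) = cover (fern_triangles g as cs True)
     \<union> (\<lambda>i. 2 * int (sum_list as + g + sum_list cs) - i) ` cover (fern_triangles g as cs False)"
  unfolding upper_holes_def cover_Un cover_reflect ..

lemma fern_triangles_partition:
  "cover (fern_triangles g as cs True) \<union> cover (fern_triangles g as cs False)
      = two_blocks (sum_list as) g (sum_list cs)"
  "cover (fern_triangles g as cs True) \<inter> cover (fern_triangles g as cs False) = {}"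
proof -
  let ?p = "int (sum_list as + g)"
  note A = cover_fern_segs_partition[of 0 as] and B = cover_fern_segs_partition[of ?p cs]
  have U: "cover (fern_segs True 0 as) \<union> cover (fern_segs False 0 as) = {0..<int (sum_list as)}"
    "cover (fern_segs True ?p cs) \<union> cover (fern_segs False ?p cs) = {?p..<?p + int (sum_list cs)}"
    using A B by simp_all
  show "cover (fern_triangles g as cs True) \<union> cover (fern_triangles g as cs False)
      = two_blocks (sum_list as) g (sum_list cs)"
    unfolding fern_triangles_def cover_Un two_blocks_def using U by auto
  have "{0..<int (sum_list as)} \<inter> {?p..<?p + int (sum_list cs)} = {}" by auto
  then show "cover (fern_triangles g as cs True) \<inter> cover (fern_triangles g as cs False) = {}"
    unfolding fern_triangles_def cover_Un using A B U by blast
qed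

lemma fern_triangles_bounds:
  assumes "(p, b) \<in> fern_triangles g as cs f"
  shows "0 \<le> p \<and> p + int b \<le> int (sum_list as + g + sum_list cs) \<and> b \<le> sum_list as + sum_list cs"
proof -
  from assms consider "(p, b) \<in> fern_segs f 0 as" | "(p, b) \<in> fern_segs f (int (sum_list as + g)) cs"
    unfolding fern_triangles_def by blast
  then show ?thesis by cases (drule fern_segs_bounds; force)+
qed

lemma upper_holes_bounds:
  assumes "(p, b) \<in> upper_holes g as cs"
  shows "0 \<le> p \<and> p + int b \<le> 2 * int (sum_list as + g + sum_list cs) + 1 \<and> b \<le> sum_list as + sum_list cs"
proof -
  from assms consider "(p, b) \<in> fern_triangles g as cs True"
    | q where "(q, b) \<in> fern_triangles g as cs False" "p = 2 * int (sum_list as + g + sum_list cs)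
        + 1 - q - int b"
    unfolding upper_holes_def by auto
  then show ?thesis
  proof cases
    case 1
    then show ?thesis using fern_triangles_bounds[OF 1] by auto
  next
    case (2 q)
    then show ?thesis using fern_triangles_bounds[OF 2(1)] by auto
  qed
qed

context
  fixes a g c :: nat and Q Q' :: "int set"
  assumes Q: "Q \<union> Q' = two_blocks a g c" "Q \<inter> Q' = {}"
begin

lemma less_center: "i \<in> Q \<union> Q' \<Longrightarrow> 0 \<le> i \<and> i < int (a + g + c)"
  unfolding Q two_blocks_def by auto

lemma reflected_blocks:
  "Q \<inter> (\<lambda>i. 2 * int (a + g + c) - i) ` Q' = {}"
  "card (Q \<union> (\<lambda>i. 2 * int (a + g + c) - i) ` Q') = a + c" "finite Q" "finite Q'"
proof -
  have fin: "finite (Q \<union> Q')" unfolding Q two_blocks_def by simp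
  then show f: "finite Q" "finite Q'" by auto
  show dj: "Q \<inter> (\<lambda>i. 2 * int (a + g + c) - i) ` Q' = {}"
  proof (rule ccontr)
    assume "Q \<inter> (\<lambda>i. 2 * int (a + g + c) - i) ` Q' \<noteq> {}"
    then obtain i where "i \<in> Q'" "2 * int (a + g + c) - i \<in> Q" by auto
    then show False using less_center[of i] less_center[of "2 * int (a + g + c) - i"] by auto
  qed
  have "card (Q \<union> (\<lambda>i. 2 * int (a + g + c) - i) ` Q') = card Q + card Q'"
    using f dj by (simp add: card_Un_disjoint card_image inj_on_def)
  also have "\<dots> = card (Q \<union> Q')" using f Q(2) by (simp add: card_Un_disjoint)
  also have "\<dots> = a + c" unfolding Q two_blocks_def by (subst card_Un_disjoint) auto
  finally show "card (Q \<union> (\<lambda>i. 2 * int (a + g + c) - i) ` Q') = a + c" .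
qed

lemma gap_positions_reflected:
  "gap_positions a g c = {i \<in> {0..2 * int (a + g + c)} - (Q \<union> (\<lambda>i. 2 * int (a + g + c) - i) ` Q').
     2 * int (a + g + c) - i \<in> {0..2 * int (a + g + c)} - (Q \<union> (\<lambda>i. 2 * int (a + g + c) - i) ` Q')}"
proof -
  have "i \<in> (\<lambda>i. 2 * int (a + g + c) - i) ` Q' \<longleftrightarrow> 2 * int (a + g + c) - i \<in> Q'" for i
    by (auto intro!: image_eqI[of _ _ "2 * int (a + g + c) - i"])
  then show ?thesis unfolding gap_positions_def Q(1)[symmetric] by auto
qed

text \<open>For every position of the two blocks, \<open>U\<close> contains either the position or its mirror image, so
its interaction with a symmetric \<open>S\<close> is that of the two blocks.\<close>

lemma sum_symmetric_dents:
  fixes n y :: nat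
  assumes n: "n = a + c + y"
  defines "U \<equiv> Q \<union> (\<lambda>i. 2 * int (a + g + c) - i) ` Q'"
  shows "(\<Sum>S | S \<subseteq> gap_positions a g c \<and> (\<lambda>i. 2 * int (a + g + c) - i) ` S = S \<and> card U + card S
      = n. vandermonde (U \<union> S))
     = vandermonde U * gap_sum a g c y"
proof -
  have "{S. S \<subseteq> gap_positions a g c \<and> (\<lambda>i. 2 * int (a + g + c) - i) ` S = S \<and> card U + card S = n}
     = {S. S \<subseteq> gap_positions a g c \<and> (\<lambda>i. 2 * int (a + g + c) - i) ` S = S \<and> card S = y}"
    unfolding U_def reflected_blocks(2) n by auto
  moreover have "vandermonde (U \<union> S) = vandermonde U * (vandermonde S
      * (\<Prod>p\<in>two_blocks a g c. \<Prod>t\<in>S. \<bar>of_int t - of_int p\<bar>))"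
    if S: "S \<subseteq> gap_positions a g c" "(\<lambda>i. 2 * int (a + g + c) - i) ` S = S" for S
  proof -
    have "finite S"
      by (rule finite_subset[OF S(1)], rule finite_subset[of _ "{0..2 * int (a + g
          + c)}"]) (auto simp: gap_positions_def)
    moreover have "U \<inter> S = {}" using S(1) unfolding gap_positions_reflected U_def by auto
    ultimately show ?thesis
      unfolding U_def Q(1)[symmetric]
      by (intro vandermonde_union_symmetric reflected_blocks Q(2) S(2)) auto
  qed
  ultimately show ?thesis unfolding gap_sum_def sum_distrib_left by (auto intro!: sum.cong)
qed

end

section \<open>The two regions and the sequence count\<close>

lemma in_rot_image: "t \<in> rot z ` X \<longleftrightarrow> rot z t \<in> X"
proof
  assume "rot z t \<in> X"
  then have "rot z (rot z t) \<in> rot z ` X" by (rule imageI)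
  then show "t \<in> rot z ` X" by simp
qed auto

lemma rot_above: "above h (rot (z1, 2 * h) t) \<longleftrightarrow> \<not> above h t"
  by (cases t rule: unit_triangle.exhaust) auto

text \<open>\<open>F\<close> and \<open>G\<close> are the parts of the ferns above the axis and of the rotated ferns above the axis.
Removing the ferns and their images removes \<open>F \<union> G\<close> from the upper half, and the image of this set
from the lower half.\<close>

lemma symmetric_region:
  fixes T F G :: region and h z1 :: int
  assumes T: "\<And>t. t \<in> T \<Longrightarrow> above h t" and F: "\<And>t. t \<in> F \<Longrightarrow> above h t" and G: "\<And>t. t \<in> G \<Longrightarrow> above h t"
  defines "r \<equiv> (`) (rot (z1, 2 * h))"
  shows "T \<union> r T - (F \<union> r G) - r (F \<union> r G) = (T - (F \<union> G)) \<union> r (T - (F \<union> G))"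
proof (rule Set.set_eqI)
  fix t
  let ?t' = "rot (z1, 2 * h) t"
  have mem: "t \<in> r X \<longleftrightarrow> ?t' \<in> X" for X unfolding r_def by (rule in_rot_image)
  have mem': "?t' \<in> r X \<longleftrightarrow> t \<in> X" for X unfolding r_def in_rot_image by simp
  have "?t' \<notin> T" "?t' \<notin> F" "?t' \<notin> G" if "above h t" using T F G that rot_above by blast+
  moreover have "t \<notin> T" "t \<notin> F" "t \<notin> G" if "\<not> above h t" using T F G that by blast+
  ultimately show "t \<in> T \<union> r T - (F \<union> r G) - r (F \<union> r G) \<longleftrightarrow> t \<in> (T - (F \<union> G)) \<union> r (T - (F \<union> G))"
    by (cases "above h t") (auto simp: mem mem')
qed

lemma trap_above: "t \<in> trap h n e \<Longrightarrow> above h t"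
  by (cases t rule: unit_triangle.exhaust) auto

lemma up_triangles_above: "t \<in> up_triangles h C \<Longrightarrow> above h t"
  by (cases t rule: unit_triangle.exhaust) (auto simp: up_triangles_iff)

lemma up_triangles_Un: "up_triangles h (C \<union> C') = up_triangles h C \<union> up_triangles h C'"
  by (simp add: up_triangles_def)

lemma rot_up_triangle:
  "rot (z1, z2) ` up_triangle (p, h) b = down_triangle (z1 - p - int b, z2 - h) b"
  by (rule region_eqI) (auto simp: in_rot_image up_triangle_iff down_triangle_iff)

lemma fern_eq:
  "fern (p, h) ns = up_triangles h (fern_segs True p ns)
     \<union> (\<Union>(q, b)\<in>fern_segs False p ns. down_triangle (q, h) b)"
proof (rule Set.set_eqI)
  fix t
  have "t \<in> up_triangles h (fern_segs True p ns) \<longleftrightarrow> (\<exists>l<length ns. even l \<and> t \<in> up_triangle (p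
      + int (sum_list (take l ns)), h) (ns ! l))"
    unfolding up_triangles_def fern_segs_nth by auto
  moreover have "t \<in> (\<Union>(q, b)\<in>fern_segs False p ns. down_triangle (q, h) b) \<longleftrightarrow> (\<exists>l<length ns. odd l
      \<and> t \<in> down_triangle (p + int (sum_list (take l ns)), h) (ns ! l))"
    unfolding fern_segs_nth by auto
  moreover have "t \<in> (if even l then up_triangle else down_triangle) q b \<longleftrightarrow> even l \<and> t \<in> up_triangle q b
      \<or> odd l \<and> t \<in> down_triangle q b"
    for l :: nat and q b by simp
  then have "t \<in> fern (p, h) ns \<longleftrightarrow> (\<exists>l<length ns. even l \<and> t \<in> up_triangle (p
      + int (sum_list (take l ns)), h) (ns ! l))
      \<or> (\<exists>l<length ns. odd l \<and> t \<in> down_triangle (p + int (sum_list (take l ns)), h) (ns ! l))"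
    unfolding fern_def UN_iff fst_conv snd_conv Bex_def lessThan_iff by blast
  ultimately show "t \<in> fern (p, h) ns \<longleftrightarrow> t \<in> up_triangles h (fern_segs True p ns)
     \<union> (\<Union>(q, b)\<in>fern_segs False p ns. down_triangle (q, h) b)"
    by simp
qed

lemma down_triangles_reflect:
  "(\<Union>(q, b)\<in>C. down_triangle (q, h) b) = rot (z1, 2 * h) ` up_triangles h ((\<lambda>(q, b). (z1 - q - int b, b)) ` C)"
proof -
  have "rot (z1, 2 * h) ` up_triangle (z1 - q - int b, h) b = down_triangle (q, h) b" for q b
    unfolding rot_up_triangle by simp
  then show ?thesis unfolding up_triangles_def by (simp add: image_UN case_prod_beta)
qed

lemma hexagon_eq:
  assumes "int x + int y = 2 * int g + 1"
  shows "hexagon (x + a + c) (y + a + c) (y + a + c)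
    = trap 0 (y + a + c) (x + a + c) \<union> rot (2 * int (a + g + c) + 1, 2 * 0) ` trap 0 (y + a + c) (x + a + c)"
  by (rule region_eqI) (use assms in \<open>auto simp: hexagon_def region_of_def in_rot_image\<close>)

lemma E_region_eq:
  fixes x y g :: nat and as cs :: "nat list"
  assumes "odd (x + y)" and g: "g = (x + y - 1) div 2"
  defines "M \<equiv> int (sum_list as + g + sum_list cs)"
    and "A \<equiv> trap 0 (y + sum_list as + sum_list cs) (x + sum_list as
        + sum_list cs) - up_triangles 0 (upper_holes g as cs)"
  shows "E_center x y as cs = (2 * M + 1, 2 * 0)"
    "E_region x y as cs = A \<union> rot (2 * M + 1, 2 * 0) ` A"
proof -
  have xy: "int x + int y = 2 * int g + 1" using assms(1) g by (auto elim!: oddE)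
  show center: "E_center x y as cs = (2 * M + 1, 2 * 0)"
    using xy by (simp add: E_center_def M_def)
  let ?T = "trap 0 (y + sum_list as + sum_list cs) (x + sum_list as + sum_list cs)"
  let ?R = "(\<lambda>(q, b). (2 * M + 1 - q - int b, b)) ` fern_triangles g as cs False"
  let ?F = "up_triangles 0 (fern_triangles g as cs True)" and ?G = "up_triangles 0 ?R"
  have "fern (0, 0) as \<union> fern (int (sum_list as + (x + y - 1) div 2), 0) cs
     = ?F \<union> (\<Union>(q, b)\<in>fern_triangles g as cs False. down_triangle (q, 0) b)"
    unfolding fern_eq fern_triangles_def up_triangles_Un g[symmetric] by blast
  also have "(\<Union>(q, b)\<in>fern_triangles g as cs False. down_triangle (q, 0) b) = rot (2 * M + 1, 2 * 0) ` ?G"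
    by (rule down_triangles_reflect)
  finally have F: "fern (0, 0) as \<union> fern (int (sum_list as + (x + y - 1) div 2), 0) cs
     = ?F \<union> rot (2 * M + 1, 2 * 0) ` ?G" .
  have "E_region x y as cs = ?T \<union> rot (2 * M + 1, 2 * 0) ` ?T
      - (?F \<union> rot (2 * M + 1, 2 * 0) ` ?G) - rot (2 * M + 1, 2 * 0) ` (?F \<union> rot (2 * M + 1, 2 * 0) ` ?G)"
    unfolding E_region_def Let_def center F hexagon_eq[OF xy] M_def by (simp only: add.assoc)
  also have "\<dots> = (?T - (?F \<union> ?G)) \<union> rot (2 * M + 1, 2 * 0) ` (?T - (?F \<union> ?G))"
    by (rule symmetric_region) (auto intro: trap_above up_triangles_above)
  also have "?T - (?F \<union> ?G) = A"
    unfolding A_def upper_holes_def up_triangles_Un M_def ..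
  finally show "E_region x y as cs = A \<union> rot (2 * M + 1, 2 * 0) ` A" .
qed

text \<open>The upper half of the hexagon is not a trapezoid, but it becomes one when an up-pointing
triangle of side-length \<open>a\<close> is added at its left end. So it is a trapezoid with two holes, just as
if the first fern were one triangle.\<close>

lemma B_region_eq:
  fixes x y a c g :: nat
  assumes "odd (x + y)" and g: "g = (x + y - 1) div 2"
  defines "M \<equiv> int (a + g + c)"
    and "A \<equiv> trap (- int a) (a + y + c) (x + c) - up_triangles (- int a) {(0, a), (int (a + g), c)}"
  shows "B_center (y + 2 * a + c) (x + c) (y + c) = (2 * M + 1, 2 * (- int a))"
    "B_region (y + 2 * a + c) (x + c) (y + c) c = A \<union> rot (2 * M + 1, 2 * (- int a)) ` A"
proof -
  have xy: "int x + int y = 2 * int g + 1" using assms(1) g by (auto elim!: oddE)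
  show center: "B_center (y + 2 * a + c) (x + c) (y + c) = (2 * M + 1, 2 * (- int a))"
    using xy by (simp add: B_center_def M_def)
  let ?r = "rot (2 * M + 1, 2 * (- int a))"
  let ?T = "trap (- int a) (a + y + c) (x + c)"
  let ?K = "up_triangle (0, - int a) a" and ?F = "up_triangle (int (a + g), - int a) c"
  have height: "(int (y + c) - int (y + 2 * a + c)) div 2 = - int a" by simp
  have left: "(int (y + 2 * a + c) + int (x + c) - 1) div 2 - int c = int (a + g)"
    and right: "(int (y + 2 * a + c) + int (x + c) + 1) div 2 = M + 1"
    using xy by (simp_all add: M_def)
  \<comment> \<open>\<open>?K\<close> is the triangle that completes the upper half to a trapezoid.\<close>
  have hex: "hexagon (x + c) (y + 2 * a + c) (y + c) = (?T - ?K) \<union> ?r ` (?T - ?K)"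
    by (rule region_eqI) (use xy in \<open>auto simp: hexagon_def region_of_def in_rot_image up_triangle_iff M_def\<close>)
  have down: "down_triangle (M + 1, - int a) c = ?r ` ?F"
    unfolding rot_up_triangle by (simp add: M_def add_ac)
  have above: "above (- int a) t" if "t \<in> ?T - ?K \<or> t \<in> ?F" for t
    using that by (cases t rule: unit_triangle.exhaust) (auto simp: up_triangle_iff)
  have "B_region (y + 2 * a + c) (x + c) (y + c) c
     = (?T - ?K) \<union> ?r ` (?T - ?K) - (?F \<union> ?r ` {}) - ?r ` (?F \<union> ?r ` {})"
    unfolding B_region_def Let_def height left right hex down by simp
  also have "\<dots> = (?T - ?K - (?F \<union> {})) \<union> ?r ` (?T - ?K - (?F \<union> {}))"
    by (rule symmetric_region) (use above in auto)
  also have "?T - ?K - (?F \<union> {}) = A"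
    unfolding A_def up_triangles_def by auto
  finally show "B_region (y + 2 * a + c) (x + c) (y + c) c = A \<union> ?r ` A" .
qed

lemma s_eq_vandermonde:
  "real (s bs) * superfact (card (cover (fern_segs True 0 bs))) = vandermonde (cover (fern_segs True 0 bs))"
proof -
  let ?C = "fern_segs True 0 bs"
  define od e where "od = (\<Sum>l | l < length bs \<and> even l. bs ! l)" and "e = (\<Sum>l | l < length bs \<and> odd l. bs ! l)"
  have card: "card (cover ?C) = od" unfolding card_cover_fern_segs od_def by simp
  have card': "card (cover (fern_segs False 0 bs)) = e" unfolding card_cover_fern_segs e_def by simp
  have fin: "finite (cover (fern_segs f 0 bs))" for f by (rule finite_subset[OF cover_fern_segs_subset]) simp
  have "od + e = card (cover ?C \<union> cover (fern_segs False 0 bs))"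
    unfolding card[symmetric] card'[symmetric]
    by (rule card_Un_disjoint[OF fin fin, symmetric]) (use cover_fern_segs_partition[of 0 bs] in blast)
  also have "\<dots> = sum_list bs" using cover_fern_segs_partition[of 0 bs] by simp
  finally have sum: "od + e = sum_list bs" .
  have bounds: "0 \<le> p \<and> p + int b \<le> int (od + e) \<and> b \<le> od" if pb: "(p, b) \<in> ?C" for p b
  proof -
    have "card {p..<p + int b} \<le> card (cover ?C)"
      by (rule card_mono[OF fin]) (use pb in \<open>force simp: cover_def\<close>)
    then show ?thesis using fern_segs_bounds[OF pb] sum card by simp
  qed
  have "trapezoid e od = trap 0 od e"
    by (rule region_eqI) (auto simp: trapezoid_def region_of_def)
  moreover have "(\<Union>l\<in>{l. l < length bs \<and> even l}. up_triangle (int (sum_list (take l bs)), 0) (bs ! l))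
      = up_triangles 0 ?C"
    unfolding up_triangles_def fern_segs_nth by auto
  ultimately have "S_region bs = trap 0 od e - up_triangles 0 ?C - ups 0 {}"
    by (simp add: S_region_def Let_def od_def e_def ups_def)
  then show ?thesis
    using num_tilings_trap_holes[of ?C od e "{}" 0, OF bounds] card unfolding s_def by simp
qed

text \<open>In the list of \<open>\<sigma>\<close> the entries after \<open>last cs + 1\<close> describe the rotated ferns, with up- and
down-pointing triangles exchanged. The unit segment at the centre is absorbed by \<open>last cs + 1\<close>, and
where two down-pointing pieces and a gap meet, their lengths are added, so that up-pointing
triangles are exactly at the even places.\<close>

lemma fern_segs_doubled_ferns:
  assumes as: "odd (length as)" and cs: "even (length cs)" "cs \<noteq> []"
  shows "fern_segs True 0 (as @ [g] @ butlast cs @ [last cs + 1] @ rev (tl cs) @ [hd cs + g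
      + last as] @ rev (butlast as))
    = upper_holes g as cs"
proof -
  let ?a = "sum_list as" and ?c = "sum_list cs"
  have as_ne: "as \<noteq> []" using as by auto
  define as' l where "as' = butlast as" and "l = last as"
  have asl: "as = as' @ [l]" using as_ne by (simp add: as'_def l_def)
  define cs' k where "cs' = butlast cs" and "k = last cs"
  have csk: "cs = cs' @ [k]" using cs(2) by (simp add: cs'_def k_def)
  define h0 ct where "h0 = hd cs" and "ct = tl cs"
  have csh: "cs = h0 # ct" using cs(2) by (simp add: h0_def ct_def)
  have par: "even (length as')" "odd (length cs')" "odd (length ct)"
    using as cs arg_cong[OF asl, of length] arg_cong[OF csk, of length] arg_cong[OF csh, of length] by simp_all
  have sums: "?a = sum_list as' + l" "?c = sum_list cs' + k" "?c = h0 + sum_list ct"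
    using arg_cong[OF asl, of sum_list] arg_cong[OF csk, of sum_list] arg_cong[OF csh, of sum_list] by simp_all
  let ?p1 = "int (?a + g + ?c) + 1" and ?p2 = "int (?a + g + ?c) + 1 + int ?c + int g + int l"
  have "fern_segs True 0 (as @ [g] @ cs' @ [k + 1] @ rev ct @ [h0 + g + l] @ rev as')
     = fern_segs True 0 as \<union> fern_segs True (int (?a + g)) cs'
       \<union> fern_segs True (int (?a + g) + int (sum_list cs') + int (k + 1)) (rev ct)
       \<union> fern_segs True (int (?a + g) + int (sum_list cs') + int (k + 1) + int (sum_list ct) + int (h0 + g
           + l)) (rev as')"
    using as par by (simp add: fern_segs_append add_ac Un_assoc)
  also have "int (?a + g) + int (sum_list cs') + int (k + 1) = ?p1" using sums(2) by simp
  also have "?p1 + int (sum_list ct) + int (h0 + g + l) = ?p2" using sums(3) by simp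
  also have "fern_segs True (int (?a + g)) cs' = fern_segs True (int (?a + g)) cs"
    using arg_cong[OF csk, of "fern_segs True (int (?a + g))"] par by (simp add: fern_segs_append)
  also have "fern_segs True ?p1 (rev ct) = (\<lambda>(q, b). (2 * int (?a + g + ?c)
      + 1 - q - int b, b)) ` fern_segs False (int (?a + g)) cs"
  proof -
    have "fern_segs True ?p1 (rev ct) = (\<lambda>(q, b). (?p1 + (int (?a + g) + int h0)
        + int (sum_list ct) - q - int b, b))
        ` fern_segs (True = odd (length ct)) (int (?a + g) + int h0) ct"
      by (rule fern_segs_rev)
    also have "fern_segs (True = odd (length ct)) (int (?a + g) + int h0) ct = fern_segs False (int (?a
        + g)) cs"
      using arg_cong[OF csh, of "fern_segs False (int (?a + g))"] par by simp
    also have "?p1 + (int (?a + g) + int h0) + int (sum_list ct) = 2 * int (?a + g + ?c) + 1"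
      using sums(3) by simp
    finally show ?thesis .
  qed
  also have "fern_segs True ?p2 (rev as') = (\<lambda>(q, b). (2 * int (?a + g + ?c)
      + 1 - q - int b, b)) ` fern_segs False 0 as"
  proof -
    have "fern_segs True ?p2 (rev as') = (\<lambda>(q, b). (?p2 + 0 + int (sum_list as') - q - int b, b))
        ` fern_segs (True = odd (length as')) 0 as'"
      by (rule fern_segs_rev)
    also have "fern_segs (True = odd (length as')) 0 as' = fern_segs False 0 as"
      using arg_cong[OF asl, of "fern_segs False 0"] par by (simp add: fern_segs_append)
    also have "?p2 + 0 + int (sum_list as') = 2 * int (?a + g + ?c) + 1"
      using sums(1) by simp
    finally show ?thesis .
  qed
  finally show ?thesis
    unfolding as'_def l_def cs'_def k_def h0_def ct_def upper_holes_def fern_triangles_def image_Un by blast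
qed

section \<open>Counting the centrally symmetric tilings\<close>

lemma Mc_E_region:
  fixes x y g :: nat and as cs :: "nat list"
  assumes xy: "odd (x + y)" and g: "g = (x + y - 1) div 2"
  defines "U \<equiv> cover (upper_holes g as cs)"
  shows "real (Mc (E_center x y as cs) (E_region x y as cs)) * superfact (sum_list as + sum_list cs + y)
    = vandermonde U * gap_sum (sum_list as) g (sum_list cs) y"
    and "card U = sum_list as + sum_list cs"
proof -
  let ?a = "sum_list as" and ?c = "sum_list cs"
  let ?M = "int (?a + g + ?c)"
  let ?Q = "cover (fern_triangles g as cs True)" and ?Q' = "cover (fern_triangles g as cs False)"
  note part = fern_triangles_partition[of g as cs]
  have U: "U = ?Q \<union> (\<lambda>i. 2 * ?M - i) ` ?Q'" unfolding U_def cover_upper_holes ..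
  show card: "card U = ?a + ?c" unfolding U by (rule reflected_blocks(2)[OF part])
  have width: "int (y + ?a + ?c + (x + ?a + ?c)) = 2 * ?M + 1"
    using xy g by (auto elim!: oddE)
  have ivl: "{0..<2 * ?M + 1} = {0..2 * ?M}" by auto
  have "real (Mc (E_center x y as cs) (E_region x y as cs)) * superfact (y + ?a + ?c)
    = (\<Sum>S | S \<subseteq> {i \<in> {0..<int (y + ?a + ?c + (x + ?a + ?c))} - U. 2 * ?M - i \<in> {0..<int (y + ?a + ?c + (x
        + ?a + ?c))} - U}
        \<and> (\<lambda>i. 2 * ?M - i) ` S = S \<and> card U + card S = y + ?a + ?c. vandermonde (U \<union> S))"
    unfolding E_region_eq[OF xy g] U_def
    by (rule Mc_trap_holes) (drule upper_holes_bounds, use width in linarith)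
  also have "\<dots> = (\<Sum>S | S \<subseteq> gap_positions ?a g ?c \<and> (\<lambda>i. 2 * ?M - i) ` S = S \<and> card U + card S = y + ?a
      + ?c. vandermonde (U \<union> S))"
    unfolding width ivl gap_positions_reflected[OF part] U ..
  also have "\<dots> = vandermonde U * gap_sum ?a g ?c y"
    unfolding U by (rule sum_symmetric_dents[OF part]) simp
  finally show "real (Mc (E_center x y as cs) (E_region x y as cs)) * superfact (?a + ?c + y)
      = vandermonde U * gap_sum ?a g ?c y"
    by (simp add: add_ac)
qed

lemma Mc_B_region:
  fixes x y a c g :: nat
  assumes xy: "odd (x + y)" and g: "g = (x + y - 1) div 2"
  shows "real (Mc (B_center (y + 2 * a + c) (x + c) (y + c)) (B_region (y + 2 * a + c) (x + c) (y + c) c))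
    = PP a g c * superfact (a + c) * gap_sum a g c y / superfact (a + c + y)"
proof -
  let ?M = "int (a + g + c)" and ?P = "two_blocks a g c"
  let ?C = "{(0, a), (int (a + g), c)}"
  have part: "?P \<union> {} = ?P" "?P \<inter> {} = {}" by simp_all
  have cov: "cover ?C = ?P" by (simp add: cover_def two_blocks_def)
  have card: "card ?P = a + c" using reflected_blocks(2)[OF part] by simp
  have width: "int (a + y + c + (x + c)) = 2 * ?M + 1 - int a"
    using xy g by (auto elim!: oddE)
  have gp: "{i \<in> {0..<2 * ?M + 1 - int a} - ?P. 2 * ?M - i \<in> {0..<2 * ?M + 1 - int a} - ?P}
      = gap_positions a g c"
    unfolding gap_positions_def by (auto simp: two_blocks_def)
  have "real (Mc (B_center (y + 2 * a + c) (x + c) (y + c)) (B_region (y + 2 * a + c) (x + c) (y + c) c))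
      * superfact (a + y + c)
    = (\<Sum>S | S \<subseteq> {i \<in> {0..<int (a + y + c + (x + c))} - cover ?C. 2 * ?M - i \<in> {0..<int (a + y + c + (x
        + c))} - cover ?C}
        \<and> (\<lambda>i. 2 * ?M - i) ` S = S \<and> card (cover ?C) + card S = a + y + c. vandermonde (cover ?C \<union> S))"
    unfolding B_region_eq[OF xy g] by (rule Mc_trap_holes) (use width in auto)
  also have "\<dots> = (\<Sum>S | S \<subseteq> gap_positions a g c \<and> (\<lambda>i. 2 * ?M - i) ` S = S \<and> card ?P + card S = a + y
      + c. vandermonde (?P \<union> S))"
    unfolding width cov gp ..
  also have "\<dots> = vandermonde ?P * gap_sum a g c y"
    using sum_symmetric_dents[OF part, of "a + y + c" y] by simp
  also have "vandermonde ?P = PP a g c * superfact (a + c)" by (rule vandermonde_two_blocks)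
  finally show ?thesis by (simp add: field_simps)
qed

text \<open>Both counts contain the same gap sum, which cancels in the quotient.\<close>

lemma Mc_E_region_eq_Mc_B_region:
  assumes "odd (length as)" "even (length cs)" "cs \<noteq> []"
    and xy: "odd (x + y)" and g: "g = (x + y - 1) div 2"
  shows "real (Mc (E_center x y as cs) (E_region x y as cs))
    = real (s (as @ [g] @ butlast cs @ [last cs + 1] @ rev (tl cs) @ [hd cs + g + last as] @ rev (butlast as)))
      / PP (sum_list as) g (sum_list cs)
      * real (Mc (B_center (y + 2 * sum_list as + sum_list cs) (x + sum_list cs) (y + sum_list cs))
          (B_region (y + 2 * sum_list as + sum_list cs) (x + sum_list cs) (y + sum_list cs) (sum_list cs)))"
proof -
  let ?a = "sum_list as" and ?c = "sum_list cs"
  let ?\<sigma> = "real (s (as @ [g] @ butlast cs @ [last cs + 1] @ rev (tl cs) @ [hd cs + g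
      + last as] @ rev (butlast as)))"
  let ?U = "cover (upper_holes g as cs)"
  have "?\<sigma> * superfact (?a + ?c) = vandermonde ?U"
    using s_eq_vandermonde[of "as @ [g] @ butlast cs @ [last cs + 1] @ rev (tl cs) @ [hd cs + g
        + last as] @ rev (butlast as)"]
    unfolding fern_segs_doubled_ferns[OF assms(1-3)] Mc_E_region(2)[OF xy g] .
  then have "real (Mc (E_center x y as cs) (E_region x y as cs)) * superfact (?a + ?c + y)
    = ?\<sigma> * superfact (?a + ?c) * gap_sum ?a g ?c y"
    using Mc_E_region(1)[OF xy g, of as cs] by simp
  moreover have "PP ?a g ?c \<noteq> 0" using PP_pos[of ?a g ?c] by simp
  ultimately show ?thesis
    unfolding Mc_B_region[OF xy g] by (simp add: field_simps)
qed

(* In the even x, odd y case the published product reads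
     prod_{i=0}^{(y-1)/2} ((y+2a+1)/2+i)_c / (c+i+1)_c
   and has (2c+i+1)_{(y+2c+1)/2} as its last denominator. This is a misprint: for
   x = 2, y = 1, a = c = 0 it evaluates to 1/2, whereas the tiling counts are integers
   and PP and the sequence count equal 1. The factors below are the corrected ones. *)
theorem theorem2p5:
  fixes x y a c g \<sigma> :: nat and as cs :: "nat list"
  assumes "odd (length as)"
    and "even (length cs)" and "cs \<noteq> []"
    and "a = sum_list as" and "c = sum_list cs"
    and "g = (x + y - 1) div 2"
    and "\<sigma> = s (as @ [g] @ butlast cs @ [last cs + 1] @ rev (tl cs)
                 @ [hd cs + g + last as] @ rev (butlast as))"
  shows
    "(odd x \<and> even y \<longrightarrow>
       real (Mc (E_center x y as cs) (E_region x y as cs))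
         = real \<sigma> / PP a g c
           * real (Mc (B_center (y + 2*a + c) (x + c) (y + c)) (B_region (y + 2*a + c) (x + c) (y + c) c))
       \<and> real \<sigma> / PP a g c
           * real (Mc (B_center (y + 2*a + c) (x + c) (y + c)) (B_region (y + 2*a + c) (x + c) (y + c) c))
         = real \<sigma> / PP a g c
           * PP ((x + 2*c + 1) div 2) (y div 2) c
           * (\<Prod>i=1..(x - 1) div 2.
                pochhammer ((real y + 2 * real a) / 2 + real i) c / pochhammer (real i) c)
           * (\<Prod>i=1..y div 2.
                pochhammer ((real y + 2 * real a + 2 * real c) / 2 + real i) ((x - 1) div 2)
                  / pochhammer (real c + real i) ((x - 1) div 2)
                * (pochhammer ((real y + 2 * real a + 2 * real c) / 2 + real i) ((x + 2*c + 1) div 2)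
                  / pochhammer (real c + real i) ((x + 2*c + 1) div 2))))
     \<and>
     (even x \<and> odd y \<longrightarrow>
       real (Mc (E_center x y as cs) (E_region x y as cs))
         = real \<sigma> / PP a g c
           * real (Mc (B_center (y + 2*a + c) (x + c) (y + c)) (B_region (y + 2*a + c) (x + c) (y + c) c))
       \<and> real \<sigma> / PP a g c
           * real (Mc (B_center (y + 2*a + c) (x + c) (y + c)) (B_region (y + 2*a + c) (x + c) (y + c) c))
         = real \<sigma> / PP a g c
           * PP ((x + 2*c) div 2) ((y - 1) div 2) (c + 1)
           * (\<Prod>i=1..(y - 1) div 2.
                pochhammer ((real y + 2 * real a + 2 * real c + 1) / 2 + real i) c
                  / pochhammer (real c + real i + 1) c)
           * (\<Prod>i=1..x div 2.
                pochhammer ((real y + 2 * real a - 1) / 2 + real i) ((y + 2*c + 1) div 2)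
                  / pochhammer (real i) ((y + 2*c + 1) div 2)
                * (pochhammer ((real y + 2 * real a + 2 * real c + 1) / 2 + real c + real i) ((y - 1) div 2)
                  / pochhammer (2 * real c + real i + 1) ((y - 1) div 2))))"
proof -
  let "(_ \<longrightarrow> ?E = ?F \<and> _ = ?R) \<and> (_ \<longrightarrow> _ \<and> _ = ?R')" = ?thesis
  have red: "(P \<longrightarrow> E = F \<and> F = R) \<and> (P' \<longrightarrow> E = F \<and> F = R')"
    if "P \<or> P' \<Longrightarrow> E = F" "P \<Longrightarrow> F = R" "P' \<Longrightarrow> F = R'" for P P' and E F R R' :: real
    using that by blast
  show ?thesis
  proof (rule red)
    assume "odd x \<and> even y \<or> even x \<and> odd y"
    then have "odd (x + y)" by auto
    then show "?E = ?F"
      unfolding assms(4,5,7) by (rule Mc_E_region_eq_Mc_B_region[OF assms(1-3) _ assms(6)])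
  next
    assume xy: "odd x \<and> even y"
    then obtain X n where X: "x = 2 * X + 1" and n: "y = 2 * n" by (auto elim!: oddE evenE)
    have odd: "odd (x + y)" using xy by simp
    have g: "g = X + n" and hx: "(x + 2 * c + 1) div 2 = X + c + 1" "(x - 1) div 2 = X" "y div 2 = n"
      unfolding assms(6) X n by simp_all
    have r: "(real y + 2 * real a) / 2 + real i = real (n + a) + real i"
      "(real y + 2 * real a + 2 * real c) / 2 + real i = real (n + a + c) + real i" for i
      unfolding n by simp_all
    show "?F = ?R"
      unfolding r hx Mc_B_region[OF odd assms(6)] unfolding g n central_count_even by (simp only: mult.assoc)
  next
    assume xy: "even x \<and> odd y"
    then obtain X n where X: "x = 2 * X" and n: "y = 2 * n + 1" by (auto elim!: oddE evenE)
    have odd: "odd (x + y)" using xy by simp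
    have g: "g = X + n" and hx: "(x + 2 * c) div 2 = X + c" "(y - 1) div 2 = n" "x div 2 = X" "(y + 2 * c + 1) div 2 = n + c + 1"
      unfolding assms(6) X n by simp_all
    have r: "(real y + 2 * real a + 2 * real c + 1) / 2 + real i = real (n + a + c + 1) + real i"
      "real c + real i + 1 = real (c + 1) + real i"
      "(real y + 2 * real a - 1) / 2 + real i = real (n + a) + real i"
      "(real y + 2 * real a + 2 * real c + 1) / 2 + real c + real i = real (n + a + 2 * c + 1) + real i"
      "2 * real c + real i + 1 = real (2 * c + 1) + real i" for i
      unfolding n by (simp_all add: field_simps)
    show "?F = ?R'"
      \<comment> \<open>The fourth equation comes first, as the first one also matches a part of its left-hand side.\<close>
      unfolding r(4) unfolding r hx Mc_B_region[OF odd assms(6)] unfolding g n central_count_odd by (simp only: mult.assoc)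
  qed
qed

end
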